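(* Let $T>0$ and let $\{k_n(t)\}_{n\ge1}$ be a sequence of integer-valued, non-decreasing, right-continuous functions on $[0,T]$ with $k_n(0)=0$ for all $n\ge1$. Let $a:[0,T]\to\mathbb{R}_+$ satisfy Assumption (Time-change). Suppose $\{X_{n,i}\}$ is a martingale difference array such that for each $t\in[0,T]$, as $n\to\infty$: (1) $\max_{i\le k_n(t)}|X_{n,i}|\to0$ in $L^2$; (2) $\sum_{i=1}^{k_n(t)}X_{n,i}^2\to a(t)$ in probability. Let $S_n(t)=\sum_{i=1}^{k_n(t)}X_{n,i}$ for $t\in[0,T]$. Then, as $n\to\infty$, $$\{S_n(t)\}_{t\in[0,T]}\Rightarrow\{B^1_{a(t)}\}_{t\in[0,T]}$$ weakly on the Skorohod space $D[0,T]$, where $B^1$ is a one-dimensional standard Brownian motion.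
   Context: $D[0,T]$ is the Skorohod space of càdlàg functions $[0,T]\to\mathbb{R}$. A martingale difference array is an array of real random variables such that, for each $n$, $\{X_{n,i}\}_{i\ge1}$ is a martingale difference sequence with respect to some filtration $\{\mathcal{F}_{n,i}\}_{i\ge0}$. Empty sums are $0$. Assumption (Time-change): $a:[0,T]\to\mathbb{R}_+$ is strictly increasing and continuous with $a(0)=0$; and, for $\delta>0$, with $t_\delta^m=m\delta$ for $0\le m\le\lfloor\delta^{-1}T\rfloor$, $t_\delta^{\lfloor\delta^{-1}T\rfloor+1}=T$, $\tau_m(\delta)=a(t_\delta^{m+1})-a(t_\delta^m)$ and $\tau(\delta)=\sup_{0\le m\le\lfloor\delta^{-1}T\rfloor}\tau_m(\delta)$, one has $\lim_{\delta\to0}\tau(\delta)\log(\delta^{-1})=0$. *)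

theory Defs
  imports "HOL-Probability.Probability" "HOL-Analysis.Abstract_Metric_Spaces"
begin

section \<open>The Skorohod space\<close>

text \<open>A function on \<open>[0,T]\<close> is represented by its extension to \<open>real\<close> that is \<open>undefined\<close>
  outside \<open>[0,T]\<close>, so that two elements are equal iff they agree on \<open>[0,T]\<close>.\<close>

definition skorohod_space :: "real \<Rightarrow> (real \<Rightarrow> real) set" where
  "skorohod_space T = {x \<in> extensional {0..T}.
     (\<forall>t\<in>{0..<T}. (x \<longlongrightarrow> x t) (at_right t)) \<and>
     (\<forall>t\<in>{0<..T}. \<exists>l. (x \<longlongrightarrow> l) (at_left t))}"

definition time_deformations :: "real \<Rightarrow> (real \<Rightarrow> real) set" where
  "time_deformations T = {\<theta>. strict_mono_on {0..T} \<theta> \<and> continuous_on {0..T} \<theta> \<and> \<theta> ` {0..T} = {0..T}}"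

definition skorohod_close :: "real \<Rightarrow> real \<Rightarrow> (real \<Rightarrow> real) \<Rightarrow> (real \<Rightarrow> real) \<Rightarrow> bool" where
  "skorohod_close T \<epsilon> x y \<longleftrightarrow> (\<exists>\<theta>\<in>time_deformations T.
     \<forall>t\<in>{0..T}. \<bar>\<theta> t - t\<bar> \<le> \<epsilon> \<and> \<bar>x t - y (\<theta> t)\<bar> \<le> \<epsilon>)"

text \<open>Skorohod's \<open>J\<^sub>1\<close> metric. The value off the space is irrelevant; it is set to \<open>0\<close> because
  \<^locale>\<open>Metric_space\<close> requires nonnegativity and symmetry on the whole type.\<close>

definition skorohod_dist :: "real \<Rightarrow> (real \<Rightarrow> real) \<Rightarrow> (real \<Rightarrow> real) \<Rightarrow> real" where
  "skorohod_dist T x y =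
     (if x \<in> skorohod_space T \<and> y \<in> skorohod_space T
      then Inf {\<epsilon>. 0 < \<epsilon> \<and> skorohod_close T \<epsilon> x y} else 0)"

definition skorohod_topology :: "real \<Rightarrow> (real \<Rightarrow> real) topology" where
  "skorohod_topology T = Metric_space.mtopology (skorohod_space T) (skorohod_dist T)"

lemma time_deformations_id: "(\<lambda>t. t) \<in> time_deformations T"
  by (auto simp: time_deformations_def strict_mono_on_def)

lemma time_deformations_comp:
  assumes "f \<in> time_deformations T" "g \<in> time_deformations T"
  shows "g \<circ> f \<in> time_deformations T"
proof -
  have f: "strict_mono_on {0..T} f" "continuous_on {0..T} f" "f ` {0..T} = {0..T}"
    and g: "strict_mono_on {0..T} g" "continuous_on {0..T} g" "g ` {0..T} = {0..T}"
    using assms by (auto simp: time_deformations_def)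
  have "strict_mono_on {0..T} (g \<circ> f)"
    unfolding strict_mono_on_def
  proof (intro allI impI)
    fix r s assume "r \<in> {0..T} \<and> s \<in> {0..T} \<and> r < s"
    moreover from this have "f r \<in> {0..T}" "f s \<in> {0..T}" using f(3) by blast+
    ultimately show "(g \<circ> f) r < (g \<circ> f) s"
      using f(1) g(1) by (simp add: strict_mono_on_def)
  qed
  moreover have "continuous_on {0..T} (g \<circ> f)"
    using f(2) g(2) f(3) by (metis continuous_on_compose)
  moreover have "(g \<circ> f) ` {0..T} = {0..T}"
    using f(3) g(3) by (metis image_comp)
  ultimately show ?thesis by (simp add: time_deformations_def)
qed

lemma time_deformations_inv:
  assumes "f \<in> time_deformations T"
  shows "inv_into {0..T} f \<in> time_deformations T"
proof -
  let ?g = "inv_into {0..T} f"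
  have f: "strict_mono_on {0..T} f" "continuous_on {0..T} f" "f ` {0..T} = {0..T}"
    using assms by (auto simp: time_deformations_def)
  have inj: "inj_on f {0..T}" using f(1) by (rule strict_mono_on_imp_inj_on)
  have bij: "bij_betw f {0..T} {0..T}" using inj f(3) by (simp add: bij_betw_def)
  have img: "?g ` {0..T} = {0..T}"
    using bij_betw_inv_into[OF bij] by (simp add: bij_betw_def)
  have "strict_mono_on {0..T} ?g"
    unfolding strict_mono_on_def
  proof (intro allI impI)
    fix r s assume rs: "r \<in> {0..T} \<and> s \<in> {0..T} \<and> r < s"
    have m: "?g r \<in> {0..T}" "?g s \<in> {0..T}" using img rs by blast+
    have e: "f (?g r) = r" "f (?g s) = s" using rs f(3) by (auto intro!: f_inv_into_f)
    show "?g r < ?g s"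
    proof (rule ccontr)
      assume "\<not> ?g r < ?g s"
      then have "?g s < ?g r \<or> ?g s = ?g r" by linarith
      then have "f (?g s) \<le> f (?g r)"
        using m f(1) by (metis strict_mono_onD less_imp_le order_refl)
      then show False using e rs by simp
    qed
  qed
  moreover have "continuous_on (f ` {0..T}) ?g"
    using f(2) by (rule continuous_on_inv) (auto simp: inv_into_f_f[OF inj])
  ultimately show ?thesis using img f(3) by (simp add: time_deformations_def)
qed

lemma time_deformations_end:
  assumes "f \<in> time_deformations T" "0 < T"
  shows "f T = T"
proof -
  have f: "strict_mono_on {0..T} f" "f ` {0..T} = {0..T}"
    using assms by (auto simp: time_deformations_def)
  have "T \<in> f ` {0..T}" using f(2) assms(2) by simp
  then obtain s where s: "s \<in> {0..T}" "f s = T" by auto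
  have "f T \<in> {0..T}" using f(2) assms(2) by fastforce
  show ?thesis
  proof (cases "s = T")
    case False
    then have "f s < f T" using f(1) s assms(2) by (auto simp: strict_mono_on_def)
    then show ?thesis using s \<open>f T \<in> {0..T}\<close> by auto
  qed (use s in simp)
qed

lemma skorohod_close_sym:
  assumes "skorohod_close T \<epsilon> x y"
  shows "skorohod_close T \<epsilon> y x"
proof -
  obtain f where f: "f \<in> time_deformations T"
    and c: "\<And>t. t \<in> {0..T} \<Longrightarrow> \<bar>f t - t\<bar> \<le> \<epsilon> \<and> \<bar>x t - y (f t)\<bar> \<le> \<epsilon>"
    using assms by (auto simp: skorohod_close_def)
  let ?g = "inv_into {0..T} f"
  have fi: "f ` {0..T} = {0..T}" using f by (simp add: time_deformations_def)
  have "\<bar>?g t - t\<bar> \<le> \<epsilon> \<and> \<bar>y t - x (?g t)\<bar> \<le> \<epsilon>" if t: "t \<in> {0..T}" for t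
  proof -
    have "?g t \<in> {0..T}" "f (?g t) = t"
      using t fi by (metis inv_into_into, metis f_inv_into_f)
    with c[of "?g t"] show ?thesis by (simp add: abs_minus_commute)
  qed
  then show ?thesis using time_deformations_inv[OF f] unfolding skorohod_close_def by blast
qed

lemma skorohod_close_trans:
  assumes "skorohod_close T \<epsilon> x y" "skorohod_close T \<delta> y z"
  shows "skorohod_close T (\<epsilon> + \<delta>) x z"
proof -
  obtain f where f: "f \<in> time_deformations T"
    and c: "\<And>t. t \<in> {0..T} \<Longrightarrow> \<bar>f t - t\<bar> \<le> \<epsilon> \<and> \<bar>x t - y (f t)\<bar> \<le> \<epsilon>"
    using assms(1) by (auto simp: skorohod_close_def)
  obtain g where g: "g \<in> time_deformations T"
    and d: "\<And>t. t \<in> {0..T} \<Longrightarrow> \<bar>g t - t\<bar> \<le> \<delta> \<and> \<bar>y t - z (g t)\<bar> \<le> \<delta>"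
    using assms(2) by (auto simp: skorohod_close_def)
  have "\<bar>(g \<circ> f) t - t\<bar> \<le> \<epsilon> + \<delta> \<and> \<bar>x t - z ((g \<circ> f) t)\<bar> \<le> \<epsilon> + \<delta>" if t: "t \<in> {0..T}" for t
  proof -
    have "f t \<in> {0..T}" using f t by (auto simp: time_deformations_def)
    from c[OF t] d[OF this] show ?thesis unfolding comp_def by linarith
  qed
  then show ?thesis using time_deformations_comp[OF f g] unfolding skorohod_close_def by blast
qed

lemma skorohod_space_bounded:
  assumes x: "x \<in> skorohod_space T" and T: "0 < T"
  obtains B where "\<And>t. t \<in> {0..T} \<Longrightarrow> \<bar>x t\<bar> \<le> B"
proof -
  define P where "P a b \<longleftrightarrow> (\<exists>B. \<forall>t\<in>{a..b} \<inter> {0..T}. \<bar>x t\<bar> \<le> B)" for a b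
  have bnd: "\<exists>B d. 0 < d \<and> (\<forall>s\<in>{0..T}. t < s \<and> s < t + d \<longrightarrow> \<bar>x s\<bar> \<le> B)"
    if t: "t \<in> {0..T}" for t
  proof (cases "t < T")
    case True
    then have "(x \<longlongrightarrow> x t) (at_right t)" using x t by (auto simp: skorohod_space_def)
    then have "\<forall>\<^sub>F s in at_right t. dist (x s) (x t) < 1" by (rule tendstoD) simp
    then obtain b where b: "b > t" "\<And>s. t < s \<Longrightarrow> s < b \<Longrightarrow> dist (x s) (x t) < 1"
      by (auto simp: eventually_at_right_field)
    then show ?thesis
      by (intro exI[of _ "\<bar>x t\<bar> + 1"] exI[of _ "b - t"]) (force simp: dist_real_def)
  next
    case False
    then show ?thesis by (intro exI[of _ 0] exI[of _ 1]) (use t in auto)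
  qed
  have bnd': "\<exists>B d. 0 < d \<and> (\<forall>s\<in>{0..T}. t - d < s \<and> s < t \<longrightarrow> \<bar>x s\<bar> \<le> B)"
    if t: "t \<in> {0..T}" for t
  proof (cases "0 < t")
    case True
    then have "t \<in> {0<..T}" using t by simp
    then obtain l where "(x \<longlongrightarrow> l) (at_left t)" using x unfolding skorohod_space_def by blast
    then have "\<forall>\<^sub>F s in at_left t. dist (x s) l < 1" by (rule tendstoD) simp
    then obtain b where b: "b < t" "\<And>s. b < s \<Longrightarrow> s < t \<Longrightarrow> dist (x s) l < 1"
      by (auto simp: eventually_at_left_field)
    then show ?thesis
      by (intro exI[of _ "\<bar>l\<bar> + 1"] exI[of _ "t - b"]) (force simp: dist_real_def)
  next
    case False
    then show ?thesis by (intro exI[of _ 0] exI[of _ 1]) (use t in auto)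
  qed
  have "P 0 T"
  proof (rule Bolzano)
    show "0 \<le> T" using T by simp
  next
    fix a b c assume "P a b" "P b c" "a \<le> b" "b \<le> c"
    then obtain B C where "\<forall>t\<in>{a..b} \<inter> {0..T}. \<bar>x t\<bar> \<le> B" "\<forall>t\<in>{b..c} \<inter> {0..T}. \<bar>x t\<bar> \<le> C"
      by (auto simp: P_def)
    then have "\<forall>t\<in>{a..c} \<inter> {0..T}. \<bar>x t\<bar> \<le> max B C"
      by (auto simp: le_max_iff_disj)
    then show "P a c" by (auto simp: P_def)
  next
    fix t assume "0 \<le> t" "t \<le> T"
    then have t: "t \<in> {0..T}" by simp
    obtain B d where B: "0 < d" "\<And>s. s \<in> {0..T} \<Longrightarrow> t < s \<Longrightarrow> s < t + d \<Longrightarrow> \<bar>x s\<bar> \<le> B"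
      using bnd[OF t] by blast
    obtain C e where C: "0 < e" "\<And>s. s \<in> {0..T} \<Longrightarrow> t - e < s \<Longrightarrow> s < t \<Longrightarrow> \<bar>x s\<bar> \<le> C"
      using bnd'[OF t] by blast
    have "P a b" if ab: "a \<le> t" "t \<le> b" "b - a < min d e" for a b
    proof -
      have "\<bar>x s\<bar> \<le> max \<bar>x t\<bar> (max B C)" if s: "s \<in> {a..b} \<inter> {0..T}" for s
      proof -
        consider "s = t" | "t < s" | "s < t" by linarith
        then show ?thesis
        proof cases
          case 2 then have "\<bar>x s\<bar> \<le> B" using B(2)[of s] s ab by auto
          then show ?thesis by simp
        next
          case 3 then have "\<bar>x s\<bar> \<le> C" using C(2)[of s] s ab by auto
          then show ?thesis by simp
        qed simp
      qed
      then show ?thesis unfolding P_def by blast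
    qed
    then show "\<exists>d>0. \<forall>a b. a \<le> t \<and> t \<le> b \<and> b - a < d \<longrightarrow> P a b"
      using B(1) C(1) by (intro exI[of _ "min d e"]) auto
  qed
  then obtain B where "\<forall>t\<in>{0..T}. \<bar>x t\<bar> \<le> B" by (auto simp: P_def)
  then show ?thesis using that by blast
qed

lemma skorohod_close_exists:
  assumes "x \<in> skorohod_space T" "y \<in> skorohod_space T" "0 < T"
  shows "\<exists>\<epsilon>>0. skorohod_close T \<epsilon> x y"
proof -
  obtain B where B: "\<And>t. t \<in> {0..T} \<Longrightarrow> \<bar>x t\<bar> \<le> B"
    using skorohod_space_bounded[OF assms(1,3)] by blast
  obtain C where C: "\<And>t. t \<in> {0..T} \<Longrightarrow> \<bar>y t\<bar> \<le> C"
    using skorohod_space_bounded[OF assms(2,3)] by blast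
  have "0 \<le> B" "0 \<le> C" using B[of 0] C[of 0] assms(3) by auto
  moreover have "\<bar>x t - y t\<bar> \<le> B + C + 1" if "t \<in> {0..T}" for t
    using B[OF that] C[OF that] by linarith
  ultimately have "skorohod_close T (B + C + 1) x y"
    unfolding skorohod_close_def by (intro bexI[OF _ time_deformations_id]) auto
  with \<open>0 \<le> B\<close> \<open>0 \<le> C\<close> show ?thesis by (intro exI[of _ "B + C + 1"]) auto
qed

lemma skorohod_close_limit_eq:
  assumes x: "x \<in> skorohod_space T" and y: "y \<in> skorohod_space T" and T: "0 < T"
    and close: "\<And>\<epsilon>. 0 < \<epsilon> \<Longrightarrow> skorohod_close T \<epsilon> x y"
  shows "x = y"
proof (rule extensionalityI[of _ "{0..T}"])
  show "x \<in> extensional {0..T}" "y \<in> extensional {0..T}"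
    using x y by (auto simp: skorohod_space_def)
next
  fix t assume t: "t \<in> {0..T}"
  show "x t = y t"
  proof (cases "t = T")
    case True
    have "\<bar>x T - y T\<bar> \<le> 0 + \<epsilon>" if e: "0 < \<epsilon>" for \<epsilon>
    proof -
      obtain f where f: "f \<in> time_deformations T" "\<forall>t\<in>{0..T}. \<bar>x t - y (f t)\<bar> \<le> \<epsilon>"
        using close[OF e] unfolding skorohod_close_def by blast
      then have "\<bar>x T - y (f T)\<bar> \<le> \<epsilon>" using T by auto
      then show ?thesis using time_deformations_end[OF f(1) T] by simp
    qed
    then have "\<bar>x T - y T\<bar> \<le> 0" by (rule field_le_epsilon)
    then show ?thesis using True by simp
  next
    case False
    then have tT: "t \<in> {0..<T}" using t by auto
    have xr: "(x \<longlongrightarrow> x t) (at_right t)" and yr: "(y \<longlongrightarrow> y t) (at_right t)"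
      using x y tT by (auto simp: skorohod_space_def)
    have "\<bar>x t - y t\<bar> \<le> 0 + \<epsilon>" if e: "0 < \<epsilon>" for \<epsilon>
    proof -
      have "\<forall>\<^sub>F s in at_right t. dist (x s) (x t) < \<epsilon>/3"
        using e by (intro tendstoD[OF xr]) simp
      then obtain b where b: "b > t" "\<And>s. t < s \<Longrightarrow> s < b \<Longrightarrow> dist (x s) (x t) < \<epsilon>/3"
        by (auto simp: eventually_at_right_field)
      have "\<forall>\<^sub>F s in at_right t. dist (y s) (y t) < \<epsilon>/3"
        using e by (intro tendstoD[OF yr]) simp
      then obtain c where c: "c > t" "\<And>s. t < s \<Longrightarrow> s < c \<Longrightarrow> dist (y s) (y t) < \<epsilon>/3"
        by (auto simp: eventually_at_right_field)
      define m where "m = min (min b c) T"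
      define s where "s = (t + m) / 2"
      define h where "h = (m - t) / 2"
      have m: "t < m" "m \<le> b" "m \<le> c" "m \<le> T" using b(1) c(1) tT by (auto simp: m_def)
      have h: "0 < h" "s = t + h" "s + h = m" using m by (auto simp: h_def s_def field_simps)
      have s: "s \<in> {0..T}" using h m t by auto
      obtain f where f: "f \<in> time_deformations T"
        "\<bar>f s - s\<bar> \<le> min (\<epsilon>/3) (h/2)" "\<bar>x s - y (f s)\<bar> \<le> min (\<epsilon>/3) (h/2)"
        using close[of "min (\<epsilon>/3) (h/2)"] e h(1) s unfolding skorohod_close_def by auto
      have "t < s" "s < b" "t < f s" "f s < c" using f(2) h m by linarith+
      then have "dist (x s) (x t) < \<epsilon>/3" "dist (y (f s)) (y t) < \<epsilon>/3" using b(2) c(2) by auto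
      then show ?thesis using f(3) unfolding dist_real_def by linarith
    qed
    then have "\<bar>x t - y t\<bar> \<le> 0" by (rule field_le_epsilon)
    then show ?thesis by simp
  qed
qed

lemma skorohod_close_mono:
  "skorohod_close T \<epsilon> x y \<Longrightarrow> \<epsilon> \<le> \<delta> \<Longrightarrow> skorohod_close T \<delta> x y"
  unfolding skorohod_close_def by (meson order_trans)

theorem Metric_space_skorohod:
  assumes T: "0 < T"
  shows "Metric_space (skorohod_space T) (skorohod_dist T)"
proof -
  let ?E = "\<lambda>x y. {\<epsilon>. 0 < \<epsilon> \<and> skorohod_close T \<epsilon> x y}"
  have bdd: "bdd_below (?E x y)" for x y by (intro bdd_belowI[of _ 0]) auto
  have ne: "?E x y \<noteq> {}" if "x \<in> skorohod_space T" "y \<in> skorohod_space T" for x y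
    using skorohod_close_exists[OF that T] by blast
  have near: "skorohod_close T \<epsilon> x y"
    if xy: "x \<in> skorohod_space T" "y \<in> skorohod_space T" and "skorohod_dist T x y < \<epsilon>" for x y \<epsilon>
  proof -
    have "Inf (?E x y) < \<epsilon>" using that by (simp add: skorohod_dist_def)
    then obtain \<delta> where "\<delta> \<in> ?E x y" "\<delta> < \<epsilon>"
      using cInf_lessD[OF ne[OF xy]] by blast
    then show ?thesis using skorohod_close_mono[of T \<delta> x y \<epsilon>] by auto
  qed
  have nonneg: "0 \<le> skorohod_dist T x y" for x y
  proof (cases "x \<in> skorohod_space T \<and> y \<in> skorohod_space T")
    case True
    then have "0 \<le> Inf (?E x y)" by (intro cInf_greatest ne) auto
    then show ?thesis using True by (simp add: skorohod_dist_def)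
  qed (auto simp: skorohod_dist_def)
  have le: "skorohod_dist T x y \<le> \<epsilon>"
    if "x \<in> skorohod_space T" "y \<in> skorohod_space T" "0 < \<epsilon>" "skorohod_close T \<epsilon> x y" for x y \<epsilon>
    using that by (auto simp: skorohod_dist_def intro!: cInf_lower bdd)
  show ?thesis
  proof
    fix x y
    show "0 \<le> skorohod_dist T x y" by (rule nonneg)
    have "?E x y = ?E y x" using skorohod_close_sym by auto
    then show "skorohod_dist T x y = skorohod_dist T y x"
      by (simp add: skorohod_dist_def)
  next
    fix x y assume xy: "x \<in> skorohod_space T" "y \<in> skorohod_space T"
    show "skorohod_dist T x y = 0 \<longleftrightarrow> x = y"
    proof
      assume "skorohod_dist T x y = 0"
      then show "x = y" using near[OF xy] by (intro skorohod_close_limit_eq[OF xy T]) auto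
    next
      assume "x = y"
      have "skorohod_dist T x y \<le> 0 + \<epsilon>" if "0 < \<epsilon>" for \<epsilon>
      proof -
        have "skorohod_close T \<epsilon> x y" unfolding skorohod_close_def
          using \<open>x = y\<close> that by (intro bexI[OF _ time_deformations_id]) auto
        then show ?thesis using le[OF xy that] by simp
      qed
      then have "skorohod_dist T x y \<le> 0" by (rule field_le_epsilon)
      then show "skorohod_dist T x y = 0" using nonneg[of x y] by simp
    qed
  next
    fix x y z assume xyz: "x \<in> skorohod_space T" "y \<in> skorohod_space T" "z \<in> skorohod_space T"
    show "skorohod_dist T x z \<le> skorohod_dist T x y + skorohod_dist T y z"
    proof (rule field_le_epsilon)
      fix e :: real assume e: "0 < e"
      let ?a = "skorohod_dist T x y + e/2" and ?b = "skorohod_dist T y z + e/2"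
      have "skorohod_close T (?a + ?b) x z"
        using e xyz by (intro skorohod_close_trans[of T ?a x y] near) auto
      moreover have "0 < ?a + ?b" using e nonneg[of x y] nonneg[of y z] by linarith
      ultimately have "skorohod_dist T x z \<le> ?a + ?b" using le xyz by blast
      then show "skorohod_dist T x z \<le> skorohod_dist T x y + skorohod_dist T y z + e" by simp
    qed
  qed
qed


section \<open>Weak convergence\<close>

definition borel_sigma :: "'a topology \<Rightarrow> 'a measure" where
  "borel_sigma X = sigma (topspace X) {U. openin X U}"

definition weakly_convergent_to :: "'a topology \<Rightarrow> (nat \<Rightarrow> 'a measure) \<Rightarrow> 'a measure \<Rightarrow> bool" where
  "weakly_convergent_to X \<mu> \<nu> \<longleftrightarrow>
     (\<forall>f :: 'a \<Rightarrow> real. continuous_map X euclideanreal f \<and> bounded (f ` topspace X) \<longrightarrow>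
        (\<lambda>n. integral\<^sup>L (\<mu> n) f) \<longlonglongrightarrow> integral\<^sup>L \<nu> f)"

text \<open>The measurability clauses say that the \<open>Y n\<close> and \<open>Z\<close> are random elements of \<open>X\<close>; without
  them \<^const>\<open>distr\<close> would not denote a law.\<close>

definition converges_in_law ::
  "'a topology \<Rightarrow> (nat \<Rightarrow> 'b measure) \<Rightarrow> (nat \<Rightarrow> 'b \<Rightarrow> 'a) \<Rightarrow> 'c measure \<Rightarrow> ('c \<Rightarrow> 'a) \<Rightarrow> bool" where
  "converges_in_law X M Y N Z \<longleftrightarrow>
     (\<forall>n. Y n \<in> measurable (M n) (borel_sigma X)) \<and>
     Z \<in> measurable N (borel_sigma X) \<and>
     weakly_convergent_to X (\<lambda>n. distr (M n) (borel_sigma X) (Y n)) (distr N (borel_sigma X) Z)"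


section \<open>Other probabilistic notions\<close>

definition standard_brownian_motion :: "'b measure \<Rightarrow> (real \<Rightarrow> 'b \<Rightarrow> real) \<Rightarrow> bool" where
  "standard_brownian_motion N B \<longleftrightarrow> prob_space N \<and>
     (\<forall>t\<ge>0. B t \<in> borel_measurable N) \<and>
     (\<forall>\<omega>\<in>space N. B 0 \<omega> = 0) \<and>
     (\<forall>\<omega>\<in>space N. continuous_on {0..} (\<lambda>t. B t \<omega>)) \<and>
     (\<forall>s t. 0 \<le> s \<and> s < t \<longrightarrow>
        distributed N lborel (\<lambda>\<omega>. B t \<omega> - B s \<omega>) (normal_density 0 (sqrt (t - s)))) \<and>
     (\<forall>(m::nat) t. 0 \<le> t 0 \<and> (\<forall>i<m. t i \<le> t (Suc i)) \<longrightarrow>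
        prob_space.indep_vars N (\<lambda>_. borel) (\<lambda>i \<omega>. B (t (Suc i)) \<omega> - B (t i) \<omega>) {..<m})"

definition martingale_difference_seq ::
  "'a measure \<Rightarrow> (nat \<Rightarrow> 'a measure) \<Rightarrow> (nat \<Rightarrow> 'a \<Rightarrow> real) \<Rightarrow> bool" where
  "martingale_difference_seq M F X \<longleftrightarrow>
     filtration (space M) F \<and> (\<forall>i. subalgebra M (F i)) \<and>
     (\<forall>i\<ge>1. X i \<in> borel_measurable (F i) \<and> integrable M (X i) \<and>
        (AE \<omega> in M. real_cond_exp M (F (i - 1)) (X i) \<omega> = 0))"

definition martingale_difference_array ::
  "(nat \<Rightarrow> 'a measure) \<Rightarrow> (nat \<Rightarrow> nat \<Rightarrow> 'a \<Rightarrow> real) \<Rightarrow> bool" where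
  "martingale_difference_array M X \<longleftrightarrow> (\<forall>n. \<exists>F. martingale_difference_seq (M n) F (X n))"

definition tendsto_0_in_L2 :: "(nat \<Rightarrow> 'a measure) \<Rightarrow> (nat \<Rightarrow> 'a \<Rightarrow> real) \<Rightarrow> bool" where
  "tendsto_0_in_L2 M Y \<longleftrightarrow>
     (\<forall>n. Y n \<in> borel_measurable (M n) \<and> integrable (M n) (\<lambda>\<omega>. (Y n \<omega>)\<^sup>2)) \<and>
     (\<lambda>n. \<integral>\<omega>. (Y n \<omega>)\<^sup>2 \<partial>M n) \<longlonglongrightarrow> 0"

definition tendsto_const_in_prob ::
  "(nat \<Rightarrow> 'a measure) \<Rightarrow> (nat \<Rightarrow> 'a \<Rightarrow> real) \<Rightarrow> real \<Rightarrow> bool" where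
  "tendsto_const_in_prob M Y c \<longleftrightarrow>
     (\<forall>\<epsilon>>0. (\<lambda>n. measure (M n) {\<omega> \<in> space (M n). \<bar>Y n \<omega> - c\<bar> > \<epsilon>}) \<longlonglongrightarrow> 0)"


section \<open>The time-change assumption\<close>

text \<open>The grid \<open>0, \<delta>, 2\<delta>, \<dots>\<close> stopped at \<open>T\<close>; the index \<open>\<lfloor>T/\<delta>\<rfloor> + 1\<close> (and any larger one) gives \<open>T\<close>.\<close>

definition time_grid :: "real \<Rightarrow> real \<Rightarrow> nat \<Rightarrow> real" where
  "time_grid T \<delta> m = (if m \<le> nat \<lfloor>T / \<delta>\<rfloor> then real m * \<delta> else T)"

definition time_change_modulus :: "(real \<Rightarrow> real) \<Rightarrow> real \<Rightarrow> real \<Rightarrow> real" where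
  "time_change_modulus a T \<delta> =
     (SUP m\<in>{0..nat \<lfloor>T / \<delta>\<rfloor>}. a (time_grid T \<delta> (m + 1)) - a (time_grid T \<delta> m))"

definition time_change :: "real \<Rightarrow> (real \<Rightarrow> real) \<Rightarrow> bool" where
  "time_change T a \<longleftrightarrow>
     (\<forall>t\<in>{0..T}. 0 \<le> a t) \<and> strict_mono_on {0..T} a \<and> continuous_on {0..T} a \<and> a 0 = 0 \<and>
     ((\<lambda>\<delta>. time_change_modulus a T \<delta> * ln (1 / \<delta>)) \<longlongrightarrow> 0) (at_right 0)"

end

theory Submission
  imports Defs
begin

text \<open>If each \<open>G\<^sub>j\<close> is \<open>F\<^sub>j\<^sub>-\<^sub>1\<close>-measurable and stops the product \<open>\<Prod>\<^sub>j (1 + z G\<^sub>j X\<^sub>j)\<close> before it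
  leaves a bounded set, the product has mean 1. For \<open>z = \<i>\<close> and the \<open>X\<^sub>j\<close> small, it is close to
  \<open>exp (\<i> S + V / 2)\<close>, where \<open>S\<close> is the sum and \<open>V\<close> the sum of squares of the \<open>X\<^sub>j\<close>; since \<open>V\<close> is nearly
  constant, this identifies the limiting characteristic function of \<open>S\<close> (McLeish), and deterministic
  weights \<open>w\<^sub>j X\<^sub>j\<close> yield the joint law of finitely many increments. For real \<open>z = \<lambda>\<close>, the bound
  \<open>1 + x \<ge> exp (x - 2 x\<^sup>2)\<close> turns the same identity into an exponential maximal inequality: over a
  time interval on which \<open>a\<close> grows by \<open>\<Delta>\<close>, the partial sums oscillate by more than \<open>\<epsilon>\<close> with asymptotic
  probability \<open>O (exp (- \<epsilon>\<^sup>2 / (16 \<Delta>))) = O (\<Delta>\<^sup>2 / \<epsilon>\<^sup>4)\<close>. Summed over a grid this vanishes with the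
  mesh, so both processes may be replaced by their grid discretisations in bounded Lipschitz test
  functions, which suffice for weak convergence.\<close>

section \<open>Skorohod topology\<close>

text \<open>A stopping rule must be predictable, so it reacts one factor too late. The sums of
  squares converge only in probability, hence that overshooting factor has no bound of its own; it
  is paid for by the maximum \<open>Q\<close> of the absolute values in a row, and the error terms
  become multiples of the mean of \<open>Q\<close>. The squared increment of \<open>a\<close> in the
  oscillation bound is essential: over a grid the increments of \<open>a\<close> add up to
  \<open>a T\<close> whatever the mesh, whereas their squares add up to at most the largest
  increment times \<open>a T\<close>. The limit has continuous paths, so the identity serves as time
  deformation in every comparison of paths, and uniform estimates suffice. Step paths are written as
  images of increment sequences under one map that is continuous from the product topology. This
  yields measurability into the Borel sets of the Skorohod topology, and it turns a test function of
  a discretised path into a continuous function of finitely many increments, to which characteristic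
  functions apply.\<close>

definition step_path :: "real \<Rightarrow> (real \<Rightarrow> nat) \<Rightarrow> (nat \<Rightarrow> real) \<Rightarrow> real \<Rightarrow> real" where
  "step_path T k d = (\<lambda>t\<in>{0..T}. \<Sum>i=1..k t. d i)"

text \<open>For values in the naturals, right continuity means being locally constant to the right.
  The notion covers both the row lengths \<open>k n\<close> and the grid index
  \<open>grid_clock\<close>.\<close>

definition clock :: "real \<Rightarrow> (real \<Rightarrow> nat) \<Rightarrow> bool" where
  "clock T k \<longleftrightarrow> mono_on {0..T} k \<and> (\<forall>t\<in>{0..<T}. \<forall>\<^sub>F s in at_right t. k s = k t)"

lemma right_continuous_clock:
  assumes "mono_on {0..T} k"
    and rc: "\<And>t. t \<in> {0..T} \<Longrightarrow> continuous (at t within {t..T}) (\<lambda>s. real (k s))"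
  shows "clock T k"
  unfolding clock_def
proof (intro conjI ballI)
  fix t assume t: "t \<in> {0..<T}"
  have "((\<lambda>s. real (k s)) \<longlongrightarrow> real (k t)) (at_right t)"
    using rc[of t] t by (simp add: continuous_within at_within_Icc_at_right)
  then have "\<forall>\<^sub>F s in at_right t. dist (real (k s)) (real (k t)) < 1" by (rule tendstoD) simp
  then show "\<forall>\<^sub>F s in at_right t. k s = k t"
    by eventually_elim (simp add: dist_real_def abs_less_iff)
qed fact

text \<open>By monotonicity only finitely many values, all at most \<open>k t\<close>, are taken
  before \<open>t\<close>; once the largest of them is reached it is kept up to
  \<open>t\<close>.\<close>

lemma clock_eventually_const_left:
  assumes k: "clock T k" and t: "t \<in> {0<..T}"
  shows "\<exists>c. \<forall>\<^sub>F s in at_left t. k s = c"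
proof -
  have mono: "\<And>r s. 0 \<le> r \<Longrightarrow> r \<le> s \<Longrightarrow> s \<le> T \<Longrightarrow> k r \<le> k s"
    using k by (auto simp: clock_def mono_on_def)
  have fin: "finite (k ` {0..<t})"
    by (rule finite_subset[of _ "{..k t}"]) (use mono t in auto)
  have "k ` {0..<t} \<noteq> {}" using t by auto
  then have "Max (k ` {0..<t}) \<in> k ` {0..<t}" using fin by (rule Max_in[rotated])
  then obtain s0 where s0: "s0 \<in> {0..<t}" "k s0 = Max (k ` {0..<t})" by auto
  have "k s = k s0" if "s0 < s" "s < t" for s
  proof (rule antisym)
    have "k s \<le> Max (k ` {0..<t})" using fin that s0(1) by (intro Max_ge) auto
    then show "k s \<le> k s0" by (simp only: s0(2))
    show "k s0 \<le> k s" using that s0(1) t by (intro mono) auto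
  qed
  then have "\<forall>\<^sub>F s in at_left t. k s = k s0"
    unfolding eventually_at_left_field using s0(1) by (intro exI[of _ s0]) auto
  then show ?thesis by blast
qed

lemma step_path_in_skorohod_space:
  assumes k: "clock T k"
  shows "step_path T k d \<in> skorohod_space T"
  unfolding skorohod_space_def
proof (intro CollectI conjI ballI)
  show "step_path T k d \<in> extensional {0..T}" by (simp add: step_path_def)
next
  fix t assume t: "t \<in> {0..<T}"
  then have "\<forall>\<^sub>F s in at_right t. k s = k t" using k by (auto simp: clock_def)
  moreover have "\<forall>\<^sub>F s in at_right t. t < s \<and> s < T"
    using t by (auto simp: eventually_at_right_field intro!: exI[of _ T])
  ultimately have "\<forall>\<^sub>F s in at_right t. step_path T k d s = step_path T k d t"
    by eventually_elim (use t in \<open>auto simp: step_path_def\<close>)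
  then show "(step_path T k d \<longlongrightarrow> step_path T k d t) (at_right t)"
    by (rule tendsto_eventually)
next
  fix t assume t: "t \<in> {0<..T}"
  then obtain c where "\<forall>\<^sub>F s in at_left t. k s = c"
    using clock_eventually_const_left[OF k] by blast
  moreover have "\<forall>\<^sub>F s in at_left t. 0 < s \<and> s < t"
    using t by (auto simp: eventually_at_left_field intro!: exI[of _ 0])
  ultimately have "\<forall>\<^sub>F s in at_left t. step_path T k d s = (\<Sum>i=1..c. d i)"
    by eventually_elim (use t in \<open>auto simp: step_path_def\<close>)
  then show "\<exists>l. (step_path T k d \<longlongrightarrow> l) (at_left t)"
    using tendsto_eventually by blast
qed

lemma continuous_in_skorohod_space:
  assumes "continuous_on {0..T} x"
  shows "(\<lambda>t\<in>{0..T}. x t) \<in> skorohod_space T"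
  unfolding skorohod_space_def
proof (intro CollectI conjI ballI)
  fix t assume t: "t \<in> {0..<T}"
  have "(x \<longlongrightarrow> x t) (at t within {0..T})"
    using assms t by (auto simp: continuous_on_def)
  then have "(x \<longlongrightarrow> x t) (at t within {t..T})"
    by (rule tendsto_within_subset) (use t in auto)
  then have "(x \<longlongrightarrow> x t) (at_right t)"
    using t by (simp add: at_within_Icc_at_right)
  moreover have "\<forall>\<^sub>F s in at_right t. x s = (\<lambda>t\<in>{0..T}. x t) s"
    using t by (auto simp: eventually_at_right_field intro!: exI[of _ T])
  ultimately have "((\<lambda>t\<in>{0..T}. x t) \<longlongrightarrow> x t) (at_right t)"
    by (rule Lim_transform_eventually)
  then show "((\<lambda>t\<in>{0..T}. x t) \<longlongrightarrow> (\<lambda>t\<in>{0..T}. x t) t) (at_right t)"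
    using t by simp
next
  fix t assume t: "t \<in> {0<..T}"
  have "(x \<longlongrightarrow> x t) (at t within {0..T})"
    using assms t by (auto simp: continuous_on_def)
  then have "(x \<longlongrightarrow> x t) (at t within {0..t})"
    by (rule tendsto_within_subset) (use t in auto)
  then have "(x \<longlongrightarrow> x t) (at_left t)"
    using t by (simp add: at_within_Icc_at_left)
  moreover have "\<forall>\<^sub>F s in at_left t. x s = (\<lambda>t\<in>{0..T}. x t) s"
    using t by (auto simp: eventually_at_left_field intro!: exI[of _ 0])
  ultimately have "((\<lambda>t\<in>{0..T}. x t) \<longlongrightarrow> x t) (at_left t)"
    by (rule Lim_transform_eventually)
  then show "\<exists>l. ((\<lambda>t\<in>{0..T}. x t) \<longlongrightarrow> l) (at_left t)" by blast
qed simp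

text \<open>The identity is an admissible time deformation, so the uniform distance dominates the
  Skorohod distance.\<close>

lemma skorohod_dist_le:
  assumes "x \<in> skorohod_space T" "y \<in> skorohod_space T" "0 \<le> e"
    and le: "\<And>t. t \<in> {0..T} \<Longrightarrow> \<bar>x t - y t\<bar> \<le> e"
  shows "skorohod_dist T x y \<le> e"
proof (rule field_le_epsilon)
  fix r :: real assume r: "0 < r"
  have "\<forall>t\<in>{0..T}. \<bar>x t - y t\<bar> \<le> e + r" using le r by (meson add_increasing2 less_imp_le)
  \<comment> \<open>The slack \<open>r\<close> is there because the infimum runs over strictly
    positive numbers and \<open>e\<close> may be 0.\<close>
  then have "skorohod_close T (e + r) x y"
    unfolding skorohod_close_def using assms(3) r
    by (intro bexI[OF _ time_deformations_id]) auto
  then show "skorohod_dist T x y \<le> e + r"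
    using assms(1-3) r unfolding skorohod_dist_def
    by (auto intro!: cInf_lower bdd_belowI[of _ 0])
qed

lemma topspace_skorohod_topology: "0 < T \<Longrightarrow> topspace (skorohod_topology T) = skorohod_space T"
  unfolding skorohod_topology_def
  by (simp add: Metric_space.topspace_mtopology[OF Metric_space_skorohod])

text \<open>Only the coordinates 1 to \<open>k T\<close> matter, and the uniform distance of two
  step paths is at most the sum of the absolute differences of these coordinates. This is continuity
  of \<open>step_path T k\<close> from the product topology.\<close>

lemma open_step_path_vimage:
  assumes T: "0 < T" and k: "clock T k" and U: "openin (skorohod_topology T) U"
  shows "open {d. step_path T k d \<in> U}"
proof -
  interpret Metric_space "skorohod_space T" "skorohod_dist T"
    using Metric_space_skorohod[OF T] .
  show ?thesis
  proof (subst open_subopen, intro ballI)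
    fix d assume d: "d \<in> {d. step_path T k d \<in> U}"
    then obtain r where r: "0 < r" "mball (step_path T k d) r \<subseteq> U"
      using U by (auto simp: skorohod_topology_def openin_mtopology)
    define V where "V = {d'. (\<Sum>i=1..k T. \<bar>d i - d' i\<bar>) < r / 2}"
    have "continuous_on UNIV (\<lambda>d'::nat \<Rightarrow> real. \<Sum>i=1..k T. \<bar>d i - d' i\<bar>)"
      by (intro continuous_intros continuous_on_product_coordinates)
    then have "open V" unfolding V_def
      by (intro open_Collect_less continuous_on_const)
    moreover have "d \<in> V" using r by (simp add: V_def)
    moreover have "V \<subseteq> {d. step_path T k d \<in> U}"
    proof
      fix d' assume d': "d' \<in> V"
      have "\<bar>step_path T k d t - step_path T k d' t\<bar> \<le> r / 2" if t: "t \<in> {0..T}" for t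
      proof -
        have "k t \<le> k T" using k t T by (auto simp: clock_def mono_on_def)
        have "\<bar>step_path T k d t - step_path T k d' t\<bar> = \<bar>\<Sum>i=1..k t. d i - d' i\<bar>"
          using t by (simp add: step_path_def sum_subtractf)
        also have "\<dots> \<le> (\<Sum>i=1..k t. \<bar>d i - d' i\<bar>)" by (rule sum_abs)
        also have "\<dots> \<le> (\<Sum>i=1..k T. \<bar>d i - d' i\<bar>)"
          using \<open>k t \<le> k T\<close> by (intro sum_mono2) auto
        finally show ?thesis using d' by (simp add: V_def)
      qed
      then have "skorohod_dist T (step_path T k d) (step_path T k d') \<le> r / 2"
        using r by (intro skorohod_dist_le step_path_in_skorohod_space k) auto
      then have "step_path T k d' \<in> mball (step_path T k d) r"
        using r step_path_in_skorohod_space[OF k] by simp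
      then show "d' \<in> {d. step_path T k d \<in> U}" using r by auto
    qed
    ultimately show "\<exists>V. open V \<and> d \<in> V \<and> V \<subseteq> {d. step_path T k d \<in> U}" by blast
  qed
qed

text \<open>Coordinatewise measurability is Borel measurability into the sequence space, and it
  passes through the continuous map \<open>step_path T k\<close>.\<close>

lemma measurable_step_path:
  assumes T: "0 < T" and k: "clock T k" and D: "\<And>i. D i \<in> borel_measurable M"
  shows "(\<lambda>\<omega>. step_path T k (\<lambda>i. D i \<omega>)) \<in> measurable M (borel_sigma (skorohod_topology T))"
  unfolding borel_sigma_def
proof (rule measurable_measure_of)
  show "{U. openin (skorohod_topology T) U} \<subseteq> Pow (topspace (skorohod_topology T))"
    by (auto dest: openin_subset)
  show "(\<lambda>\<omega>. step_path T k (\<lambda>i. D i \<omega>)) \<in> space M \<rightarrow> topspace (skorohod_topology T)"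
    using step_path_in_skorohod_space[OF k] by (simp add: topspace_skorohod_topology[OF T])
  fix U assume "U \<in> {U. openin (skorohod_topology T) U}"
  then have "open {d. step_path T k d \<in> U}" using open_step_path_vimage[OF T k] by simp
  moreover have "(\<lambda>\<omega> i. D i \<omega>) \<in> borel_measurable M"
    using D by (rule measurable_coordinatewise_then_product)
  ultimately have "(\<lambda>\<omega> i. D i \<omega>) -` {d. step_path T k d \<in> U} \<inter> space M \<in> sets M"
    by (intro measurable_sets[of _ M borel]) auto
  then show "(\<lambda>\<omega>. step_path T k (\<lambda>i. D i \<omega>)) -` U \<inter> space M \<in> sets M"
    by (simp add: vimage_def)
qed

section \<open>Borel sets of a topology and pointwise limits of random elements\<close>

lemma space_borel_sigma: "space (borel_sigma X) = topspace X"
  by (simp add: borel_sigma_def space_measure_of_conv)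

lemma openin_imp_borel_sigma: "openin X U \<Longrightarrow> U \<in> sets (borel_sigma X)"
  using openin_subset by (subst borel_sigma_def, subst sets_measure_of) (blast intro: sigma_sets.Basic)+

lemma continuous_map_imp_borel_sigma_measurable:
  assumes f: "continuous_map X euclideanreal f"
  shows "f \<in> borel_measurable (borel_sigma X)"
proof (rule borel_measurableI)
  fix S :: "real set" assume "open S"
  then have "openin X {x \<in> topspace X. f x \<in> S}"
    using f by (simp add: continuous_map)
  moreover have "f -` S \<inter> space (borel_sigma X) = {x \<in> topspace X. f x \<in> S}"
    by (auto simp: space_borel_sigma)
  ultimately show "f -` S \<inter> space (borel_sigma X) \<in> sets (borel_sigma X)"
    using openin_imp_borel_sigma by simp
qed

lemma borel_measurable_continuous_map_compose:
  assumes "continuous_map X euclideanreal h" "Y \<in> measurable M (borel_sigma X)"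
  shows "(\<lambda>\<omega>. h (Y \<omega>)) \<in> borel_measurable M"
  using measurable_compose[OF assms(2) continuous_map_imp_borel_sigma_measurable[OF assms(1)]] .

context Metric_space
begin

text \<open>\<open>Z \<omega>\<close> lies in the open set \<open>U\<close> iff, for some
  \<open>p\<close>, all late \<open>Y m \<omega>\<close> lie in the smaller open set
  \<open>V p\<close> of points that have a margin of more than \<open>1 / Suc p\<close> inside
  \<open>U\<close>. This describes the event by countably many measurable ones.\<close>

lemma measurable_borel_sigma_limit:
  assumes Y: "\<And>m::nat. Y m \<in> measurable N (borel_sigma mtopology)"
    and Z: "\<And>\<omega>. \<omega> \<in> space N \<Longrightarrow> Z \<omega> \<in> M"
    and lim: "\<And>\<omega>. \<omega> \<in> space N \<Longrightarrow> (\<lambda>m. d (Y m \<omega>) (Z \<omega>)) \<longlonglongrightarrow> 0"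
  shows "Z \<in> measurable N (borel_sigma mtopology)"
  unfolding borel_sigma_def
proof (rule measurable_measure_of)
  show "{U. openin mtopology U} \<subseteq> Pow (topspace mtopology)" using openin_subset by blast
  show "Z \<in> space N \<rightarrow> topspace mtopology" using Z by simp
  have space: "space (borel_sigma mtopology) = M"
    by (simp add: space_borel_sigma)
  then have YM: "\<And>m \<omega>. \<omega> \<in> space N \<Longrightarrow> Y m \<omega> \<in> M"
    using measurable_space[OF Y] by simp
  fix U assume "U \<in> {U. openin mtopology U}"
  then have U: "openin mtopology U" by simp
  \<comment> \<open>The strict bound on \<open>r\<close> makes \<open>V p\<close> open: moving away
    from \<open>x\<close> may use up half of the surplus of \<open>r\<close>.\<close>
  define V where "V p = {x\<in>M. \<exists>r>1 / real (Suc p). mball x r \<subseteq> U}" for p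
  have V_open: "openin mtopology (V p)" for p
    unfolding openin_mtopology
  proof (intro conjI allI impI)
    show "V p \<subseteq> M" by (auto simp: V_def)
    fix x assume "x \<in> V p"
    then obtain r where r: "x \<in> M" "r > 1 / real (Suc p)" "mball x r \<subseteq> U" by (auto simp: V_def)
    define q where "q = (r - 1 / real (Suc p)) / 2"
    have q: "0 < q" using r(2) by (simp add: q_def)
    have q': "r - q > 1 / real (Suc p)" unfolding q_def
    proof -
      have "c < r - (r - c) / 2" if "c < r" for c using that by (simp add: field_simps)
      then show "1 / real (Suc p) < r - (r - 1 / real (Suc p)) / 2" using r(2) by blast
    qed
    have "mball x q \<subseteq> V p"
    proof
      fix y assume y: "y \<in> mball x q"
      have "mball y (r - q) \<subseteq> mball x r"
        using y triangle[of x y] by fastforce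
      then show "y \<in> V p" using y r q' by (auto simp: V_def intro!: exI[of _ "r - q"])
    qed
    then show "\<exists>r>0. mball x r \<subseteq> V p" using q by blast
  qed
  have "Y m -` V p \<inter> space N \<in> sets N" for m p
    using measurable_sets[OF Y[of m] openin_imp_borel_sigma[OF V_open[of p]]] .
  then have "(\<Union>p. \<Union>m0. \<Inter>m\<in>{m0..}. Y m -` V p \<inter> space N) \<in> sets N"
    by (intro sets.countable_UN'' sets.countable_INT') auto
  also have "(\<Union>p. \<Union>m0. \<Inter>m\<in>{m0..}. Y m -` V p \<inter> space N) = Z -` U \<inter> space N"
  proof (intro equalityI subsetI)
    fix \<omega> assume "\<omega> \<in> (\<Union>p. \<Union>m0. \<Inter>m\<in>{m0..}. Y m -` V p \<inter> space N)"
    then obtain p m0 where p: "\<And>m. m \<ge> m0 \<Longrightarrow> Y m \<omega> \<in> V p" and w: "\<omega> \<in> space N" by fastforce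
    have "\<forall>\<^sub>F m in sequentially. d (Y m \<omega>) (Z \<omega>) < 1 / real (Suc p)"
      using lim[OF w] by (rule order_tendstoD) simp
    then obtain m where m: "m \<ge> m0" "d (Y m \<omega>) (Z \<omega>) < 1 / real (Suc p)"
      unfolding eventually_sequentially by (meson nle_le)
    from p[OF m(1)] obtain r where "r > 1 / real (Suc p)" "mball (Y m \<omega>) r \<subseteq> U"
      by (auto simp: V_def)
    then show "\<omega> \<in> Z -` U \<inter> space N" using m(2) Z[OF w] YM[OF w] w by force
  next
    fix \<omega> assume w: "\<omega> \<in> Z -` U \<inter> space N"
    then obtain r where r: "0 < r" "mball (Z \<omega>) r \<subseteq> U" using U by (auto simp: openin_mtopology)
    obtain p where p: "1 / real (Suc p) < r / 2"
      using r by (metis half_gt_zero nat_approx_posE)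
    have "\<forall>\<^sub>F m in sequentially. d (Y m \<omega>) (Z \<omega>) < r / 2"
      using order_tendstoD(2)[OF lim[of \<omega>], of "r / 2"] w r by simp
    then obtain m0 where m0: "\<And>m. m \<ge> m0 \<Longrightarrow> d (Y m \<omega>) (Z \<omega>) < r / 2"
      unfolding eventually_sequentially by blast
    have "Y m \<omega> \<in> V p" if m: "m \<ge> m0" for m
    proof -
      have "mball (Y m \<omega>) (r / 2) \<subseteq> mball (Z \<omega>) r"
      proof
        fix y assume y: "y \<in> mball (Y m \<omega>) (r / 2)"
        then have "d (Z \<omega>) y \<le> d (Z \<omega>) (Y m \<omega>) + d (Y m \<omega>) y" using w Z YM by (intro triangle) auto
        then show "y \<in> mball (Z \<omega>) r" using y m0[OF m] Z w by (auto simp: commute)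
      qed
      then have "mball (Y m \<omega>) (r / 2) \<subseteq> U" using r by blast
      then show ?thesis unfolding V_def using p YM w by blast
    qed
    then show "\<omega> \<in> (\<Union>p. \<Union>m0. \<Inter>m\<in>{m0..}. Y m -` V p \<inter> space N)" using w by blast
  qed
  finally show "Z -` U \<inter> space N \<in> sets N" .
qed

end

section \<open>Lipschitz test functions\<close>

context Metric_space
begin

text \<open>The Pasch-Hausdorff envelope (infimal convolution of \<open>f\<close> with
  \<open>n\<close> times the distance): for bounded \<open>f\<close>, the largest
  \<open>n\<close>-Lipschitz function below \<open>f\<close>.\<close>

definition lip_approx :: "('a \<Rightarrow> real) \<Rightarrow> nat \<Rightarrow> 'a \<Rightarrow> real" where
  "lip_approx f n x = (INF y\<in>M. f y + real n * d x y)"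

text \<open>An infimum of functions that are \<open>n\<close>-Lipschitz in \<open>x\<close> is again
  so. For convergence, a competitor \<open>y\<close> near \<open>x\<close> has \<open>f y\<close>
  not much below \<open>f x\<close> by continuity, while at distance at least \<open>r\<close> the
  penalty eventually exceeds \<open>2 * C\<close>, the most that \<open>f\<close> can drop.\<close>

lemma
  assumes C: "\<And>x. x \<in> M \<Longrightarrow> \<bar>f x\<bar> \<le> C"
  shows lip_approx_le: "x \<in> M \<Longrightarrow> lip_approx f n x \<le> f x"
    and lip_approx_bounded: "x \<in> M \<Longrightarrow> \<bar>lip_approx f n x\<bar> \<le> C"
    and lip_approx_lipschitz: "x \<in> M \<Longrightarrow> y \<in> M \<Longrightarrow> \<bar>lip_approx f n x - lip_approx f n y\<bar> \<le> real n * d x y"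
    and lip_approx_tendsto: "x \<in> M \<Longrightarrow> continuous_map mtopology euclideanreal f \<Longrightarrow>
      (\<lambda>n. lip_approx f n x) \<longlonglongrightarrow> f x"
proof -
  have low: "- C \<le> f y + real n * d x y" if "y \<in> M" for x y n
    using C[OF that] by (smt (verit) mult_nonneg_nonneg nonneg of_nat_0_le_iff)
  have bdd: "bdd_below ((\<lambda>y. f y + real n * d x y) ` M)" for n x
    using low by (intro bdd_belowI2[of _ "- C"])
  have le: "lip_approx f n x \<le> f y + real n * d x y" if "y \<in> M" for n x y
    unfolding lip_approx_def using bdd that by (rule cINF_lower)
  have lef: "lip_approx f n x \<le> f x" if "x \<in> M" for n x
    using le[OF that, of n x] that by simp
  then show "x \<in> M \<Longrightarrow> lip_approx f n x \<le> f x" .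
  show "\<bar>lip_approx f n x\<bar> \<le> C" if x: "x \<in> M" for x n
  proof -
    have "- C \<le> lip_approx f n x"
      unfolding lip_approx_def using low x by (intro cINF_greatest) auto
    moreover have "lip_approx f n x \<le> C" using lef[OF x, of n] C[OF x] by linarith
    ultimately show ?thesis by linarith
  qed
  have half: "lip_approx f n x - real n * d x y \<le> lip_approx f n y" if xy: "x \<in> M" "y \<in> M" for n x y
    unfolding lip_approx_def[of f n y]
  proof (rule cINF_greatest)
    fix z assume z: "z \<in> M"
    have "lip_approx f n x \<le> f z + real n * d x z" using le z .
    also have "\<dots> \<le> f z + real n * (d x y + d y z)"
      using triangle[OF xy z] by (intro add_left_mono mult_left_mono) auto
    finally show "lip_approx f n x - real n * d x y \<le> f z + real n * d y z"
      by (simp add: algebra_simps)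
  qed (use xy in auto)
  show "\<bar>lip_approx f n x - lip_approx f n y\<bar> \<le> real n * d x y" if "x \<in> M" "y \<in> M" for x y n
    using half[OF that, of n] half[OF that(2,1), of n] by (simp add: commute abs_le_iff)
  show "(\<lambda>n. lip_approx f n x) \<longlonglongrightarrow> f x"
    if x: "x \<in> M" and f: "continuous_map mtopology euclideanreal f" for x
  proof (rule LIMSEQ_I)
    fix e :: real assume e: "0 < e"
    have "openin mtopology {y \<in> topspace mtopology. f y \<in> {f x - e / 2<..}}"
      using f by (rule openin_continuous_map_preimage) simp
    moreover have "x \<in> {y \<in> topspace mtopology. f y \<in> {f x - e / 2<..}}" using x e by simp
    ultimately obtain r where r: "0 < r" "mball x r \<subseteq> {y \<in> topspace mtopology. f y \<in> {f x - e / 2<..}}"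
      unfolding openin_mtopology by blast
    obtain N where N: "2 * C < real N * r" using reals_Archimedean3[OF r(1)] by blast
    have "norm (lip_approx f n x - f x) < e" if n: "N \<le> n" for n
    proof -
      have "f x - e / 2 \<le> lip_approx f n x"
        unfolding lip_approx_def
      proof (rule cINF_greatest)
        fix y assume y: "y \<in> M"
        show "f x - e / 2 \<le> f y + real n * d x y"
        proof (cases "d x y < r")
          case True
          then have "f x - e / 2 < f y" using r x y by auto
          then show ?thesis by (smt (verit) mult_nonneg_nonneg nonneg of_nat_0_le_iff)
        next
          case False
          then have "real N * r \<le> real n * d x y" using n r by (intro mult_mono) auto
          then show ?thesis using N C[OF x] C[OF y] e by linarith
        qed
      qed (use x in auto)
      then show ?thesis using lef[OF x, of n] e by simp
    qed
    then show "\<exists>no. \<forall>n\<ge>no. norm (lip_approx f n x - f x) < e" by blast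
  qed
qed

lemma lipschitz_continuous_map:
  assumes "\<And>x y. x \<in> M \<Longrightarrow> y \<in> M \<Longrightarrow> \<bar>h x - h y\<bar> \<le> L * d x y" "0 \<le> L"
  shows "continuous_map mtopology euclideanreal h"
  unfolding continuous_map openin_mtopology topspace_mtopology
proof (intro conjI allI impI)
  fix U :: "real set" and x
  assume U: "openin euclideanreal U" and x: "x \<in> {x \<in> M. h x \<in> U}"
  then have "open U" "h x \<in> U" by auto
  then obtain e where e: "0 < e" "\<And>z. \<bar>z - h x\<bar> < e \<Longrightarrow> z \<in> U"
    unfolding open_dist dist_real_def by blast
  \<comment> \<open>The slope \<open>L + 1\<close> in place of \<open>L\<close> covers
    \<open>L = 0\<close>.\<close>
  have "mball x (e / (L + 1)) \<subseteq> {x \<in> M. h x \<in> U}"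
  proof
    fix y assume y: "y \<in> mball x (e / (L + 1))"
    have "\<bar>h y - h x\<bar> \<le> L * d x y" using assms(1)[of x y] y by (simp add: abs_minus_commute)
    also have "\<dots> \<le> (L + 1) * d x y" by (simp add: algebra_simps)
    also have "\<dots> < e" using y assms(2) by (simp add: field_simps)
    finally show "y \<in> {x \<in> M. h x \<in> U}" using e y by simp
  qed
  then show "\<exists>r>0. mball x r \<subseteq> {x \<in> M. h x \<in> U}"
    using e(1) assms(2) by (intro exI[of _ "e / (L + 1)"]) auto
qed auto

text \<open>The approximants lie below \<open>f\<close> and their expectations under the limit law
  come arbitrarily close to that of \<open>f\<close>, which bounds the limit inferior of the
  expectations from below. The same bound for \<open>- f\<close> gives the limit superior.\<close>

lemma converges_in_law_lipschitzI:
  assumes P: "\<And>n. prob_space (P n)" "prob_space N"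
    and Y: "\<And>n. Y n \<in> measurable (P n) (borel_sigma mtopology)"
    and Z: "Z \<in> measurable N (borel_sigma mtopology)"
    and lim: "\<And>h L C. 0 \<le> L \<Longrightarrow> (\<And>x y. x \<in> M \<Longrightarrow> y \<in> M \<Longrightarrow> \<bar>h x - h y\<bar> \<le> L * d x y) \<Longrightarrow>
      (\<And>x. x \<in> M \<Longrightarrow> \<bar>h x\<bar> \<le> C) \<Longrightarrow>
      (\<lambda>n. \<integral>\<omega>. h (Y n \<omega>) \<partial>P n) \<longlonglongrightarrow> (\<integral>\<omega>. h (Z \<omega>) \<partial>N)"
  shows "converges_in_law mtopology P Y N Z"
proof -
  have YM: "\<And>n \<omega>. \<omega> \<in> space (P n) \<Longrightarrow> Y n \<omega> \<in> M" and ZM: "\<And>\<omega>. \<omega> \<in> space N \<Longrightarrow> Z \<omega> \<in> M"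
    using measurable_space[OF Y] measurable_space[OF Z] by (auto simp: space_borel_sigma)
  have meas: "(\<lambda>\<omega>. f (Y n \<omega>)) \<in> borel_measurable (P n)" "(\<lambda>\<omega>. f (Z \<omega>)) \<in> borel_measurable N"
    if "continuous_map mtopology euclideanreal f" for f n
    using that Y Z by (auto intro: borel_measurable_continuous_map_compose)
  have liminf: "\<forall>\<^sub>F n in sequentially. (\<integral>\<omega>. f (Z \<omega>) \<partial>N) - e < (\<integral>\<omega>. f (Y n \<omega>) \<partial>P n)"
    if f: "continuous_map mtopology euclideanreal f" and C: "\<And>x. x \<in> M \<Longrightarrow> \<bar>f x\<bar> \<le> C" and e: "0 < e"
    for f e C
  proof -
    have lip: "continuous_map mtopology euclideanreal (lip_approx f j)" for j
      using lip_approx_lipschitz[OF C] by (rule lipschitz_continuous_map) auto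
    have "(\<lambda>j. \<integral>\<omega>. lip_approx f j (Z \<omega>) \<partial>N) \<longlonglongrightarrow> (\<integral>\<omega>. f (Z \<omega>) \<partial>N)"
    proof (rule integral_dominated_convergence)
      show "integrable N (\<lambda>_. C)" using P(2) by (simp add: prob_space.finite_measure finite_measure.integrable_const)
      show "AE \<omega> in N. (\<lambda>j. lip_approx f j (Z \<omega>)) \<longlonglongrightarrow> f (Z \<omega>)"
        using lip_approx_tendsto[OF C ZM f] by auto
      show "AE \<omega> in N. norm (lip_approx f j (Z \<omega>)) \<le> C" for j
        using lip_approx_bounded[OF C ZM] by auto
    qed (use meas f lip in auto)
    then have "\<forall>\<^sub>F j in sequentially. (\<integral>\<omega>. f (Z \<omega>) \<partial>N) - e < (\<integral>\<omega>. lip_approx f j (Z \<omega>) \<partial>N)"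
      by (rule order_tendstoD) (use e in simp)
    then obtain j where j: "(\<integral>\<omega>. f (Z \<omega>) \<partial>N) - e < (\<integral>\<omega>. lip_approx f j (Z \<omega>) \<partial>N)"
      using eventually_happens' sequentially_bot by blast
    have "(\<lambda>n. \<integral>\<omega>. lip_approx f j (Y n \<omega>) \<partial>P n) \<longlonglongrightarrow> (\<integral>\<omega>. lip_approx f j (Z \<omega>) \<partial>N)"
      using lip_approx_lipschitz[OF C] lip_approx_bounded[OF C] by (intro lim[of "real j" _ C]) auto
    then have "\<forall>\<^sub>F n in sequentially. (\<integral>\<omega>. f (Z \<omega>) \<partial>N) - e < (\<integral>\<omega>. lip_approx f j (Y n \<omega>) \<partial>P n)"
      using j by (rule order_tendstoD)
    then show ?thesis
    proof eventually_elim
      case (elim n)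
      interpret prob_space "P n" by (rule P)
      have "(\<integral>\<omega>. lip_approx f j (Y n \<omega>) \<partial>P n) \<le> (\<integral>\<omega>. f (Y n \<omega>) \<partial>P n)"
      proof (rule integral_mono)
        show "integrable (P n) (\<lambda>\<omega>. lip_approx f j (Y n \<omega>))" "integrable (P n) (\<lambda>\<omega>. f (Y n \<omega>))"
          using lip_approx_bounded[OF C YM] C[OF YM] meas f lip
          by (auto intro!: integrable_const_bound[of _ C])
        show "lip_approx f j (Y n \<omega>) \<le> f (Y n \<omega>)" if "\<omega> \<in> space (P n)" for \<omega>
          using C YM[OF that] by (rule lip_approx_le)
      qed
      then show ?case using elim by simp
    qed
  qed
  have "weakly_convergent_to mtopology (\<lambda>n. distr (P n) (borel_sigma mtopology) (Y n)) (distr N (borel_sigma mtopology) Z)"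
    unfolding weakly_convergent_to_def
  proof (intro allI impI, elim conjE)
    fix f :: "'a \<Rightarrow> real"
    assume f: "continuous_map mtopology euclideanreal f" and "bounded (f ` topspace mtopology)"
    then obtain C where C: "\<And>x. x \<in> M \<Longrightarrow> \<bar>f x\<bar> \<le> C" by (auto simp: bounded_iff)
    have f': "continuous_map mtopology euclideanreal (\<lambda>x. - f x)"
      using f by (rule continuous_map_minus)
    have "(\<lambda>n. \<integral>\<omega>. f (Y n \<omega>) \<partial>P n) \<longlonglongrightarrow> (\<integral>\<omega>. f (Z \<omega>) \<partial>N)"
    proof (rule tendstoI)
      fix e :: real assume e: "0 < e"
      show "\<forall>\<^sub>F n in sequentially. dist (\<integral>\<omega>. f (Y n \<omega>) \<partial>P n) (\<integral>\<omega>. f (Z \<omega>) \<partial>N) < e"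
        using liminf[OF f C e] liminf[OF f' _ e, of C] C
        by (auto simp: dist_real_def elim: eventually_elim2)
    qed
    then show "(\<lambda>n. integral\<^sup>L (distr (P n) (borel_sigma mtopology) (Y n)) f)
      \<longlonglongrightarrow> integral\<^sup>L (distr N (borel_sigma mtopology) Z) f"
      using Y Z continuous_map_imp_borel_sigma_measurable[OF f] by (simp add: integral_distr)
  qed
  then show ?thesis using Y Z by (simp add: converges_in_law_def)
qed

end

section \<open>Convergence of random vectors from characteristic functions\<close>

text \<open>The linear span of the characters in the first \<open>m\<close> coordinates. The
  inductive form lets convergence of characteristic functions extend by linearity; products stay in
  the class because frequencies add, which makes it an algebra, as Stone-Weierstrass
  demands.\<close>

inductive_set trig_poly :: "nat \<Rightarrow> ((nat \<Rightarrow> real) \<Rightarrow> complex) set" for m :: nat where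
  exp: "(\<lambda>x. c * iexp (\<Sum>j<m. \<theta> j * x j)) \<in> trig_poly m"
| add: "f \<in> trig_poly m \<Longrightarrow> g \<in> trig_poly m \<Longrightarrow> (\<lambda>x. f x + g x) \<in> trig_poly m"

lemma trig_poly_const: "(\<lambda>x. c) \<in> trig_poly m"
  using trig_poly.exp[of c "\<lambda>_. 0" m] by simp

lemma trig_poly_exp_mult:
  assumes "g \<in> trig_poly m"
  shows "(\<lambda>x. c * iexp (\<Sum>j<m. \<theta> j * x j) * g x) \<in> trig_poly m"
  using assms
proof induction
  case (exp d \<phi>)
  have "(\<lambda>x. c * iexp (\<Sum>j<m. \<theta> j * x j) * (d * iexp (\<Sum>j<m. \<phi> j * x j)))
    = (\<lambda>x. (c * d) * iexp (\<Sum>j<m. (\<theta> j + \<phi> j) * x j))"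
    by (simp add: fun_eq_iff distrib_right sum.distrib distrib_left exp_add)
  then show ?case by (simp only: trig_poly.exp)
next
  case (add f g)
  from trig_poly.add[OF add.IH] show ?case by (simp add: distrib_left)
qed

lemma trig_poly_mult:
  assumes "f \<in> trig_poly m" "g \<in> trig_poly m"
  shows "(\<lambda>x. f x * g x) \<in> trig_poly m"
  using assms(1)
proof induction
  case (exp c \<theta>)
  then show ?case using trig_poly_exp_mult[OF assms(2)] by simp
next
  case (add f g)
  from trig_poly.add[OF add.IH] show ?case by (simp add: distrib_right)
qed

lemma trig_poly_sin:
  assumes "j < m"
  shows "(\<lambda>x. complex_of_real (sin (c * x j))) \<in> trig_poly m"
proof -
  have sum: "(\<Sum>l<m. (if l = j then b else 0) * x l) = b * x j" for b and x :: "nat \<Rightarrow> real"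
    using assms by (simp add: if_distrib[of "\<lambda>b. b * _"] cong: if_cong)
  have "complex_of_real (sin y) = (- \<i> / 2) * iexp y + (\<i> / 2) * iexp (- y)" for y
    by (simp add: complex_eq_iff Re_exp Im_exp)
  then have "(\<lambda>x. complex_of_real (sin (c * x j)))
    = (\<lambda>x. (- \<i> / 2) * iexp (\<Sum>l<m. (if l = j then c else 0) * x l)
         + (\<i> / 2) * iexp (\<Sum>l<m. (if l = j then - c else 0) * x l))"
    unfolding sum by simp
  then show ?thesis by (simp only: trig_poly.add trig_poly.exp)
qed

lemma trig_poly_expectation_tendsto:
  assumes P: "\<And>n. prob_space (P n)" "prob_space N"
    and Y: "\<And>n j. Y n j \<in> borel_measurable (P n)" and W: "\<And>j. W j \<in> borel_measurable N"
    and char: "\<And>\<theta>. (\<lambda>n. \<integral>\<omega>. iexp (\<Sum>j<m. \<theta> j * Y n j \<omega>) \<partial>P n) \<longlonglongrightarrow> (\<integral>\<omega>. iexp (\<Sum>j<m. \<theta> j * W j \<omega>) \<partial>N)"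
    and f: "f \<in> trig_poly m"
  shows "(\<lambda>n. \<integral>\<omega>. f (\<lambda>j. Y n j \<omega>) \<partial>P n) \<longlonglongrightarrow> (\<integral>\<omega>. f (\<lambda>j. W j \<omega>) \<partial>N)"
proof -
  \<comment> \<open>Integrability is carried through the induction so that the integral of a sum
    splits.\<close>
  have "(\<forall>n. integrable (P n) (\<lambda>\<omega>. f (\<lambda>j. Y n j \<omega>))) \<and> integrable N (\<lambda>\<omega>. f (\<lambda>j. W j \<omega>)) \<and> ?thesis"
    using f
  proof induction
    case (exp c \<theta>)
    have [measurable]: "\<And>n j. Y n j \<in> borel_measurable (P n)" "\<And>j. W j \<in> borel_measurable N" by fact+
    have "integrable (P n) (\<lambda>\<omega>. iexp (\<Sum>j<m. \<theta> j * Y n j \<omega>))" for n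
      by (rule finite_measure.integrable_const_bound[of _ _ 1])
        (use P(1) in \<open>auto simp: prob_space.finite_measure\<close>)
    moreover have "integrable N (\<lambda>\<omega>. iexp (\<Sum>j<m. \<theta> j * W j \<omega>))"
      by (rule finite_measure.integrable_const_bound[of _ _ 1])
        (use P(2) in \<open>auto simp: prob_space.finite_measure\<close>)
    ultimately show ?case using tendsto_mult_left[OF char[of \<theta>], of c] by simp
  next
    case (add f g)
    then show ?case by (auto intro!: tendsto_add)
  qed
  then show ?thesis by blast
qed

text \<open>Tychonoff. The \<open>m\<close>-dimensional cube sits in the space of sequences with all
  coordinates from \<open>m\<close> on pinned to 0; this keeps it compact, and its points are
  separated by the coordinates below \<open>m\<close>.\<close>

lemma compact_cube: "compact {s :: nat \<Rightarrow> real. \<forall>j. s j \<in> (if j < m then {-1..1} else {0})}"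
proof -
  have "compactin (product_topology (\<lambda>i::nat. euclidean) UNIV)
    (PiE UNIV (\<lambda>j. if j < m then {-1..1} else {0::real}))"
    by (subst compactin_PiE) auto
  moreover have "(PiE UNIV (\<lambda>j. if j < m then {-1..1} else {0::real}))
     = {s. \<forall>j. s j \<in> (if j < m then {-1..1} else {0})}"
    by (auto simp: PiE_def Pi_def)
  ultimately show ?thesis by (simp add: euclidean_product_topology)
qed

lemma prob_integral_diff_le:
  fixes u v :: "'a \<Rightarrow> real"
  assumes "prob_space M" "integrable M u" "integrable M v" "A \<in> sets M"
    and le: "\<And>\<omega>. \<omega> \<in> space M \<Longrightarrow> \<bar>u \<omega> - v \<omega>\<bar> \<le> a + b * indicator A \<omega>"
  shows "\<bar>(\<integral>\<omega>. u \<omega> \<partial>M) - (\<integral>\<omega>. v \<omega> \<partial>M)\<bar> \<le> a + b * measure M A"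
proof -
  interpret prob_space M by fact
  have iA: "integrable M (indicat_real A)"
    using assms(4) by (intro integrable_const_bound[of _ 1]) auto
  have "\<bar>(\<integral>\<omega>. u \<omega> \<partial>M) - (\<integral>\<omega>. v \<omega> \<partial>M)\<bar> = \<bar>\<integral>\<omega>. u \<omega> - v \<omega> \<partial>M\<bar>"
    using assms by simp
  also have "\<dots> \<le> (\<integral>\<omega>. \<bar>u \<omega> - v \<omega>\<bar> \<partial>M)" by (rule integral_abs_bound)
  also have "\<dots> \<le> (\<integral>\<omega>. a + b * indicator A \<omega> \<partial>M)"
    using assms iA by (intro integral_mono) auto
  also have "\<dots> = a + b * measure M A"
    using iA assms(4) by (simp add: prob_space)
  finally show ?thesis .
qed

lemma tail_prob_small:
  fixes W :: "nat \<Rightarrow> 'a \<Rightarrow> real"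
  assumes "prob_space N" and W: "\<And>j. W j \<in> borel_measurable N" and e: "0 < e"
  shows "\<exists>K0. \<forall>K\<ge>K0. measure N {\<omega>\<in>space N. \<exists>j<m. K < \<bar>W j \<omega>\<bar>} \<le> e"
proof -
  interpret prob_space N by fact
  have [measurable]: "\<And>j. W j \<in> borel_measurable N" by fact
  let ?A = "\<lambda>k::nat. {\<omega>\<in>space N. \<exists>j<m. real k < \<bar>W j \<omega>\<bar>}"
  have "(\<lambda>k. measure N (?A k)) \<longlonglongrightarrow> measure N (\<Inter>k. ?A k)"
    by (intro finite_Lim_measure_decseq) (auto simp: decseq_def intro: le_less_trans[rotated])
  also have "(\<Inter>k. ?A k) = {}"
  proof -
    have "\<exists>k. \<omega> \<notin> ?A k" for \<omega>
    proof -
      obtain k :: nat where k: "(\<Sum>j<m. \<bar>W j \<omega>\<bar>) < real k" using reals_Archimedean2 by blast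
      have "\<bar>W j \<omega>\<bar> \<le> (\<Sum>j<m. \<bar>W j \<omega>\<bar>)" if "j < m" for j using that by (intro member_le_sum) auto
      then show ?thesis using k by (intro exI[of _ k]) fastforce
    qed
    then show ?thesis by blast
  qed
  finally have "\<forall>\<^sub>F k in sequentially. measure N (?A k) < e"
    using e by (intro order_tendstoD(2)) auto
  then obtain k where k: "measure N (?A k) < e" using eventually_happens' sequentially_bot by blast
  have "measure N {\<omega>\<in>space N. \<exists>j<m. K < \<bar>W j \<omega>\<bar>} \<le> measure N (?A k)" if "real k \<le> K" for K
    using that by (intro finite_measure_mono) (auto intro: le_less_trans)
  then show ?thesis using k by (intro exI[of _ "real k"]) force
qed

lemma continuous_on_vector_if:
  fixes F :: "nat \<Rightarrow> (nat \<Rightarrow> real) \<Rightarrow> real"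
  assumes "\<And>j. j < m \<Longrightarrow> continuous_on S (F j)"
  shows "continuous_on S (\<lambda>x j. if j < m then F j x else 0)"
proof (rule continuous_on_coordinatewise_then_product)
  show "continuous_on S (\<lambda>x. if i < m then F i x else 0)" for i
    using assms by (cases "i < m") auto
qed

text \<open>On \<open>\<bar>x\<bar> \<le> K\<close> the triangle wave \<open>arcsin (sin (c x)) / c\<close> with \<open>c = pi / (2 K)\<close> is the identity,
  so up to a tail event every test function is a continuous function of the \<open>sin (c x\<^sub>j)\<close>;
  by Stone-Weierstrass it is then uniformly close to a trigonometric polynomial.\<close>

lemma random_vector_tendsto:
  fixes g :: "(nat \<Rightarrow> real) \<Rightarrow> real" and Y :: "nat \<Rightarrow> nat \<Rightarrow> 'a \<Rightarrow> real" and W :: "nat \<Rightarrow> 'b \<Rightarrow> real"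
  assumes P: "\<And>n. prob_space (P n)" "prob_space N"
    and Y: "\<And>n j. Y n j \<in> borel_measurable (P n)" and W: "\<And>j. W j \<in> borel_measurable N"
    and char: "\<And>\<theta>. (\<lambda>n. \<integral>\<omega>. iexp (\<Sum>j<m. \<theta> j * Y n j \<omega>) \<partial>P n) \<longlonglongrightarrow> (\<integral>\<omega>. iexp (\<Sum>j<m. \<theta> j * W j \<omega>) \<partial>N)"
    and tight: "\<And>e. 0 < e \<Longrightarrow> \<exists>K0. \<forall>K\<ge>K0. \<forall>\<^sub>F n in sequentially.
      measure (P n) {\<omega>\<in>space (P n). \<exists>j<m. K < \<bar>Y n j \<omega>\<bar>} \<le> e"
    and g: "continuous_on UNIV g" "\<And>x. \<bar>g x\<bar> \<le> C"
  shows "(\<lambda>n. \<integral>\<omega>. g (\<lambda>j. if j < m then Y n j \<omega> else 0) \<partial>P n)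
    \<longlonglongrightarrow> (\<integral>\<omega>. g (\<lambda>j. if j < m then W j \<omega> else 0) \<partial>N)"
proof (rule tendstoI)
  fix e :: real assume e: "0 < e"
  have C: "0 \<le> C" using g(2)[of "\<lambda>_. 0"] by linarith
  \<comment> \<open>Error budget: \<open>r + 2 * C * r\<close> for each of the two replacements of
    \<open>g\<close> by \<open>q\<close>, and \<open>r\<close> for the convergence of the
    expectations of \<open>q\<close>, together less than
    \<open>4 * r + 4 * C * r = e\<close>.\<close>
  define r where "r = e / (4 + 4 * C)"
  have r: "0 < r" using e C by (simp add: r_def)
  obtain K1 where K1: "\<forall>K\<ge>K1. \<forall>\<^sub>F n in sequentially. measure (P n) {\<omega>\<in>space (P n). \<exists>j<m. K < \<bar>Y n j \<omega>\<bar>} \<le> r"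
    using tight[OF r] by blast
  obtain K2 where K2: "\<forall>K\<ge>K2. measure N {\<omega>\<in>space N. \<exists>j<m. K < \<bar>W j \<omega>\<bar>} \<le> r"
    using tail_prob_small[of N W r m, OF P(2) W r] by blast
  define K where "K = Max {1, K1, K2}"
  have K: "0 < K" "K1 \<le> K" "K2 \<le> K" by (auto simp: K_def)
  define c where "c = pi / (2 * K)"
  have c: "0 < c" using K by (simp add: c_def)
  define S where "S = {s :: nat \<Rightarrow> real. \<forall>j. s j \<in> (if j < m then {-1..1} else {0})}"
  define sv where "sv x = (\<lambda>j. if j < m then sin (c * x j) else 0)" for x :: "nat \<Rightarrow> real"
  have svS: "sv x \<in> S" for x by (auto simp: sv_def S_def)
  \<comment> \<open>\<open>G (sv x)\<close> is the value of \<open>g\<close> at the first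
    \<open>m\<close> coordinates of \<open>x\<close> as long as these are at most \<open>K\<close>
    in absolute value; otherwise it is just some value bounded by \<open>C\<close>.\<close>
  define G where "G s = g (\<lambda>j. if j < m then arcsin (s j) / c else 0)" for s
  have G: "continuous_on S G"
    unfolding G_def
  proof (rule continuous_on_compose2[OF g(1)])
    show "continuous_on S (\<lambda>x j. if j < m then arcsin (x j) / c else 0)"
    proof (rule continuous_on_vector_if)
      fix j assume "j < m"
      have "continuous_on S (\<lambda>x. x j)"
        by (rule continuous_on_subset[OF continuous_on_product_coordinates]) simp
      moreover have "\<forall>x\<in>S. -1 \<le> x j \<and> x j \<le> 1" using \<open>j < m\<close> by (auto simp: S_def)
      ultimately show "continuous_on S (\<lambda>x. arcsin (x j) / c)"
        using c by (intro continuous_intros) auto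
    qed
  qed simp
  \<comment> \<open>The algebra consists of the continuous \<open>q\<close> on the cube whose
    pullback along \<open>sv\<close> is a trigonometric polynomial. The coordinates belong to it,
    their pullbacks being sines, and they separate points.\<close>
  have "\<exists>q. (continuous_on S q \<and> (\<lambda>x. complex_of_real (q (sv x))) \<in> trig_poly m) \<and> (\<forall>s\<in>S. \<bar>G s - q s\<bar> < r)"
  proof (rule Stone_Weierstrass_HOL)
    show "compact S" unfolding S_def by (rule compact_cube)
    show "continuous_on S G" "0 < r" by fact+
    show "continuous_on S (\<lambda>x. a) \<and> (\<lambda>x. complex_of_real a) \<in> trig_poly m" for a :: real
      by (simp add: trig_poly_const)
    fix x y assume xy: "x \<in> S \<and> y \<in> S \<and> x \<noteq> y"
    then obtain j where j: "x j \<noteq> y j" by blast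
    with xy have "j < m" by (auto simp: S_def split: if_splits) metis
    then show "\<exists>f. (continuous_on S f \<and> (\<lambda>x. complex_of_real (f (sv x))) \<in> trig_poly m) \<and> f x \<noteq> f y"
      using j trig_poly_sin[of j m c]
      by (intro exI[of _ "\<lambda>s. s j"])
        (auto simp: sv_def intro: continuous_on_subset[OF continuous_on_product_coordinates])
  qed (auto intro: continuous_intros trig_poly.add trig_poly_mult)
  then obtain q where q: "continuous_on S q" "(\<lambda>x. complex_of_real (q (sv x))) \<in> trig_poly m"
    "\<And>s. s \<in> S \<Longrightarrow> \<bar>G s - q s\<bar> < r" by blast
  have sv_cont: "continuous_on UNIV sv"
    unfolding sv_def by (intro continuous_on_vector_if continuous_intros continuous_on_product_coordinates)
  have q_cont: "continuous_on UNIV (\<lambda>x. q (sv x))"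
    by (rule continuous_on_compose2[OF q(1) sv_cont]) (use svS in auto)
  have vec_cont: "continuous_on UNIV (\<lambda>x::nat \<Rightarrow> real. g (\<lambda>j. if j < m then x j else 0))"
    by (rule continuous_on_compose2[OF g(1)])
      (auto intro!: continuous_on_vector_if continuous_on_product_coordinates)
  have near: "\<bar>(\<integral>\<omega>. g (\<lambda>j. if j < m then Z j \<omega> else 0) \<partial>M) - (\<integral>\<omega>. q (sv (\<lambda>j. Z j \<omega>)) \<partial>M)\<bar>
    \<le> r + 2 * C * measure M {\<omega>\<in>space M. \<exists>j<m. K < \<bar>Z j \<omega>\<bar>}"
    if M: "prob_space M" and Z: "\<And>j. Z j \<in> borel_measurable M" for M :: "'c measure" and Z
  proof (rule prob_integral_diff_le)
    interpret prob_space M by fact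
    have Z'[measurable]: "(\<lambda>\<omega> j. Z j \<omega>) \<in> borel_measurable M"
      using Z by (rule measurable_coordinatewise_then_product)
    have [measurable]: "\<And>j. Z j \<in> borel_measurable M" by fact
    have "(\<lambda>\<omega>. g (\<lambda>j. if j < m then Z j \<omega> else 0)) \<in> borel_measurable M"
      using measurable_compose[OF Z' borel_measurable_continuous_onI[OF vec_cont]] by simp
    then show "integrable M (\<lambda>\<omega>. g (\<lambda>j. if j < m then Z j \<omega> else 0))"
      using g(2) by (intro integrable_const_bound[of _ C]) auto
    have "(\<lambda>\<omega>. q (sv (\<lambda>j. Z j \<omega>))) \<in> borel_measurable M"
      using measurable_compose[OF Z' borel_measurable_continuous_onI[OF q_cont]] by simp
    moreover have "\<bar>q (sv x)\<bar> \<le> C + r" for x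
      using q(3)[OF svS[of x]] g(2)[of "\<lambda>j. if j < m then arcsin (sv x j) / c else 0"]
      unfolding G_def by linarith
    ultimately show "integrable M (\<lambda>\<omega>. q (sv (\<lambda>j. Z j \<omega>)))"
      by (intro integrable_const_bound[of _ "C + r"]) auto
    show "prob_space M" by fact
    show "{\<omega>\<in>space M. \<exists>j<m. K < \<bar>Z j \<omega>\<bar>} \<in> sets M" by measurable
    fix \<omega> assume w: "\<omega> \<in> space M"
    let ?z = "\<lambda>j. Z j \<omega>"
    have d: "\<bar>G (sv ?z) - q (sv ?z)\<bar> < r" using q(3) svS by blast
    show "\<bar>g (\<lambda>j. if j < m then Z j \<omega> else 0) - q (sv ?z)\<bar>
      \<le> r + 2 * C * indicator {\<omega>\<in>space M. \<exists>j<m. K < \<bar>Z j \<omega>\<bar>} \<omega>"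
    proof (cases "\<exists>j<m. K < \<bar>Z j \<omega>\<bar>")
      case True
      have "\<bar>G (sv ?z)\<bar> \<le> C" unfolding G_def by (rule g)
      then show ?thesis using True w d g(2)[of "\<lambda>j. if j < m then Z j \<omega> else 0"]
        by (simp add: indicator_def)
    next
      case False
      have "arcsin (sin (c * Z j \<omega>)) / c = Z j \<omega>" if "j < m" for j
      proof -
        have "\<bar>Z j \<omega>\<bar> \<le> K" using False that by (meson not_less)
        then have "\<bar>c * Z j \<omega>\<bar> \<le> c * K" using c by (simp add: abs_mult)
        then have "\<bar>c * Z j \<omega>\<bar> \<le> pi / 2" using K by (simp add: c_def)
        then show ?thesis using c by (subst arcsin_sin) auto
      qed
      then have "G (sv ?z) = g (\<lambda>j. if j < m then Z j \<omega> else 0)"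
        unfolding G_def sv_def by (intro arg_cong[of _ _ g]) auto
      then show ?thesis using d False by simp
    qed
  qed
  have "(\<lambda>n. \<integral>\<omega>. complex_of_real (q (sv (\<lambda>j. Y n j \<omega>))) \<partial>P n) \<longlonglongrightarrow> (\<integral>\<omega>. complex_of_real (q (sv (\<lambda>j. W j \<omega>))) \<partial>N)"
    by (rule trig_poly_expectation_tendsto[OF P Y W char q(2)])
  then have "(\<lambda>n. \<integral>\<omega>. q (sv (\<lambda>j. Y n j \<omega>)) \<partial>P n) \<longlonglongrightarrow> (\<integral>\<omega>. q (sv (\<lambda>j. W j \<omega>)) \<partial>N)"
    unfolding integral_complex_of_real tendsto_of_real_iff .
  then have "\<forall>\<^sub>F n in sequentially. dist (\<integral>\<omega>. q (sv (\<lambda>j. Y n j \<omega>)) \<partial>P n) (\<integral>\<omega>. q (sv (\<lambda>j. W j \<omega>)) \<partial>N) < r"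
    using r by (rule tendstoD)
  moreover have "\<forall>\<^sub>F n in sequentially. measure (P n) {\<omega>\<in>space (P n). \<exists>j<m. K < \<bar>Y n j \<omega>\<bar>} \<le> r"
    using K1 K by blast
  ultimately show "\<forall>\<^sub>F n in sequentially. dist (\<integral>\<omega>. g (\<lambda>j. if j < m then Y n j \<omega> else 0) \<partial>P n)
    (\<integral>\<omega>. g (\<lambda>j. if j < m then W j \<omega> else 0) \<partial>N) < e"
  proof eventually_elim
    case (elim n)
    have "2 * C * measure (P n) {\<omega>\<in>space (P n). \<exists>j<m. K < \<bar>Y n j \<omega>\<bar>} \<le> 2 * C * r"
      "2 * C * measure N {\<omega>\<in>space N. \<exists>j<m. K < \<bar>W j \<omega>\<bar>} \<le> 2 * C * r"
      using elim K2 K C by (auto intro!: mult_left_mono)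
    moreover have "r * (4 + 4 * C) = e" using C by (simp add: r_def)
    then have "4 * r + 4 * (C * r) = e" by (simp add: algebra_simps)
    ultimately show ?case
      using near[of "P n" "Y n", OF P(1) Y] near[of N W, OF P(2) W] elim r unfolding dist_real_def by linarith
  qed
qed

section \<open>Increments of Brownian motion\<close>

lemma (in prob_space) char_centered_normal:
  assumes s: "0 < s" and D: "distributed M lborel X (normal_density 0 s)"
  shows "(\<integral>\<omega>. iexp (u * X \<omega>) \<partial>M) = exp (- of_real (u\<^sup>2 * s\<^sup>2 / 2))"
proof -
  have D': "distributed M lborel (\<lambda>\<omega>. (X \<omega> - 0) / s) std_normal_density"
    using normal_standard_normal_convert[OF s, of X 0] D by simp
  have m: "(\<lambda>\<omega>. X \<omega> / s) \<in> borel_measurable M" using distributed_measurable[OF D'] by simp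
  have dist: "distr M borel (\<lambda>\<omega>. X \<omega> / s) = std_normal_distribution"
  proof -
    have "distr M lborel (\<lambda>\<omega>. X \<omega> / s) = density lborel std_normal_density"
      using distributed_distr_eq_density[OF D'] by simp
    moreover have "distr M lborel (\<lambda>\<omega>. X \<omega> / s) = distr M borel (\<lambda>\<omega>. X \<omega> / s)"
      by (rule distr_cong) auto
    ultimately show ?thesis by simp
  qed
  have "(\<integral>\<omega>. iexp (u * X \<omega>) \<partial>M) = (\<integral>\<omega>. iexp ((u * s) * (X \<omega> / s)) \<partial>M)"
    using s by simp
  also have "\<dots> = char (distr M borel (\<lambda>\<omega>. X \<omega> / s)) (u * s)"
    unfolding char_def using m by (subst integral_distr) auto
  also have "\<dots> = exp (- of_real (u\<^sup>2 * s\<^sup>2 / 2))"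
    unfolding dist char_std_normal_distribution by (simp add: power_mult_distrib flip: exp_of_real)
  finally show ?thesis .
qed

text \<open>The joint characteristic function is that of the weighted sum at 1, which factorises by
  independence. Strict increase of the times gives every increment a normal density.\<close>

lemma brownian_increments_char:
  fixes t :: "nat \<Rightarrow> real"
  assumes B: "standard_brownian_motion N B"
    and t: "0 \<le> t 0" "\<And>i. i < m \<Longrightarrow> t i < t (Suc i)"
  shows "(\<integral>\<omega>. iexp (\<Sum>j<m. \<theta> j * (B (t (Suc j)) \<omega> - B (t j) \<omega>)) \<partial>N)
    = of_real (exp (- (\<Sum>j<m. (\<theta> j)\<^sup>2 * (t (Suc j) - t j)) / 2))"
proof -
  have "prob_space N" using B by (simp add: standard_brownian_motion_def)
  then interpret prob_space N .
  let ?D = "\<lambda>j \<omega>. B (t (Suc j)) \<omega> - B (t j) \<omega>"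
  have t0: "j \<le> m \<Longrightarrow> 0 \<le> t j" for j
  proof (induction j)
    case (Suc j)
    then show ?case using t(2)[of j] by simp
  qed (use t(1) in simp)
  have indep: "indep_vars (\<lambda>_. borel) ?D {..<m}"
    using B t(1) less_imp_le[OF t(2)] by (simp add: standard_brownian_motion_def)
  have "indep_vars (\<lambda>_. borel) (\<lambda>j \<omega>. \<theta> j * ?D j \<omega>) {..<m}"
    by (rule indep_vars_compose2[OF indep, where Y="\<lambda>j x. \<theta> j * x"]) simp
  then have "char (distr N borel (\<lambda>\<omega>. \<Sum>j<m. \<theta> j * ?D j \<omega>)) 1 = (\<Prod>j<m. char (distr N borel (\<lambda>\<omega>. \<theta> j * ?D j \<omega>)) 1)"
    by (rule char_distr_sum)
  moreover have meas: "?D j \<in> borel_measurable N" if "j < m" for j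
  proof -
    have "B (t j) \<in> borel_measurable N" "B (t (Suc j)) \<in> borel_measurable N"
      using B t0[of j] t0[of "Suc j"] that by (auto simp: standard_brownian_motion_def)
    then show ?thesis by (rule borel_measurable_diff[rotated])
  qed
  ultimately have "(\<integral>\<omega>. iexp (\<Sum>j<m. \<theta> j * ?D j \<omega>) \<partial>N) = (\<Prod>j<m. \<integral>\<omega>. iexp (\<theta> j * ?D j \<omega>) \<partial>N)"
    unfolding char_def by (subst (asm) integral_distr) (auto simp: integral_distr)
  also have "\<dots> = (\<Prod>j<m. exp (- of_real ((\<theta> j)\<^sup>2 * (t (Suc j) - t j) / 2)))"
  proof (rule prod.cong)
    fix j assume "j \<in> {..<m}"
    then have j: "t j < t (Suc j)" "0 \<le> t j" using t(2) t0[of j] by auto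
    then have "distributed N lborel (?D j) (normal_density 0 (sqrt (t (Suc j) - t j)))"
      using B by (simp add: standard_brownian_motion_def)
    then show "(\<integral>\<omega>. iexp (\<theta> j * ?D j \<omega>) \<partial>N) = exp (- of_real ((\<theta> j)\<^sup>2 * (t (Suc j) - t j) / 2))"
      using char_centered_normal[of "sqrt (t (Suc j) - t j)" "?D j" "\<theta> j"] j by simp
  qed simp
  also have "\<dots> = of_real (exp (- (\<Sum>j<m. (\<theta> j)\<^sup>2 * (t (Suc j) - t j)) / 2))"
    by (simp add: exp_sum[symmetric] sum_negf sum_divide_distrib flip: exp_of_real)
  finally show ?thesis .
qed

section \<open>Stopped product martingales\<close>

lemma filtration_measurable_mono:
  fixes F :: "nat \<Rightarrow> 'a measure"
  assumes "filtration \<Omega> F" "f \<in> measurable (F i) N" "i \<le> j"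
  shows "f \<in> measurable (F j) N"
proof -
  interpret filtration \<Omega> F by fact
  have "subalgebra (F j) (F i)"
    using sets_F_mono[OF assms(3)] by (simp add: subalgebra_def space_F)
  then show ?thesis using assms(2) measurable_from_subalg by blast
qed

text \<open>Deterministic weights serve twice: as the coefficients of a joint characteristic
  function, and as indicators that restrict a sum to a time interval.\<close>

lemma mds_scale:
  assumes M: "prob_space M" and X: "martingale_difference_seq M F X"
  shows "martingale_difference_seq M F (\<lambda>i \<omega>. w i * X i \<omega>)"
  unfolding martingale_difference_seq_def
proof (intro conjI allI impI)
  interpret prob_space M by fact
  show "filtration (space M) F" and sub: "\<And>i. subalgebra M (F i)"
    using X by (auto simp: martingale_difference_seq_def)
  fix i :: nat assume i: "1 \<le> i"
  have Xi: "X i \<in> borel_measurable (F i)" "integrable M (X i)"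
    "AE \<omega> in M. real_cond_exp M (F (i - 1)) (X i) \<omega> = 0"
    using X i by (auto simp: martingale_difference_seq_def)
  show "(\<lambda>\<omega>. w i * X i \<omega>) \<in> borel_measurable (F i)" "integrable M (\<lambda>\<omega>. w i * X i \<omega>)"
    using Xi by auto
  interpret finite_measure_subalgebra M "F (i - 1)"
    using sub by unfold_locales
  show "AE \<omega> in M. real_cond_exp M (F (i - 1)) (\<lambda>\<omega>. w i * X i \<omega>) \<omega> = 0"
    using real_cond_exp_cmult[OF Xi(2), of "w i"] Xi(3) by eventually_elim simp
qed

lemma mds_measurable:
  assumes X: "martingale_difference_seq M F X" and "1 \<le> i" "i \<le> j"
  shows "X i \<in> borel_measurable (F j)"
  using assms filtration_measurable_mono[of "space M" F "X i" i borel j]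
  by (auto simp: martingale_difference_seq_def)

lemma mds_measurable':
  assumes X: "martingale_difference_seq M F X" and "1 \<le> i"
  shows "X i \<in> borel_measurable M"
  using assms by (auto simp: martingale_difference_seq_def)

text \<open>Pulling the predictable factor \<open>U\<close> out of the conditional expectation
  leaves 0. Its boundedness keeps the product integrable, as \<open>X i\<close> is only known to be
  integrable.\<close>

lemma mds_integral_mult:
  fixes U :: "'a \<Rightarrow> real"
  assumes M: "prob_space M" and X: "martingale_difference_seq M F X" and i: "1 \<le> i"
    and U: "U \<in> borel_measurable (F (i - 1))" and C: "\<And>\<omega>. \<omega> \<in> space M \<Longrightarrow> \<bar>U \<omega>\<bar> \<le> C"
  shows "integrable M (\<lambda>\<omega>. U \<omega> * X i \<omega>)" "(\<integral>\<omega>. U \<omega> * X i \<omega> \<partial>M) = 0"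
proof -
  interpret prob_space M by fact
  have Xi: "integrable M (X i)" "AE \<omega> in M. real_cond_exp M (F (i - 1)) (X i) \<omega> = 0"
    and sub: "subalgebra M (F (i - 1))"
    using X i by (auto simp: martingale_difference_seq_def)
  interpret finite_measure_subalgebra M "F (i - 1)"
    using sub by unfold_locales
  have UM: "U \<in> borel_measurable M" using U measurable_from_subalg[OF sub] by blast
  show int: "integrable M (\<lambda>\<omega>. U \<omega> * X i \<omega>)"
  proof (rule Bochner_Integration.integrable_bound)
    show "integrable M (\<lambda>\<omega>. C * X i \<omega>)" using Xi by simp
    show "(\<lambda>\<omega>. U \<omega> * X i \<omega>) \<in> borel_measurable M"
      using UM Xi(1) by measurable
    show "AE \<omega> in M. norm (U \<omega> * X i \<omega>) \<le> norm (C * X i \<omega>)"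
      using C by (intro AE_I2) (auto simp: abs_mult intro!: mult_right_mono order_trans[OF C])
  qed
  have "(\<integral>\<omega>. U \<omega> * X i \<omega> \<partial>M) = (\<integral>\<omega>. U \<omega> * real_cond_exp M (F (i - 1)) (X i) \<omega> \<partial>M)"
    using real_cond_exp_intg(2)[OF int U borel_measurable_integrable[OF Xi(1)]] by simp
  also have "\<dots> = (\<integral>\<omega>. 0 \<partial>M)"
    using Xi(2) by (intro integral_cong_AE) (use UM in auto)
  finally show "(\<integral>\<omega>. U \<omega> * X i \<omega> \<partial>M) = 0" by simp
qed

lemma mds_integral_mult_complex:
  fixes U :: "'a \<Rightarrow> complex"
  assumes M: "prob_space M" and X: "martingale_difference_seq M F X" and i: "1 \<le> i"
    and U: "U \<in> borel_measurable (F (i - 1))" and C: "\<And>\<omega>. \<omega> \<in> space M \<Longrightarrow> cmod (U \<omega>) \<le> C"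
  shows "integrable M (\<lambda>\<omega>. U \<omega> * X i \<omega>)" "(\<integral>\<omega>. U \<omega> * X i \<omega> \<partial>M) = 0"
proof -
  have C': "\<bar>Re (U \<omega>)\<bar> \<le> C" "\<bar>Im (U \<omega>)\<bar> \<le> C" if "\<omega> \<in> space M" for \<omega>
    using C[OF that] abs_Re_le_cmod abs_Im_le_cmod order_trans by blast+
  have U': "(\<lambda>\<omega>. Re (U \<omega>)) \<in> borel_measurable (F (i - 1))" "(\<lambda>\<omega>. Im (U \<omega>)) \<in> borel_measurable (F (i - 1))"
    using U by measurable
  note R = mds_integral_mult[OF M X i U'(1) C'(1)] and I = mds_integral_mult[OF M X i U'(2) C'(2)]
  have eq: "U \<omega> * X i \<omega> = of_real (Re (U \<omega>) * X i \<omega>) + \<i> * of_real (Im (U \<omega>) * X i \<omega>)" for \<omega>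
    by (simp add: complex_eq_iff)
  have 1: "integrable M (\<lambda>\<omega>. complex_of_real (Re (U \<omega>) * X i \<omega>))"
    "integrable M (\<lambda>\<omega>. \<i> * complex_of_real (Im (U \<omega>) * X i \<omega>))"
    using R(1) I(1) by (auto intro!: integrable_of_real simp del: of_real_mult)
  show "integrable M (\<lambda>\<omega>. U \<omega> * X i \<omega>)"
    unfolding eq using 1 by (rule Bochner_Integration.integrable_add)
  show "(\<integral>\<omega>. U \<omega> * X i \<omega> \<partial>M) = 0"
    unfolding eq Bochner_Integration.integral_add[OF 1]
    using R(2) I(2) by (simp del: of_real_mult)
qed

text \<open>Each step adds the predictable multiplier \<open>z * P n * G (Suc n)\<close> times
  \<open>X (Suc n)\<close>, which has mean 0. The bound \<open>C\<close> is imposed on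
  \<open>P j * G (Suc j)\<close> and not on \<open>P j\<close>, since the last factor before
  stopping is unbounded.\<close>

lemma mds_integral_prod:
  fixes z :: complex and G X :: "nat \<Rightarrow> 'a \<Rightarrow> real"
  defines "P \<equiv> \<lambda>n \<omega>. \<Prod>j=1..n. 1 + z * of_real (G j \<omega> * X j \<omega>)"
  assumes M: "prob_space M" and X: "martingale_difference_seq M F X"
    and G: "\<And>j. 1 \<le> j \<Longrightarrow> G j \<in> borel_measurable (F (j - 1))"
    and C: "\<And>j \<omega>. \<omega> \<in> space M \<Longrightarrow> cmod (P j \<omega> * of_real (G (Suc j) \<omega>)) \<le> C"
  shows "integrable M (P n)" "(\<integral>\<omega>. P n \<omega> \<partial>M) = 1"
proof -
  interpret prob_space M by fact
  have filt: "filtration (space M) F" using X by (simp add: martingale_difference_seq_def)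
  have GF: "G j \<in> borel_measurable (F n)" if "1 \<le> j" "j \<le> Suc n" for j n
    using filtration_measurable_mono[OF filt G[OF that(1)]] that by simp
  have PF: "P n \<in> borel_measurable (F n)" for n
    unfolding P_def using GF[of _ n] mds_measurable[OF X, of _ n]
    by (intro borel_measurable_prod borel_measurable_add borel_measurable_times borel_measurable_const)
      (auto intro!: borel_measurable_of_real)
  have "integrable M (P n) \<and> (\<integral>\<omega>. P n \<omega> \<partial>M) = 1"
  proof (induction n)
    case 0 show ?case by (simp add: P_def prob_space)
  next
    case (Suc n)
    let ?U = "\<lambda>\<omega>. z * (P n \<omega> * of_real (G (Suc n) \<omega>))"
    have eq: "P (Suc n) = (\<lambda>\<omega>. P n \<omega> + ?U \<omega> * X (Suc n) \<omega>)"
      by (auto simp: P_def algebra_simps)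
    have "?U \<in> borel_measurable (F (Suc n - 1))"
      unfolding diff_Suc_1 using PF[of n] GF[of "Suc n" n]
      by (intro borel_measurable_times borel_measurable_const borel_measurable_of_real) auto
    moreover have "cmod (?U \<omega>) \<le> cmod z * C" if "\<omega> \<in> space M" for \<omega>
      unfolding norm_mult[of z] using C[OF that] by (rule mult_left_mono) simp
    ultimately have *: "integrable M (\<lambda>\<omega>. ?U \<omega> * X (Suc n) \<omega>)" "(\<integral>\<omega>. ?U \<omega> * X (Suc n) \<omega> \<partial>M) = 0"
      using mds_integral_mult_complex[OF M X, of "Suc n" ?U "cmod z * C"] by auto
    show ?case unfolding eq using * Suc by simp
  qed
  then show "integrable M (P n)" "(\<integral>\<omega>. P n \<omega> \<partial>M) = 1" by auto
qed


section \<open>Exponential maximal inequality\<close>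

lemma exp_le_one_plus:
  fixes x :: real
  assumes "\<bar>x\<bar> \<le> 1 / 2"
  shows "exp (x - 2 * x\<^sup>2) \<le> 1 + x"
proof -
  \<comment> \<open>The constant 2 comes from the negative side, from
    \<open>ln (1 - y) \<ge> - y - 2 * y\<^sup>2\<close> for
    \<open>0 \<le> y \<le> 1 / 2\<close>.\<close>
  have "x - 2 * x\<^sup>2 \<le> ln (1 + x)"
  proof (cases "0 \<le> x")
    case True
    then have "x - x\<^sup>2 \<le> ln (1 + x)" using assms by (intro ln_one_plus_pos_lower_bound) auto
    moreover have "0 \<le> x\<^sup>2" by simp
    ultimately show ?thesis by linarith
  next
    case False
    then show ?thesis using assms ln_one_minus_pos_lower_bound[of "-x"] by simp
  qed
  then have "exp (x - 2 * x\<^sup>2) \<le> exp (ln (1 + x))" by simp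
  also have "\<dots> = 1 + x" using assms by (intro exp_ln) auto
  finally show ?thesis .
qed

text \<open>If some \<open>S j\<close> exceeds \<open>eps\<close> although the squares sum to at
  most \<open>v\<close> and \<open>lam * Q \<le> 1 / 2\<close> (the event \<open>A\<close>), then
  the product \<open>R j\<close> exceeds \<open>C\<close>. The stopped product has mean 1, stays at
  its first value above \<open>C\<close>, and is never below \<open>- C * lam * Q\<close>; hence
  \<open>C * measure M A\<close> is at most 1 plus \<open>C * lam\<close> times the mean of
  \<open>Q\<close>. Of the final \<open>3 * lam\<close> times that mean, one third is this lower
  bound and two thirds are Markov's inequality for \<open>lam * Q \<ge> 1 / 2\<close>.\<close>

lemma mds_exponential_maximal_inequality:
  fixes X :: "nat \<Rightarrow> 'a \<Rightarrow> real" and Q :: "'a \<Rightarrow> real"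
  defines "S \<equiv> \<lambda>j \<omega>. \<Sum>i=1..j. X i \<omega>"
  assumes M: "prob_space M" and X: "martingale_difference_seq M F X"
    and Q: "integrable M Q" "\<And>\<omega>. 0 \<le> Q \<omega>" "\<And>i \<omega>. i \<in> {1..n} \<Longrightarrow> \<bar>X i \<omega>\<bar> \<le> Q \<omega>"
    and lam: "0 < lam"
  shows "measure M {\<omega>\<in>space M. \<exists>j\<le>n. eps < S j \<omega>} \<le>
    exp (2 * lam\<^sup>2 * v - lam * eps) + measure M {\<omega>\<in>space M. v < (\<Sum>i=1..n. (X i \<omega>)\<^sup>2)}
      + 3 * lam * (\<integral>\<omega>. Q \<omega> \<partial>M)"
proof -
  interpret prob_space M by fact
  have Xm[measurable]: "\<And>i. 1 \<le> i \<Longrightarrow> X i \<in> borel_measurable M" using mds_measurable'[OF X] .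
  have Sm[measurable]: "S j \<in> borel_measurable M" for j unfolding S_def by (intro borel_measurable_sum) auto
  define V where "V = (\<lambda>\<omega>. \<Sum>i=1..n. (X i \<omega>)\<^sup>2)"
  have Vm[measurable]: "V \<in> borel_measurable M"
    unfolding V_def by (intro borel_measurable_sum borel_measurable_power) auto
  define C where "C = exp (lam * eps - 2 * lam\<^sup>2 * v)"
  have C: "0 < C" by (simp add: C_def)
  define R where "R l \<omega> = (\<Prod>j=1..l. 1 + lam * X j \<omega>)" for l \<omega>
  \<comment> \<open>\<open>ok j\<close> looks at indices below \<open>j\<close> only, which makes
    \<open>G j\<close> predictable. It fails once \<open>R\<close> has passed \<open>C\<close>, or
    after a step with \<open>lam * \<bar>X l \<omega>\<bar>\<close> above 1/2; the second condition
    keeps \<open>R\<close> nonnegative while the product runs.\<close>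
  define ok where "ok j \<omega> \<longleftrightarrow> (\<forall>l\<in>{0..<j}. R l \<omega> \<le> C \<and> (1 \<le> l \<longrightarrow> lam * \<bar>X l \<omega>\<bar> \<le> 1 / 2))" for j \<omega>
  define G where "G j \<omega> = (if ok j \<omega> then 1 else 0 :: real)" for j \<omega>
  define P where "P l \<omega> = (\<Prod>j=1..l. 1 + lam * (G j \<omega> * X j \<omega>))" for l \<omega>
  have R0: "R 0 \<omega> = 1" "P 0 \<omega> = 1" for \<omega> by (simp_all add: R_def P_def)
  have RS: "R (Suc l) \<omega> = R l \<omega> * (1 + lam * X (Suc l) \<omega>)"
    "P (Suc l) \<omega> = P l \<omega> * (1 + lam * (G (Suc l) \<omega> * X (Suc l) \<omega>))" for l \<omega>
    by (simp_all add: R_def P_def)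
  have ok_mono: "ok j \<omega>" if "ok k \<omega>" "j \<le> k" for j k \<omega>
    using that by (auto simp: ok_def)
  have P_eq: "P j \<omega> = R j \<omega>" if "ok j \<omega>" for j \<omega>
    using that
  proof (induction j)
    case (Suc j)
    then show ?case using ok_mono[of "Suc j" \<omega> j] by (simp add: RS G_def)
  qed (simp add: R0)
  have R_nonneg: "0 \<le> R j \<omega>" if "ok (Suc j) \<omega>" for j \<omega>
    unfolding R_def
  proof (rule prod_nonneg)
    fix i assume "i \<in> {1..j}"
    then have "lam * \<bar>X i \<omega>\<bar> \<le> 1 / 2" using that by (auto simp: ok_def)
    moreover have "- (lam * \<bar>X i \<omega>\<bar>) \<le> lam * X i \<omega>"
      using lam mult_left_mono[of "- \<bar>X i \<omega>\<bar>" "X i \<omega>" lam] by simp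
    ultimately show "0 \<le> 1 + lam * X i \<omega>" by linarith
  qed
  have R_le: "R j \<omega> \<le> C" if "ok (Suc j) \<omega>" for j \<omega>
    using that by (auto simp: ok_def)
  have Gm: "G j \<in> borel_measurable (F (j - 1))" if "1 \<le> j" for j
  proof -
    have XF: "X i \<in> borel_measurable (F (j - 1))" if "1 \<le> i" "i < j" for i
      using mds_measurable[OF X that(1), of "j - 1"] that by simp
    have RF: "R l \<in> borel_measurable (F (j - 1))" if "l < j" for l
      unfolding R_def using XF that by (intro borel_measurable_prod borel_measurable_add
        borel_measurable_times borel_measurable_const) auto
    have pm: "Measurable.pred (F (j - 1)) (\<lambda>\<omega>. R l \<omega> \<le> C \<and> (1 \<le> l \<longrightarrow> lam * \<bar>X l \<omega>\<bar> \<le> 1 / 2))"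
      if "l \<in> {0..<j}" for l
    proof (cases "1 \<le> l")
      case True
      have [measurable]: "X l \<in> borel_measurable (F (j - 1))" "R l \<in> borel_measurable (F (j - 1))"
        using XF[OF True] RF that by auto
      show ?thesis by measurable
    next
      case False
      have [measurable]: "R l \<in> borel_measurable (F (j - 1))"
        using RF that by auto
      have "Measurable.pred (F (j - 1)) (\<lambda>\<omega>. R l \<omega> \<le> C)" by measurable
      then show ?thesis using False by simp
    qed
    have "Measurable.pred (F (j - 1)) (ok j)"
      unfolding ok_def by (intro pred_intros_finite(3) pm) auto
    then show ?thesis unfolding G_def by (intro measurable_If) auto
  qed
  have bound: "cmod ((\<Prod>i=1..j. 1 + of_real lam * of_real (G i \<omega> * X i \<omega>)) * of_real (G (Suc j) \<omega>)) \<le> C" for j \<omega>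
  proof (cases "ok (Suc j) \<omega>")
    case True
    have "(\<Prod>i=1..j. 1 + complex_of_real lam * of_real (G i \<omega> * X i \<omega>)) = of_real (P j \<omega>)"
      by (simp add: P_def)
    also have "P j \<omega> = R j \<omega>" using P_eq ok_mono[OF True] by simp
    finally show ?thesis using R_nonneg[OF True] R_le[OF True] by (simp add: G_def True)
  next
    case False then show ?thesis using C by (simp add: G_def)
  qed
  have "integrable M (\<lambda>\<omega>. complex_of_real (P n \<omega>))" "(\<integral>\<omega>. complex_of_real (P n \<omega>) \<partial>M) = 1"
    using mds_integral_prod[OF M X Gm, of "of_real lam", OF _ bound] by (simp_all add: P_def)
  then have P: "integrable M (P n)" "(\<integral>\<omega>. P n \<omega> \<partial>M) = 1"
    by (auto simp: integral_complex_of_real complex_of_real_integrable_eq)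
  define A where "A = {\<omega>\<in>space M. (\<exists>j\<le>n. eps < S j \<omega>) \<and> V \<omega> \<le> v \<and> lam * Q \<omega> \<le> 1 / 2}"
  have [measurable]: "Q \<in> borel_measurable M" using Q by auto
  have A[measurable]: "A \<in> sets M" unfolding A_def by measurable
  \<comment> \<open>While the product runs, \<open>R j\<close> lies between 0 and \<open>C\<close>,
    so a single step cannot take it below \<open>- C * lam * Q\<close>; once stopped it no longer
    moves.\<close>
  have lower: "j \<le> n \<Longrightarrow> - (C * lam * Q \<omega>) \<le> P j \<omega>" for j \<omega>
  proof (induction j)
    case 0 show ?case using C lam Q(2)[of \<omega>] by (simp add: R0 order_trans[of _ 0])
  next
    case (Suc j)
    show ?case
    proof (cases "ok (Suc j) \<omega>")
      case True
      have R: "P j \<omega> = R j \<omega>" "0 \<le> R j \<omega>" "R j \<omega> \<le> C"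
        using P_eq ok_mono[OF True, of j] R_nonneg[OF True] R_le[OF True] by auto
      have "- Q \<omega> \<le> X (Suc j) \<omega>" using Q(3)[of "Suc j" \<omega>] Suc by auto
      then have "R j \<omega> * (lam * - Q \<omega>) \<le> R j \<omega> * (lam * X (Suc j) \<omega>)"
        using R lam by (intro mult_left_mono) auto
      moreover have "R j \<omega> * (lam * Q \<omega>) \<le> C * (lam * Q \<omega>)"
        using R lam Q(2) by (intro mult_right_mono) auto
      ultimately show ?thesis using R True by (simp add: RS G_def algebra_simps)
    next
      case False then show ?thesis using Suc by (simp add: RS G_def)
    qed
  qed
  have upper: "C \<le> P n \<omega>" if w: "\<omega> \<in> A" for \<omega>
  proof -
    have small: "lam * \<bar>X i \<omega>\<bar> \<le> 1 / 2" if "i \<in> {1..n}" for i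
    proof -
      have "lam * \<bar>X i \<omega>\<bar> \<le> lam * Q \<omega>" using Q(3)[OF that] lam by simp
      then show ?thesis using w by (simp add: A_def)
    qed
    obtain j where j: "j \<le> n" "eps < S j \<omega>" using w by (auto simp: A_def)
    have "C < R j \<omega>"
    proof -
      have "lam * eps < lam * S j \<omega>" using j lam by simp
      moreover have "(\<Sum>i=1..j. (X i \<omega>)\<^sup>2) \<le> V \<omega>"
        unfolding V_def using j by (intro sum_mono2) auto
      then have "2 * lam\<^sup>2 * (\<Sum>i=1..j. (X i \<omega>)\<^sup>2) \<le> 2 * lam\<^sup>2 * v"
        using w by (intro mult_left_mono) (auto simp: A_def)
      ultimately have "C < exp (lam * S j \<omega> - 2 * lam\<^sup>2 * (\<Sum>i=1..j. (X i \<omega>)\<^sup>2))"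
        unfolding C_def by simp
      also have "\<dots> = (\<Prod>i=1..j. exp (lam * X i \<omega> - 2 * (lam * X i \<omega>)\<^sup>2))"
        by (simp add: exp_sum[symmetric] S_def sum_subtractf sum_distrib_left power_mult_distrib mult.assoc)
      also have "\<dots> \<le> R j \<omega>"
        unfolding R_def using small j lam by (intro prod_mono) (auto intro!: exp_le_one_plus simp: abs_mult)
      finally show ?thesis .
    qed
    \<comment> \<open>First passage above \<open>C\<close>. On \<open>A\<close> all steps are small,
      so nothing stops the product earlier, and it is frozen at the value
      \<open>R m\<close>.\<close>
    define m where "m = (LEAST l. C < R l \<omega>)"
    have m: "C < R m \<omega>" "m \<le> j" "\<And>l. l < m \<Longrightarrow> R l \<omega> \<le> C"
      unfolding m_def using \<open>C < R j \<omega>\<close> by (auto intro: LeastI Least_le dest: not_less_Least)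
    have okm: "ok m \<omega>" using m small j(1) by (auto simp: ok_def)
    have nok: "\<not> ok l \<omega>" if "m < l" for l using m(1) that by (auto simp: ok_def intro!: bexI[of _ m])
    have "P l \<omega> = P m \<omega>" if "m \<le> l" for l
      using that
    proof (induction l rule: dec_induct)
      case (step l)
      then show ?case using nok[of "Suc l"] by (simp add: RS G_def)
    qed simp
    then show ?thesis using P_eq[OF okm] m j by simp
  qed
  have iA: "integrable M (indicat_real A)"
    by (rule integrable_const_bound[of _ 1]) auto
  have "C * measure M A = (\<integral>\<omega>. C * indicator A \<omega> \<partial>M)" by simp
  also have "\<dots> \<le> (\<integral>\<omega>. P n \<omega> + C * lam * Q \<omega> \<partial>M)"
  proof (rule integral_mono)
    fix \<omega> assume "\<omega> \<in> space M"
    have "0 \<le> C * lam * Q \<omega>" using C lam Q by simp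
    then show "C * indicator A \<omega> \<le> P n \<omega> + C * lam * Q \<omega>"
      using upper[of \<omega>] lower[of n \<omega>] by (auto simp: indicator_def)
  qed (use P Q iA in auto)
  also have "\<dots> = 1 + C * (lam * (\<integral>\<omega>. Q \<omega> \<partial>M))" using P Q(1) by simp
  finally have "measure M A \<le> 1 / C + lam * (\<integral>\<omega>. Q \<omega> \<partial>M)"
    using C by (simp add: field_simps)
  also have "1 / C = exp (2 * lam\<^sup>2 * v - lam * eps)"
    by (simp add: C_def exp_minus[symmetric] divide_inverse)
  finally have A_le: "measure M A \<le> exp (2 * lam\<^sup>2 * v - lam * eps) + lam * (\<integral>\<omega>. Q \<omega> \<partial>M)" .
  have Qc: "measure M {\<omega>\<in>space M. 1 / (2 * lam) \<le> Q \<omega>} \<le> (\<integral>\<omega>. Q \<omega> \<partial>M) / (1 / (2 * lam))"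
    using Q lam by (intro integral_Markov_inequality_measure[where A="{}"]) auto
  have "{\<omega>\<in>space M. \<exists>j\<le>n. eps < S j \<omega>} \<subseteq> (A \<union> {\<omega>\<in>space M. v < V \<omega>}) \<union> {\<omega>\<in>space M. 1 / (2 * lam) \<le> Q \<omega>}"
    using lam by (auto simp: A_def field_simps not_le)
  then have "measure M {\<omega>\<in>space M. \<exists>j\<le>n. eps < S j \<omega>}
    \<le> measure M ((A \<union> {\<omega>\<in>space M. v < V \<omega>}) \<union> {\<omega>\<in>space M. 1 / (2 * lam) \<le> Q \<omega>})"
    by (intro finite_measure_mono) measurable
  also have "\<dots> \<le> measure M (A \<union> {\<omega>\<in>space M. v < V \<omega>}) + measure M {\<omega>\<in>space M. 1 / (2 * lam) \<le> Q \<omega>}"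
    by (intro measure_Un_le) measurable
  also have "measure M (A \<union> {\<omega>\<in>space M. v < V \<omega>}) \<le> measure M A + measure M {\<omega>\<in>space M. v < V \<omega>}"
    by (intro measure_Un_le) measurable
  finally have "measure M {\<omega>\<in>space M. \<exists>j\<le>n. eps < S j \<omega>}
    \<le> measure M A + measure M {\<omega>\<in>space M. v < V \<omega>} + measure M {\<omega>\<in>space M. 1 / (2 * lam) \<le> Q \<omega>}"
    by simp
  moreover have "3 * lam * (\<integral>\<omega>. Q \<omega> \<partial>M) = lam * (\<integral>\<omega>. Q \<omega> \<partial>M) + (\<integral>\<omega>. Q \<omega> \<partial>M) * (2 * lam)"
    by (simp add: algebra_simps)
  moreover have "measure M {\<omega>\<in>space M. 1 / (2 * lam) \<le> Q \<omega>} \<le> (\<integral>\<omega>. Q \<omega> \<partial>M) * (2 * lam)"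
    using Qc by simp
  ultimately show ?thesis using A_le unfolding V_def by linarith
qed


section \<open>Characteristic functions of martingales\<close>

text \<open>Both functions are compared with their common quadratic Taylor polynomial 1 + i x - x^2
  / 2. The Taylor remainder of the exponential contributes 1/6 to the constant, the other comparison
  1; the sum is rounded up to 2.\<close>

lemma iexp_second_order_bound:
  assumes "\<bar>x\<bar> \<le> 1"
  shows "cmod (iexp x - (1 + \<i> * of_real x) * of_real (exp (- x\<^sup>2 / 2))) \<le> 2 * \<bar>x\<bar> ^ 3"
proof -
  define y where "y = x\<^sup>2 / 2"
  have "x\<^sup>2 \<le> 1" using assms by (simp add: abs_square_le_1)
  then have y: "0 \<le> y" "y \<le> 1" by (auto simp: y_def)
  define r where "r = exp (- y) - (1 - y)"
  have r0: "0 \<le> r" using exp_ge_add_one_self[of "-y"] by (simp add: r_def)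
  have "exp (- y) * (1 + y) \<le> exp (- y) * exp y" by (intro mult_left_mono exp_ge_add_one_self) simp
  then have "exp (- y) * (1 + y) \<le> 1" by (simp add: exp_minus)
  then have "exp (- y) \<le> 1 / (1 + y)" using y by (simp add: field_simps)
  also have "\<dots> \<le> 1 - y + y\<^sup>2" using y by (simp add: field_simps power2_eq_square)
  finally have r1: "r \<le> y\<^sup>2" by (simp add: r_def)
  have "cmod (iexp x - (\<Sum>k\<le>2. (\<i> * of_real x) ^ k / fact k)) \<le> \<bar>x\<bar> ^ Suc 2 / fact (Suc 2)"
    by (rule iexp_approx1)
  then have 1: "cmod (iexp x - (1 + \<i> * of_real x - of_real y)) \<le> \<bar>x\<bar> ^ 3 / 6"
    by (simp add: numeral_2_eq_2 numeral_3_eq_3 y_def power2_eq_square fact_numeral field_simps)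
  have "(1 + \<i> * of_real x - of_real y) - (1 + \<i> * of_real x) * of_real (exp (- y))
    = \<i> * of_real (x * y) - (1 + \<i> * of_real x) * of_real r"
    by (simp add: r_def algebra_simps)
  also have "cmod \<dots> \<le> \<bar>x\<bar> * y + (1 + \<bar>x\<bar>) * r"
    using r0 y norm_triangle_ineq4[of "\<i> * of_real (x * y)" "(1 + \<i> * of_real x) * of_real r"]
      mult_right_mono[OF norm_triangle_ineq[of 1 "\<i> * of_real x"] r0]
    by (simp add: norm_mult abs_mult)
  also have "\<dots> \<le> \<bar>x\<bar> ^ 3 / 2 + 2 * (\<bar>x\<bar> ^ 3 / 4)"
  proof (intro add_mono mult_mono)
    show "\<bar>x\<bar> * y \<le> \<bar>x\<bar> ^ 3 / 2" by (simp add: y_def power3_eq_cube power2_eq_square abs_mult[symmetric] algebra_simps)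
    have "y\<^sup>2 = \<bar>x\<bar> ^ 3 * \<bar>x\<bar> / 4"
      by (simp add: y_def power3_eq_cube power2_eq_square algebra_simps abs_mult[symmetric])
    also have "\<dots> \<le> \<bar>x\<bar> ^ 3 / 4" using assms mult_left_mono[OF assms, of "\<bar>x\<bar> ^ 3"] by simp
    finally show "r \<le> \<bar>x\<bar> ^ 3 / 4" using r1 by simp
  qed (use assms r0 in auto)
  finally have 2: "cmod ((1 + \<i> * of_real x - of_real y) - (1 + \<i> * of_real x) * of_real (exp (- y)))
    \<le> \<bar>x\<bar> ^ 3" by simp
  have "cmod (iexp x - (1 + \<i> * of_real x) * of_real (exp (- y))) \<le> \<bar>x\<bar> ^ 3 / 6 + \<bar>x\<bar> ^ 3"
    using norm_triangle_mono[OF 1 2] by simp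
  also have "\<dots> \<le> 2 * \<bar>x\<bar> ^ 3" by simp
  finally show ?thesis by (simp add: y_def)
qed

text \<open>The first bound multiplies up to the exponential of half the sum of squares; the second
  is for the one factor that overshoots the stopping level.\<close>

lemma cmod_one_plus_i:
  "cmod (1 + \<i> * of_real x) \<le> exp (x\<^sup>2 / 2)" "cmod (1 + \<i> * of_real x) \<le> 1 + \<bar>x\<bar>"
proof -
  have "(cmod (1 + \<i> * of_real x))\<^sup>2 = 1 + x\<^sup>2" by (simp add: cmod_power2)
  also have "\<dots> \<le> exp (x\<^sup>2)" using exp_ge_add_one_self[of "x\<^sup>2"] by simp
  also have "\<dots> = (exp (x\<^sup>2 / 2))\<^sup>2" by (simp add: exp_double[symmetric])
  finally show "cmod (1 + \<i> * of_real x) \<le> exp (x\<^sup>2 / 2)" by (rule power2_le_imp_le) simp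
  show "cmod (1 + \<i> * of_real x) \<le> 1 + \<bar>x\<bar>"
    using norm_triangle_ineq[of 1 "\<i> * of_real x"] by (simp add: norm_mult)
qed

lemma exp_minus_lipschitz:
  fixes x y :: real
  assumes "0 \<le> x" "0 \<le> y"
  shows "\<bar>exp (- x) - exp (- y)\<bar> \<le> \<bar>x - y\<bar>"
proof -
  have *: "\<bar>exp (- x) - exp (- y)\<bar> \<le> \<bar>x - y\<bar>" if "0 \<le> x" "x \<le> y" for x y :: real
  proof -
    have "1 - exp (x - y) \<le> y - x"
      using exp_ge_add_one_self[of "x - y"] by linarith
    then have "exp (- x) * (1 - exp (x - y)) \<le> 1 * (y - x)"
      using that by (intro mult_mono) auto
    moreover have "exp (- x) * (1 - exp (x - y)) = exp (- x) - exp (- y)"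
      by (simp add: algebra_simps exp_add[symmetric])
    ultimately show ?thesis using that by simp
  qed
  show ?thesis using *[of x y] *[of y x] assms by (cases "x \<le> y") (auto simp: abs_minus_commute)
qed

text \<open>The product \<open>P\<close> is stopped when the sum of squares passes
  \<open>v + 1\<close>, so \<open>cmod (P j)\<close> is at most \<open>E * (1 + Q)\<close>. If
  \<open>V n\<close> is within \<open>eta\<close> of \<open>v\<close> and
  \<open>Q \<le> eta\<close>, nothing is stopped: replacing \<open>iexp S\<close> by
  \<open>P n * exp (- V n / 2)\<close> costs at most \<open>2 * eta * c\<close>, and replacing
  \<open>V n\<close> by \<open>v\<close> costs \<open>E * eta\<close>. Outside this event the
  difference is at most \<open>1 + E * (1 + Q)\<close>. Integrating, with mean 1 for
  \<open>P n\<close>, gives the three terms.\<close>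

lemma mds_char_bound:
  fixes X :: "nat \<Rightarrow> 'a \<Rightarrow> real" and Q :: "'a \<Rightarrow> real"
  assumes M: "prob_space M" and X: "martingale_difference_seq M F X"
    and Q: "integrable M Q" "\<And>\<omega>. 0 \<le> Q \<omega>" "\<And>i \<omega>. i \<in> {1..n} \<Longrightarrow> \<bar>X i \<omega>\<bar> \<le> Q \<omega>"
    and v: "0 \<le> v" and eta: "0 < eta" "eta \<le> 1"
  shows "cmod ((\<integral>\<omega>. iexp (\<Sum>i=1..n. X i \<omega>) \<partial>M) - of_real (exp (- v / 2))) \<le>
    (2 * (v + 1) + exp ((v + 1) / 2)) * eta
    + (1 + exp ((v + 1) / 2)) * (measure M {\<omega>\<in>space M. eta < \<bar>(\<Sum>i=1..n. (X i \<omega>)\<^sup>2) - v\<bar>} + (\<integral>\<omega>. Q \<omega> \<partial>M) / eta)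
    + exp ((v + 1) / 2) * (\<integral>\<omega>. Q \<omega> \<partial>M)"
proof -
  interpret prob_space M by fact
  have Xm[measurable]: "\<And>i. 1 \<le> i \<Longrightarrow> X i \<in> borel_measurable M" using mds_measurable'[OF X] .
  have [measurable]: "Q \<in> borel_measurable M" using Q by auto
  define S where "S = (\<lambda>\<omega>. \<Sum>i=1..n. X i \<omega>)"
  have [measurable]: "S \<in> borel_measurable M" unfolding S_def by (intro borel_measurable_sum) auto
  define V where "V = (\<lambda>j \<omega>. \<Sum>i=1..j. (X i \<omega>)\<^sup>2)"
  have Vm[measurable]: "V j \<in> borel_measurable M" for j
    unfolding V_def by (intro borel_measurable_sum borel_measurable_power) auto
  have V_mono: "V i \<omega> \<le> V j \<omega>" if "i \<le> j" for i j \<omega>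
    unfolding V_def using that by (intro sum_mono2) auto
  \<comment> \<open>The slack 1 is at least \<open>eta\<close>, so the product runs to the end
    whenever \<open>V n\<close> is within \<open>eta\<close> of \<open>v\<close>.\<close>
  define c where "c = v + 1"
  define E where "E = exp (c / 2)"
  have E: "1 \<le> E" using v by (simp add: E_def c_def)
  define G where "G j \<omega> = (if V (j - 1) \<omega> \<le> c then 1 else 0 :: real)" for j \<omega>
  define P where "P j \<omega> = (\<Prod>i=1..j. 1 + \<i> * of_real (G i \<omega> * X i \<omega>))" for j \<omega>
  have P0: "P 0 \<omega> = 1" and PS: "P (Suc j) \<omega> = P j \<omega> * (1 + \<i> * of_real (G (Suc j) \<omega> * X (Suc j) \<omega>))" for j \<omega>
    by (simp_all add: P_def)
  have P_le: "cmod (P j \<omega>) \<le> exp (V j \<omega> / 2)" for j \<omega>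
  proof (induction j)
    case 0 show ?case by (simp add: P0 V_def)
  next
    case (Suc j)
    have "cmod (1 + \<i> * of_real (G (Suc j) \<omega> * X (Suc j) \<omega>)) \<le> exp ((G (Suc j) \<omega> * X (Suc j) \<omega>)\<^sup>2 / 2)"
      by (rule cmod_one_plus_i)
    also have "\<dots> \<le> exp ((X (Suc j) \<omega>)\<^sup>2 / 2)" by (simp add: G_def)
    finally have "cmod (P (Suc j) \<omega>) \<le> exp (V j \<omega> / 2) * exp ((X (Suc j) \<omega>)\<^sup>2 / 2)"
      unfolding PS norm_mult using Suc by (intro mult_mono) auto
    also have "\<dots> = exp (V (Suc j) \<omega> / 2)" by (simp add: V_def exp_add[symmetric] add_divide_distrib)
    finally show ?case .
  qed
  have P_le': "cmod (P j \<omega>) \<le> E" if "V j \<omega> \<le> c" for j \<omega>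
    using P_le[of j \<omega>] that by (auto simp: E_def elim!: order_trans)
  have P_bound: "j \<le> n \<Longrightarrow> cmod (P j \<omega>) \<le> E * (1 + Q \<omega>)" for j \<omega>
  proof (induction j)
    case 0 show ?case using E Q(2)[of \<omega>] mult_mono[of 1 E 1 "1 + Q \<omega>"] by (simp add: P0)
  next
    case (Suc j)
    show ?case
    proof (cases "V j \<omega> \<le> c")
      case True
      have "cmod (1 + \<i> * of_real (X (Suc j) \<omega>)) \<le> 1 + Q \<omega>"
        using cmod_one_plus_i(2)[of "X (Suc j) \<omega>"] Q(3)[of "Suc j" \<omega>] Suc by auto
      then show ?thesis
        unfolding PS norm_mult using P_le'[OF True] True E by (intro mult_mono) (auto simp: G_def)
    next
      case False then show ?thesis using Suc by (simp add: PS G_def)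
    qed
  qed
  have Gm: "G j \<in> borel_measurable (F (j - 1))" if "1 \<le> j" for j
  proof -
    have "V (j - 1) \<in> borel_measurable (F (j - 1))" unfolding V_def
      using mds_measurable[OF X, of _ "j - 1"] by (intro borel_measurable_sum borel_measurable_power) auto
    then have "Measurable.pred (F (j - 1)) (\<lambda>\<omega>. V (j - 1) \<omega> \<le> c)" by measurable
    then show ?thesis unfolding G_def by (intro measurable_If) auto
  qed
  have bound: "cmod ((\<Prod>i=1..j. 1 + \<i> * of_real (G i \<omega> * X i \<omega>)) * of_real (G (Suc j) \<omega>)) \<le> E" for j \<omega>
    using P_le'[of j \<omega>] E by (auto simp: G_def P_def)
  have P: "integrable M (P n)" "(\<integral>\<omega>. P n \<omega> \<partial>M) = 1"
    using mds_integral_prod[OF M X Gm, of \<i>, OF _ bound] unfolding P_def by blast+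
  have [measurable]: "P n \<in> borel_measurable M" using P by auto
  define B where "B = {\<omega>\<in>space M. eta < \<bar>V n \<omega> - v\<bar>}"
  have [measurable]: "B \<in> sets M" unfolding B_def by measurable
  let ?a = "of_real (exp (- v / 2)) :: complex"
  have pointwise: "cmod (iexp (S \<omega>) - P n \<omega> * ?a)
    \<le> (2 * c + E) * eta + (1 + E) * (indicator B \<omega> + Q \<omega> / eta) + E * Q \<omega>" if w: "\<omega> \<in> space M" for \<omega>
  proof (cases "\<omega> \<in> B \<or> eta < Q \<omega>")
    case True
    have "cmod (iexp (S \<omega>) - P n \<omega> * ?a) \<le> 1 + E * (1 + Q \<omega>) * 1"
    proof -
      have "cmod (P n \<omega> * ?a) \<le> E * (1 + Q \<omega>) * 1"
        unfolding norm_mult using P_bound[of n \<omega>] v E Q(2)[of \<omega>] by (intro mult_mono) auto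
      then show ?thesis using norm_triangle_ineq4[of "iexp (S \<omega>)" "P n \<omega> * ?a"] by simp
    qed
    \<comment> \<open>Markov's inequality in pointwise form: the indicator of \<open>eta < Q\<close>
      is at most \<open>Q / eta\<close>.\<close>
    moreover have "1 \<le> indicator B \<omega> + Q \<omega> / eta"
      using True Q(2)[of \<omega>] eta by (auto simp: indicator_def)
    then have "(1 + E) * 1 \<le> (1 + E) * (indicator B \<omega> + Q \<omega> / eta)"
      using E by (intro mult_left_mono) auto
    moreover have "0 \<le> (2 * c + E) * eta" using E v eta by (simp add: c_def)
    ultimately show ?thesis by (simp add: algebra_simps)
  next
    case False
    then have Vn: "\<bar>V n \<omega> - v\<bar> \<le> eta" and Qn: "Q \<omega> \<le> eta" using w by (auto simp: B_def not_less)
    then have Vc: "V n \<omega> \<le> c" using eta by (simp add: c_def)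
    have "G i \<omega> = 1" if "i \<in> {1..n}" for i
      using V_mono[of "i - 1" n \<omega>] that Vc unfolding G_def by fastforce
    then have "P n \<omega> = (\<Prod>i=1..n. 1 + \<i> * of_real (X i \<omega>))"
      unfolding P_def by (intro prod.cong) auto
    \<comment> \<open>Spreading \<open>exp (- V n / 2)\<close> over the factors gives each of them
      modulus at most 1, so that the two products differ by at most the sum of the factorwise
      differences.\<close>
    then have eq: "P n \<omega> * of_real (exp (- V n \<omega> / 2)) = (\<Prod>i=1..n. (1 + \<i> * of_real (X i \<omega>)) * of_real (exp (- (X i \<omega>)\<^sup>2 / 2)))"
      by (simp add: prod.distrib V_def exp_sum[symmetric] sum_divide_distrib[symmetric] sum_negf flip: of_real_prod)
    have "iexp (S \<omega>) = (\<Prod>i=1..n. iexp (X i \<omega>))" by (simp add: S_def exp_sum sum_distrib_left)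
    then have "cmod (iexp (S \<omega>) - P n \<omega> * of_real (exp (- V n \<omega> / 2)))
      = cmod ((\<Prod>i=1..n. iexp (X i \<omega>)) - (\<Prod>i=1..n. (1 + \<i> * of_real (X i \<omega>)) * of_real (exp (- (X i \<omega>)\<^sup>2 / 2))))"
      by (simp only: eq)
    also have "\<dots> \<le> (\<Sum>i=1..n. cmod (iexp (X i \<omega>) - (1 + \<i> * of_real (X i \<omega>)) * of_real (exp (- (X i \<omega>)\<^sup>2 / 2))))"
    proof (rule norm_prod_diff)
      fix i
      have "cmod ((1 + \<i> * of_real (X i \<omega>)) * of_real (exp (- (X i \<omega>)\<^sup>2 / 2)))
        \<le> exp ((X i \<omega>)\<^sup>2 / 2) * exp (- (X i \<omega>)\<^sup>2 / 2)"
        unfolding norm_mult using cmod_one_plus_i(1) by (intro mult_mono) auto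
      then show "cmod ((1 + \<i> * of_real (X i \<omega>)) * of_real (exp (- (X i \<omega>)\<^sup>2 / 2))) \<le> 1"
        by (simp add: exp_add[symmetric])
    qed simp
    also have "\<dots> \<le> (\<Sum>i=1..n. 2 * eta * (X i \<omega>)\<^sup>2)"
    proof (rule sum_mono)
      fix i assume "i \<in> {1..n}"
      then have Xi: "\<bar>X i \<omega>\<bar> \<le> eta" using Q(3)[of i \<omega>] Qn by simp
      have "cmod (iexp (X i \<omega>) - (1 + \<i> * of_real (X i \<omega>)) * of_real (exp (- (X i \<omega>)\<^sup>2 / 2))) \<le> 2 * \<bar>X i \<omega>\<bar> ^ 3"
        using Xi eta by (intro iexp_second_order_bound) simp
      also have "\<dots> = 2 * \<bar>X i \<omega>\<bar> * (X i \<omega>)\<^sup>2" by (simp add: power3_eq_cube power2_eq_square)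
      also have "\<dots> \<le> 2 * eta * (X i \<omega>)\<^sup>2" using Xi by (intro mult_right_mono) auto
      finally show "cmod (iexp (X i \<omega>) - (1 + \<i> * of_real (X i \<omega>)) * of_real (exp (- (X i \<omega>)\<^sup>2 / 2)))
        \<le> 2 * eta * (X i \<omega>)\<^sup>2" .
    qed
    also have "\<dots> = 2 * eta * V n \<omega>" by (simp add: V_def sum_distrib_left)
    also have "\<dots> \<le> 2 * eta * c" using Vc eta by simp
    finally have 1: "cmod (iexp (S \<omega>) - P n \<omega> * of_real (exp (- V n \<omega> / 2))) \<le> 2 * eta * c" .
    have "\<bar>exp (- (V n \<omega> / 2)) - exp (- (v / 2))\<bar> \<le> \<bar>V n \<omega> / 2 - v / 2\<bar>"
      using v by (intro exp_minus_lipschitz) (auto simp: V_def intro!: sum_nonneg)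
    also have "\<dots> \<le> eta" using Vn by linarith
    finally have "cmod (P n \<omega> * of_real (exp (- V n \<omega> / 2)) - P n \<omega> * ?a) \<le> E * eta"
      unfolding right_diff_distrib[symmetric] norm_mult of_real_diff[symmetric] norm_of_real
      using P_le'[OF Vc] by (intro mult_mono) (use E in auto)
    from norm_triangle_mono[OF 1 this]
    have "cmod (iexp (S \<omega>) - P n \<omega> * ?a) \<le> 2 * eta * c + E * eta" by simp
    moreover have "0 \<le> (1 + E) * (indicator B \<omega> + Q \<omega> / eta)" "0 \<le> E * Q \<omega>"
      using E Q(2)[of \<omega>] eta by auto
    ultimately show ?thesis by (simp add: algebra_simps)
  qed
  have iB: "integrable M (indicat_real B)"
    by (rule integrable_const_bound[of _ 1]) auto
  have iS: "integrable M (\<lambda>\<omega>. iexp (S \<omega>))"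
    by (rule integrable_const_bound[of _ 1]) auto
  have "(\<integral>\<omega>. iexp (S \<omega>) \<partial>M) - ?a = (\<integral>\<omega>. iexp (S \<omega>) - P n \<omega> * ?a \<partial>M)"
    using iS P by simp
  also have "cmod \<dots> \<le> (\<integral>\<omega>. cmod (iexp (S \<omega>) - P n \<omega> * ?a) \<partial>M)" by (rule integral_norm_bound)
  also have "\<dots> \<le> (\<integral>\<omega>. (2 * c + E) * eta + (1 + E) * (indicator B \<omega> + Q \<omega> / eta) + E * Q \<omega> \<partial>M)"
    using iS P Q(1) iB pointwise by (intro integral_mono) auto
  also have "\<dots> = (2 * c + E) * eta + (1 + E) * (measure M B + (\<integral>\<omega>. Q \<omega> \<partial>M) / eta) + E * (\<integral>\<omega>. Q \<omega> \<partial>M)"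
    using Q(1) iB by (simp add: prob_space)
  finally show ?thesis unfolding S_def B_def V_def c_def E_def .
qed

section \<open>Discretisation in time\<close>

definition grid :: "real \<Rightarrow> nat \<Rightarrow> nat \<Rightarrow> real" where
  "grid T m j = T * real j / real m"

text \<open>The index of the last grid point at or before \<open>s\<close>; on the interval it
  equals \<open>m\<close> only at \<open>s = T\<close>.\<close>

definition grid_clock :: "real \<Rightarrow> nat \<Rightarrow> real \<Rightarrow> nat" where
  "grid_clock T m s = nat \<lfloor>s * real m / T\<rfloor>"

text \<open>For \<open>x 0 = 0\<close> this is \<open>x\<close> frozen at the last grid point. It is
  assembled from increments so that the continuity and measurability of \<open>step_path\<close>
  apply to it.\<close>

definition grid_path :: "real \<Rightarrow> nat \<Rightarrow> (real \<Rightarrow> real) \<Rightarrow> real \<Rightarrow> real" where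
  "grid_path T m x = step_path T (grid_clock T m)
     (\<lambda>i. if 1 \<le> i \<and> i \<le> m then x (grid T m i) - x (grid T m (i - 1)) else 0)"

lemma grid_0: "grid T m 0 = 0"
  by (simp add: grid_def)

lemma grid_m: "0 < m \<Longrightarrow> grid T m m = T"
  by (simp add: grid_def)

lemma grid_step: "grid T m (Suc j) - grid T m j = T / real m"
  by (simp add: grid_def distrib_left add_divide_distrib)

lemma grid_less:
  assumes "0 < T" "0 < m" "i < j"
  shows "grid T m i < grid T m j"
  using assms by (simp add: grid_def divide_strict_right_mono)

lemma grid_mem:
  assumes "0 < T" "0 < m" "j \<le> m"
  shows "grid T m j \<in> {0..T}"
proof -
  have "T * real j \<le> T * real m" using assms by (intro mult_left_mono) auto
  then show ?thesis using assms by (auto simp: grid_def divide_le_eq)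
qed

lemma grid_clock_bounds:
  assumes T: "0 < T" and m: "0 < m" and s: "s \<in> {0..T}"
  shows "grid_clock T m s \<le> m" "grid T m (grid_clock T m s) \<le> s" "s < grid T m (Suc (grid_clock T m s))"
proof -
  let ?y = "s * real m / T"
  have y: "0 \<le> ?y" using assms by simp
  then have fl: "real (grid_clock T m s) = of_int \<lfloor>?y\<rfloor>" by (simp add: grid_clock_def)
  have "s * real m \<le> T * real m" using s by (intro mult_right_mono) auto
  then have "?y \<le> real m" using T by (simp add: divide_le_eq mult.commute)
  then have "real (grid_clock T m s) \<le> real m" unfolding fl using of_int_floor_le[of ?y] by linarith
  then show "grid_clock T m s \<le> m" by simp
  have "real (grid_clock T m s) \<le> ?y" unfolding fl by simp
  then show "grid T m (grid_clock T m s) \<le> s"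
    using T m by (simp add: grid_def field_simps)
  have "?y < real (Suc (grid_clock T m s))" using fl by (simp add: floor_less_iff) linarith
  then show "s < grid T m (Suc (grid_clock T m s))"
    using T m by (simp add: grid_def field_simps)
qed

lemma grid_clock_unique:
  assumes T: "0 < T" and m: "0 < m" and s: "grid T m j \<le> s" "s < grid T m (Suc j)"
  shows "grid_clock T m s = j"
proof -
  have "real j \<le> s * real m / T" "s * real m / T < real j + 1"
    using assms by (simp_all add: grid_def field_simps)
  then have "\<lfloor>s * real m / T\<rfloor> = int j" by (intro floor_unique) auto
  then show ?thesis by (simp add: grid_clock_def)
qed

lemma clock_grid_clock:
  assumes T: "0 < T" and m: "0 < m"
  shows "clock T (grid_clock T m)"
  unfolding clock_def
proof (intro conjI ballI)
  show "mono_on {0..T} (grid_clock T m)"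
    unfolding mono_on_def grid_clock_def using T
    by (auto intro!: nat_mono floor_mono divide_right_mono mult_right_mono)
  fix t assume "t \<in> {0..<T}"
  then have t: "grid T m (grid_clock T m t) \<le> t" "t < grid T m (Suc (grid_clock T m t))"
    using grid_clock_bounds[OF T m, of t] by auto
  then show "\<forall>\<^sub>F s in at_right t. grid_clock T m s = grid_clock T m t"
    unfolding eventually_at_right_field
    by (intro exI[of _ "grid T m (Suc (grid_clock T m t))"]) (auto intro!: grid_clock_unique[OF T m])
qed

lemma grid_path_eq:
  assumes T: "0 < T" and m: "0 < m" and s: "s \<in> {0..T}" and x: "x 0 = 0"
  shows "grid_path T m x s = x (grid T m (grid_clock T m s))"
proof -
  have "(\<Sum>i=1..p. if 1 \<le> i \<and> i \<le> m then x (grid T m i) - x (grid T m (i - 1)) else 0) = x (grid T m p)"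
    if "p \<le> m" for p
    using that by (induction p) (auto simp: grid_0 x)
  then show ?thesis
    using grid_clock_bounds(1)[OF T m s] s by (simp add: grid_path_def step_path_def)
qed

lemma grid_path_in_skorohod_space:
  "0 < T \<Longrightarrow> 0 < m \<Longrightarrow> grid_path T m x \<in> skorohod_space T"
  unfolding grid_path_def by (intro step_path_in_skorohod_space clock_grid_clock)

text \<open>Uniform continuity on the compact interval, without deforming time. \<open>Suc m\<close>
  rules out the grid with no cells.\<close>

lemma grid_path_tendsto:
  assumes T: "0 < T" and x: "continuous_on {0..T} x" "x 0 = 0"
  shows "(\<lambda>m. skorohod_dist T (grid_path T (Suc m) x) (\<lambda>t\<in>{0..T}. x t)) \<longlonglongrightarrow> 0"
proof (rule LIMSEQ_I)
  fix e :: real assume e: "0 < e"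
  have "uniformly_continuous_on {0..T} x"
    using x(1) by (rule compact_uniformly_continuous) simp
  then obtain d where d: "0 < d" "\<And>s t. s \<in> {0..T} \<Longrightarrow> t \<in> {0..T} \<Longrightarrow> dist t s < d \<Longrightarrow> dist (x t) (x s) < e / 2"
    unfolding uniformly_continuous_on_def using e half_gt_zero by metis
  obtain n where n: "T / d < real n" using reals_Archimedean2 by blast
  have "norm (skorohod_dist T (grid_path T (Suc m) x) (\<lambda>t\<in>{0..T}. x t) - 0) < e" if m: "n \<le> m" for m
  proof -
    have mesh: "T / real (Suc m) < d"
      using n m d(1) T by (simp add: field_simps) (smt (verit) mult_left_mono of_nat_le_iff)
    have "skorohod_dist T (grid_path T (Suc m) x) (\<lambda>t\<in>{0..T}. x t) \<le> e / 2"
    proof (rule skorohod_dist_le)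
      show "grid_path T (Suc m) x \<in> skorohod_space T" using T by (intro grid_path_in_skorohod_space) auto
      show "(\<lambda>t\<in>{0..T}. x t) \<in> skorohod_space T" using x by (intro continuous_in_skorohod_space)
      fix s assume s: "s \<in> {0..T}"
      let ?j = "grid_clock T (Suc m) s"
      note b = grid_clock_bounds[OF T zero_less_Suc s, of m]
      have "grid T (Suc m) (Suc ?j) - grid T (Suc m) ?j = T / real (Suc m)"
        by (rule grid_step)
      then have "dist (grid T (Suc m) ?j) s < d" using b mesh by (simp add: dist_real_def)
      then have "dist (x (grid T (Suc m) ?j)) (x s) < e / 2"
        using s grid_mem[OF T zero_less_Suc b(1)] by (intro d)
      then show "\<bar>grid_path T (Suc m) x s - (\<lambda>t\<in>{0..T}. x t) s\<bar> \<le> e / 2"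
        using s grid_path_eq[OF T zero_less_Suc s, of x m] x(2) by (simp add: dist_real_def)
    qed (use e in simp)
    moreover have "0 \<le> skorohod_dist T (grid_path T (Suc m) x) (\<lambda>t\<in>{0..T}. x t)"
      using Metric_space_skorohod[OF T] by (rule Metric_space.nonneg)
    ultimately show ?thesis using e by simp
  qed
  then show "\<exists>no. \<forall>m\<ge>no. norm (skorohod_dist T (grid_path T (Suc m) x) (\<lambda>t\<in>{0..T}. x t) - 0) < e" by blast
qed

text \<open>A continuous monotone function has vanishing quadratic variation: the sum is at most the
  largest increment, small by uniform continuity, times the total growth \<open>a T\<close>.\<close>

lemma sum_square_increments_tendsto_0:
  fixes a :: "real \<Rightarrow> real"
  assumes T: "0 < T" and a: "continuous_on {0..T} a" "mono_on {0..T} a" "a 0 = 0"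
  shows "(\<lambda>m. \<Sum>j<Suc m. (a (grid T (Suc m) (Suc j)) - a (grid T (Suc m) j))\<^sup>2) \<longlonglongrightarrow> 0"
proof (rule LIMSEQ_I)
  fix e :: real assume e: "0 < e"
  have aT: "0 \<le> a T" using mono_onD[OF a(2), of 0 T] a(3) T by simp
  define r where "r = e / (a T + 1)"
  have r: "0 < r" "r * a T < e" using e aT by (simp_all add: r_def field_simps)
  have "uniformly_continuous_on {0..T} a"
    using a(1) by (rule compact_uniformly_continuous) simp
  then obtain d where d: "0 < d" "\<And>s t. s \<in> {0..T} \<Longrightarrow> t \<in> {0..T} \<Longrightarrow> dist t s < d \<Longrightarrow> dist (a t) (a s) < r"
    unfolding uniformly_continuous_on_def using r(1) by metis
  obtain n where n: "T / d < real n" using reals_Archimedean2 by blast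
  have "norm ((\<Sum>j<Suc m. (a (grid T (Suc m) (Suc j)) - a (grid T (Suc m) j))\<^sup>2) - 0) < e" if m: "n \<le> m" for m
  proof -
    let ?t = "grid T (Suc m)"
    have mesh: "T / real (Suc m) < d"
      using n m d(1) T by (simp add: field_simps) (smt (verit) mult_left_mono of_nat_le_iff)
    have "(\<Sum>j<Suc m. (a (?t (Suc j)) - a (?t j))\<^sup>2) \<le> (\<Sum>j<Suc m. r * (a (?t (Suc j)) - a (?t j)))"
    proof (rule sum_mono)
      fix j assume j: "j \<in> {..<Suc m}"
      have t: "?t j \<in> {0..T}" "?t (Suc j) \<in> {0..T}"
        using j T by (auto intro!: grid_mem simp del: atLeastAtMost_iff)
      have less: "?t j < ?t (Suc j)" using T by (intro grid_less) auto
      have "?t (Suc j) - ?t j = T / real (Suc m)" by (rule grid_step)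
      then have "dist (?t (Suc j)) (?t j) < d" using mesh less by (simp add: dist_real_def)
      then have "dist (a (?t (Suc j))) (a (?t j)) < r" using t by (intro d)
      moreover have "a (?t j) \<le> a (?t (Suc j))" using a(2) t less by (auto simp: mono_on_def)
      ultimately show "(a (?t (Suc j)) - a (?t j))\<^sup>2 \<le> r * (a (?t (Suc j)) - a (?t j))"
        unfolding power2_eq_square by (intro mult_right_mono) (auto simp: dist_real_def)
    qed
    also have "\<dots> = r * a T"
      using sum_lessThan_telescope[of "\<lambda>j. a (?t j)" "Suc m"] grid_m[of "Suc m" T]
      by (simp add: sum_distrib_left[symmetric] grid_0 a(3) del: sum.lessThan_Suc)
    finally show ?thesis using r(2) sum_nonneg[of "{..<Suc m}" "\<lambda>j. (a (?t (Suc j)) - a (?t j))\<^sup>2"] by simp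
  qed
  then show "\<exists>no. \<forall>m\<ge>no. norm ((\<Sum>j<Suc m. (a (grid T (Suc m) (Suc j)) - a (grid T (Suc m) j))\<^sup>2) - 0) < e" by blast
qed

lemma continuous_on_step_path:
  assumes T: "0 < T" and c: "clock T c" and h: "continuous_map (skorohod_topology T) euclideanreal h"
  shows "continuous_on UNIV (\<lambda>d. h (step_path T c d))"
proof (subst continuous_on_open_vimage[OF open_UNIV], intro allI impI)
  fix U :: "real set" assume "open U"
  then have "openin (skorohod_topology T) {x \<in> topspace (skorohod_topology T). h x \<in> U}"
    using h by (simp add: continuous_map)
  from open_step_path_vimage[OF T c this]
  show "open ((\<lambda>d. h (step_path T c d)) -` U \<inter> UNIV)"
    using step_path_in_skorohod_space[OF c] by (simp add: topspace_skorohod_topology[OF T] vimage_def)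
qed

text \<open>Vectors of increments are indexed from 0, whereas \<open>step_path\<close> sums from
  1.\<close>

lemma continuous_on_shift:
  "continuous_on UNIV (\<lambda>(y :: nat \<Rightarrow> real) i. if 1 \<le> i \<and> i \<le> p then y (i - 1) else 0)"
proof (rule continuous_on_coordinatewise_then_product)
  show "continuous_on UNIV (\<lambda>y :: nat \<Rightarrow> real. if 1 \<le> i \<and> i \<le> p then y (i - 1) else 0)" for i
    by (cases "1 \<le> i \<and> i \<le> p") (auto simp del: One_nat_def)
qed

section \<open>Convergence in probability to a constant\<close>

lemma tendsto_const_in_prob_add:
  assumes P: "\<And>n. prob_space (M n)"
    and m: "\<And>n. Y n \<in> borel_measurable (M n)" "\<And>n. Z n \<in> borel_measurable (M n)"
    and "tendsto_const_in_prob M Y y" "tendsto_const_in_prob M Z z"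
  shows "tendsto_const_in_prob M (\<lambda>n \<omega>. Y n \<omega> + Z n \<omega>) (y + z)"
  unfolding tendsto_const_in_prob_def
proof (intro allI impI)
  fix e :: real assume e: "0 < e"
  let ?A = "\<lambda>n. {\<omega>\<in>space (M n). e / 2 < \<bar>Y n \<omega> - y\<bar>}" and ?B = "\<lambda>n. {\<omega>\<in>space (M n). e / 2 < \<bar>Z n \<omega> - z\<bar>}"
  have lim: "(\<lambda>n. measure (M n) (?A n) + measure (M n) (?B n)) \<longlonglongrightarrow> 0 + 0"
    using assms(4,5) half_gt_zero[OF e] unfolding tendsto_const_in_prob_def by (intro tendsto_add) blast+
  show "(\<lambda>n. measure (M n) {\<omega>\<in>space (M n). e < \<bar>Y n \<omega> + Z n \<omega> - (y + z)\<bar>}) \<longlonglongrightarrow> 0"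
  proof (rule tendsto_sandwich[OF _ _ tendsto_const lim[unfolded add_0]])
    show "\<forall>\<^sub>F n in sequentially. measure (M n) {\<omega>\<in>space (M n). e < \<bar>Y n \<omega> + Z n \<omega> - (y + z)\<bar>}
      \<le> measure (M n) (?A n) + measure (M n) (?B n)"
    proof (intro always_eventually allI)
      fix n
      interpret prob_space "M n" by fact
      have [measurable]: "Y n \<in> borel_measurable (M n)" "Z n \<in> borel_measurable (M n)" by fact+
      have "{\<omega>\<in>space (M n). e < \<bar>Y n \<omega> + Z n \<omega> - (y + z)\<bar>} \<subseteq> ?A n \<union> ?B n"
      proof
        fix \<omega> assume w: "\<omega> \<in> {\<omega>\<in>space (M n). e < \<bar>Y n \<omega> + Z n \<omega> - (y + z)\<bar>}"
        have "\<bar>Y n \<omega> + Z n \<omega> - (y + z)\<bar> \<le> \<bar>Y n \<omega> - y\<bar> + \<bar>Z n \<omega> - z\<bar>" by linarith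
        then have "e / 2 < \<bar>Y n \<omega> - y\<bar> \<or> e / 2 < \<bar>Z n \<omega> - z\<bar>" using w by (auto simp del: abs_le_iff)
        then show "\<omega> \<in> ?A n \<union> ?B n" using w by blast
      qed
      then have "measure (M n) {\<omega>\<in>space (M n). e < \<bar>Y n \<omega> + Z n \<omega> - (y + z)\<bar>} \<le> measure (M n) (?A n \<union> ?B n)"
        by (intro finite_measure_mono) measurable
      also have "\<dots> \<le> measure (M n) (?A n) + measure (M n) (?B n)"
        by (intro measure_Un_le) measurable
      finally show "measure (M n) {\<omega>\<in>space (M n). e < \<bar>Y n \<omega> + Z n \<omega> - (y + z)\<bar>}
        \<le> measure (M n) (?A n) + measure (M n) (?B n)" .
    qed
  qed auto
qed

lemma tendsto_const_in_prob_const: "tendsto_const_in_prob M (\<lambda>n \<omega>. c) c"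
  by (simp add: tendsto_const_in_prob_def)

lemma tendsto_const_in_prob_cmult:
  assumes "tendsto_const_in_prob M Y y"
  shows "tendsto_const_in_prob M (\<lambda>n \<omega>. c * Y n \<omega>) (c * y)"
proof (cases "c = 0")
  case True then show ?thesis using tendsto_const_in_prob_const[of M 0] by simp
next
  case False
  show ?thesis unfolding tendsto_const_in_prob_def
  proof (intro allI impI)
    fix e :: real assume e: "0 < e"
    have "(e < \<bar>c * u - c * y\<bar>) = (e / \<bar>c\<bar> < \<bar>u - y\<bar>)" for u
      using False by (simp add: right_diff_distrib[symmetric] abs_mult divide_less_eq mult.commute)
    then show "(\<lambda>n. measure (M n) {\<omega> \<in> space (M n). e < \<bar>c * Y n \<omega> - c * y\<bar>}) \<longlonglongrightarrow> 0"
      using assms e False by (simp add: tendsto_const_in_prob_def)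
  qed
qed

lemma tendsto_const_in_prob_sum:
  assumes P: "\<And>n. prob_space (M n)" and "finite J"
    and "\<And>n j. j \<in> J \<Longrightarrow> Y j n \<in> borel_measurable (M n)"
    and "\<And>j. j \<in> J \<Longrightarrow> tendsto_const_in_prob M (Y j) (y j)"
  shows "tendsto_const_in_prob M (\<lambda>n \<omega>. \<Sum>j\<in>J. Y j n \<omega>) (\<Sum>j\<in>J. y j)"
  using assms(2-4)
proof (induction J)
  case empty then show ?case using tendsto_const_in_prob_const[of M 0] by simp
next
  case (insert j J)
  then have "tendsto_const_in_prob M (\<lambda>n \<omega>. Y j n \<omega> + (\<Sum>j\<in>J. Y j n \<omega>)) (y j + (\<Sum>j\<in>J. y j))"
    by (intro tendsto_const_in_prob_add P) auto
  then show ?case using insert by simp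
qed

section \<open>Martingale difference arrays\<close>

text \<open>As a weight, this turns a sum over the indices of a time interval into a sum over the
  whole row, so that one martingale estimate serves all intervals.\<close>

definition block :: "nat \<Rightarrow> nat \<Rightarrow> nat \<Rightarrow> real" where
  "block p q i = (if p < i \<and> i \<le> q then 1 else 0)"

lemma sum_block:
  fixes x :: "nat \<Rightarrow> real"
  assumes "p \<le> q" "q \<le> r"
  shows "(\<Sum>i=1..r. block p q i * x i) = (\<Sum>i=1..q. x i) - (\<Sum>i=1..p. x i)"
proof -
  have "(\<Sum>i=1..r. block p q i * x i) = (\<Sum>i\<in>{1..q} - {1..p}. x i)"
    using assms by (intro sum.mono_neutral_cong_right) (auto simp: block_def)
  also have "\<dots> = (\<Sum>i=1..q. x i) - (\<Sum>i=1..p. x i)"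
    using assms by (intro sum_diff) auto
  finally show ?thesis .
qed

lemma block_power2: "(block p q i)\<^sup>2 = block p q i"
  by (simp add: block_def)

text \<open>Consecutive blocks are disjoint, so all cross terms vanish.\<close>

lemma square_sum_blocks:
  assumes "\<And>j. j < m \<Longrightarrow> p j \<le> p (Suc j)"
  shows "(\<Sum>j<m. \<theta> j * block (p j) (p (Suc j)) i)\<^sup>2 = (\<Sum>j<m. (\<theta> j)\<^sup>2 * block (p j) (p (Suc j)) i)"
proof -
  have mono: "j \<le> l \<Longrightarrow> l \<le> m \<Longrightarrow> p j \<le> p l" for j l
    by (induction l rule: dec_induct) (use assms in \<open>auto intro: order_trans\<close>)
  have disj: "block (p j) (p (Suc j)) i * block (p l) (p (Suc l)) i = 0" if "j < l" "l < m" for j l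
    using mono[of "Suc j" l] that by (auto simp: block_def)
  have *: "(\<theta> j * block (p j) (p (Suc j)) i) * (\<theta> l * block (p l) (p (Suc l)) i)
    = (if l = j then (\<theta> j)\<^sup>2 * block (p j) (p (Suc j)) i else 0)" if "j < m" "l < m" for j l
    using disj[of j l] disj[of l j] that block_power2[of "p j" "p (Suc j)" i]
    by (cases j l rule: linorder_cases) (auto simp: power2_eq_square)
  have "(\<Sum>j<m. \<theta> j * block (p j) (p (Suc j)) i)\<^sup>2
    = (\<Sum>j<m. \<Sum>l<m. (\<theta> j * block (p j) (p (Suc j)) i) * (\<theta> l * block (p l) (p (Suc l)) i))"
    unfolding power2_eq_square by (rule sum_product)
  also have "\<dots> = (\<Sum>j<m. \<Sum>l<m. if l = j then (\<theta> j)\<^sup>2 * block (p j) (p (Suc j)) i else 0)"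
    using * by (intro sum.cong refl) auto
  also have "\<dots> = (\<Sum>j<m. (\<theta> j)\<^sup>2 * block (p j) (p (Suc j)) i)" by simp
  finally show ?thesis .
qed

text \<open>Quadratic decay is what turns the exponential tail into a multiple of the squared
  increment of \<open>a\<close>, summable over a grid to something small.\<close>

lemma exp_minus_le_inverse_square:
  fixes x :: real
  assumes "0 < x"
  shows "exp (- x) \<le> 2 / x\<^sup>2"
proof -
  have "x\<^sup>2 / 2 \<le> exp x" using exp_lower_Taylor_quadratic[of x] assms by simp
  then show ?thesis using assms by (simp add: exp_minus field_simps)
qed

text \<open>The filtrations are chosen once and kept as the parameter \<open>F\<close>. Right
  continuity of \<open>k n\<close> enters separately, as \<open>clock\<close>, where paths must lie
  in the Skorohod space.\<close>

locale clt_array =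
  fixes T :: real and k :: "nat \<Rightarrow> real \<Rightarrow> nat" and a :: "real \<Rightarrow> real"
    and M :: "nat \<Rightarrow> 'a measure" and F :: "nat \<Rightarrow> nat \<Rightarrow> 'a measure" and X :: "nat \<Rightarrow> nat \<Rightarrow> 'a \<Rightarrow> real"
  assumes T: "0 < T"
    and k_mono: "\<And>n. mono_on {0..T} (k n)" and k_zero: "\<And>n. k n 0 = 0"
    and a_mono: "strict_mono_on {0..T} a" and a_cont: "continuous_on {0..T} a" and a_zero: "a 0 = 0"
    and prob: "\<And>n. prob_space (M n)"
    and mds: "\<And>n. martingale_difference_seq (M n) (F n) (X n)"
    and max_L2: "tendsto_0_in_L2 M (\<lambda>n \<omega>. Max (insert 0 ((\<lambda>i. \<bar>X n i \<omega>\<bar>) ` {1..k n T})))"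
    and sum_squares: "\<And>t. t \<in> {0..T} \<Longrightarrow>
      tendsto_const_in_prob M (\<lambda>n \<omega>. \<Sum>i=1..k n t. (X n i \<omega>)\<^sup>2) (a t)"
begin

definition Q :: "nat \<Rightarrow> 'a \<Rightarrow> real" where
  "Q n \<omega> = Max (insert 0 ((\<lambda>i. \<bar>X n i \<omega>\<bar>) ` {1..k n T}))"

definition S :: "nat \<Rightarrow> real \<Rightarrow> 'a \<Rightarrow> real" where
  "S n t \<omega> = (\<Sum>i=1..k n t. X n i \<omega>)"

lemma X_measurable: "1 \<le> i \<Longrightarrow> X n i \<in> borel_measurable (M n)"
  using mds_measurable'[OF mds] .

lemma S_measurable: "S n t \<in> borel_measurable (M n)"
  unfolding S_def using X_measurable by (intro borel_measurable_sum) auto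

lemma V_measurable: "(\<lambda>\<omega>. \<Sum>i=1..k n t. (X n i \<omega>)\<^sup>2) \<in> borel_measurable (M n)"
  using X_measurable by (intro borel_measurable_sum borel_measurable_power) auto

lemma Q_nonneg: "0 \<le> Q n \<omega>"
  unfolding Q_def by (intro Max_ge) auto

lemma Q_ge: "i \<in> {1..k n T} \<Longrightarrow> \<bar>X n i \<omega>\<bar> \<le> Q n \<omega>"
  unfolding Q_def by (intro Max_ge) auto

lemma Q_integrable: "integrable (M n) (Q n)"
proof -
  interpret prob_space "M n" by (rule prob)
  have "Q n \<in> borel_measurable (M n)" "integrable (M n) (\<lambda>\<omega>. (Q n \<omega>)\<^sup>2)"
    using max_L2 unfolding tendsto_0_in_L2_def Q_def[abs_def] by auto
  then show ?thesis by (rule square_integrable_imp_integrable)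
qed

text \<open>Nonnegativity of the variance passes from the second moment to the mean, the quantity
  that appears in both martingale estimates.\<close>

lemma Q_tendsto_0: "(\<lambda>n. \<integral>\<omega>. Q n \<omega> \<partial>M n) \<longlonglongrightarrow> 0"
proof -
  have sq: "integrable (M n) (\<lambda>\<omega>. (Q n \<omega>)\<^sup>2)" for n
    using max_L2 unfolding tendsto_0_in_L2_def Q_def[abs_def] by auto
  have lim: "(\<lambda>n. sqrt (\<integral>\<omega>. (Q n \<omega>)\<^sup>2 \<partial>M n)) \<longlonglongrightarrow> sqrt 0"
    using max_L2 unfolding tendsto_0_in_L2_def Q_def[abs_def] by (intro tendsto_real_sqrt) auto
  have "(\<integral>\<omega>. Q n \<omega> \<partial>M n) \<le> sqrt (\<integral>\<omega>. (Q n \<omega>)\<^sup>2 \<partial>M n)" for n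
  proof -
    interpret prob_space "M n" by (rule prob)
    have "0 \<le> variance (Q n)" by (rule variance_positive)
    also have "\<dots> = (\<integral>\<omega>. (Q n \<omega>)\<^sup>2 \<partial>M n) - (\<integral>\<omega>. Q n \<omega> \<partial>M n)\<^sup>2"
      using Q_integrable sq by (rule variance_eq)
    finally show ?thesis by (intro real_le_rsqrt) simp
  qed
  then show ?thesis
    using lim Q_nonneg by (intro tendsto_sandwich[OF _ _ tendsto_const lim[unfolded real_sqrt_zero]])
      (auto intro!: always_eventually integral_nonneg)
qed

lemma k_le: "0 \<le> s \<Longrightarrow> s \<le> t \<Longrightarrow> t \<le> T \<Longrightarrow> k n s \<le> k n t"
  using k_mono[of n] by (auto simp: mono_on_def)

section \<open>Joint characteristic functions of the increments\<close>

lemma weighted_char_tendsto: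
  assumes w: "\<And>n i. \<bar>w n i\<bar> \<le> C" and v: "0 \<le> v"
    and V: "tendsto_const_in_prob M (\<lambda>n \<omega>. \<Sum>i=1..k n T. (w n i * X n i \<omega>)\<^sup>2) v"
  shows "(\<lambda>n. \<integral>\<omega>. iexp (\<Sum>i=1..k n T. w n i * X n i \<omega>) \<partial>M n) \<longlonglongrightarrow> of_real (exp (- v / 2))"
proof (rule tendstoI)
  fix e :: real assume e: "0 < e"
  have C: "0 \<le> C" using w[of 0 0] by linarith
  define A where "A = 2 * (v + 1) + exp ((v + 1) / 2)"
  have A: "0 < A" using v by (simp add: A_def add_pos_pos)
  \<comment> \<open>\<open>eta\<close> is fixed before \<open>n\<close> grows: it makes the first
    error term less than \<open>e\<close>, and the remaining terms, even with the division by
    \<open>eta\<close>, tend to 0.\<close>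
  define eta where "eta = min 1 (e / (2 * A))"
  have eta: "0 < eta" "eta \<le> 1" using e A by (auto simp: eta_def)
  have Aeta: "A * eta < e"
  proof -
    have "A * eta \<le> A * (e / (2 * A))" using A by (intro mult_left_mono) (auto simp: eta_def)
    then show ?thesis using A e by simp
  qed
  let ?p = "\<lambda>n. measure (M n) {\<omega>\<in>space (M n). eta < \<bar>(\<Sum>i=1..k n T. (w n i * X n i \<omega>)\<^sup>2) - v\<bar>}"
  let ?q = "\<lambda>n. C * (\<integral>\<omega>. Q n \<omega> \<partial>M n)"
  let ?b = "\<lambda>n. A * eta + (1 + exp ((v + 1) / 2)) * (?p n + ?q n / eta) + exp ((v + 1) / 2) * ?q n"
  have "?p \<longlonglongrightarrow> 0" using V eta by (simp add: tendsto_const_in_prob_def)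
  then have "?b \<longlonglongrightarrow> A * eta + (1 + exp ((v + 1) / 2)) * (0 + (C * 0) / eta) + exp ((v + 1) / 2) * (C * 0)"
    using eta Q_tendsto_0 by (intro tendsto_intros) auto
  then have "\<forall>\<^sub>F n in sequentially. ?b n < e"
    using Aeta by (intro order_tendstoD(2)) auto
  moreover have "cmod ((\<integral>\<omega>. iexp (\<Sum>i=1..k n T. w n i * X n i \<omega>) \<partial>M n) - of_real (exp (- v / 2))) \<le> ?b n" for n
  proof -
    have "\<bar>w n i * X n i \<omega>\<bar> \<le> C * Q n \<omega>" if "i \<in> {1..k n T}" for i \<omega>
      unfolding abs_mult using w Q_ge[OF that] C by (intro mult_mono) auto
    then show ?thesis
      using mds_char_bound[OF prob mds_scale[OF prob mds], of n "\<lambda>\<omega>. C * Q n \<omega>" "k n T" "w n" v eta]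
        Q_integrable[of n] Q_nonneg[of n] C v eta by (simp add: A_def)
  qed
  ultimately show "\<forall>\<^sub>F n in sequentially. dist (\<integral>\<omega>. iexp (\<Sum>i=1..k n T. w n i * X n i \<omega>) \<partial>M n)
    (of_real (exp (- v / 2))) < e"
    unfolding dist_norm by (auto elim!: eventually_mono intro: le_less_trans)
qed

text \<open>The linear combination of increments is a single weighted row sum with the step weights
  \<open>w\<close>. Since the blocks are disjoint, its squares sum to a combination of increments of
  the sums of squares, whose limit is the variance on the right.\<close>

lemma increments_char_tendsto:
  assumes t: "\<And>j. j \<le> m \<Longrightarrow> t j \<in> {0..T}" "\<And>j. j < m \<Longrightarrow> t j < t (Suc j)"
  shows "(\<lambda>n. \<integral>\<omega>. iexp (\<Sum>j<m. \<theta> j * (S n (t (Suc j)) \<omega> - S n (t j) \<omega>)) \<partial>M n)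
    \<longlonglongrightarrow> of_real (exp (- (\<Sum>j<m. (\<theta> j)\<^sup>2 * (a (t (Suc j)) - a (t j))) / 2))"
proof -
  define w where "w n i = (\<Sum>j<m. \<theta> j * block (k n (t j)) (k n (t (Suc j))) i)" for n i
  have kt: "k n (t j) \<le> k n (t (Suc j))" "k n (t (Suc j)) \<le> k n T" if "j < m" for n j
    using t(1)[of j] t(1)[of "Suc j"] t(2)[of j] that by (auto intro!: k_le)
  have lin: "(\<Sum>i=1..k n T. w n i * x i)
    = (\<Sum>j<m. \<theta> j * ((\<Sum>i=1..k n (t (Suc j)). x i) - (\<Sum>i=1..k n (t j). x i)))" for n and x :: "nat \<Rightarrow> real"
  proof -
    have "(\<Sum>i=1..k n T. w n i * x i) = (\<Sum>j<m. \<Sum>i=1..k n T. \<theta> j * (block (k n (t j)) (k n (t (Suc j))) i * x i))"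
      unfolding w_def sum_distrib_right by (subst sum.swap) (simp add: mult.assoc)
    also have "\<dots> = (\<Sum>j<m. \<theta> j * ((\<Sum>i=1..k n (t (Suc j)). x i) - (\<Sum>i=1..k n (t j). x i)))"
      using kt by (intro sum.cong refl) (simp add: sum_distrib_left[symmetric] sum_block[unfolded One_nat_def])
    finally show ?thesis .
  qed
  \<comment> \<open>The difference is written with a factor \<open>- 1\<close> so that the rules for
    sums and multiples of limits in probability match.\<close>
  have quad: "(\<Sum>i=1..k n T. (w n i * x i)\<^sup>2)
    = (\<Sum>j<m. (\<theta> j)\<^sup>2 * ((\<Sum>i=1..k n (t (Suc j)). (x i)\<^sup>2) + (- 1) * (\<Sum>i=1..k n (t j). (x i)\<^sup>2)))"
    for n and x :: "nat \<Rightarrow> real"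
  proof -
    have "(\<Sum>i=1..k n T. (w n i * x i)\<^sup>2)
      = (\<Sum>i=1..k n T. \<Sum>j<m. (\<theta> j)\<^sup>2 * (block (k n (t j)) (k n (t (Suc j))) i * (x i)\<^sup>2))"
      unfolding power_mult_distrib w_def using kt
      by (subst square_sum_blocks) (auto simp: sum_distrib_right mult.assoc)
    also have "\<dots> = (\<Sum>j<m. \<Sum>i=1..k n T. (\<theta> j)\<^sup>2 * (block (k n (t j)) (k n (t (Suc j))) i * (x i)\<^sup>2))"
      by (rule sum.swap)
    also have "\<dots> = (\<Sum>j<m. (\<theta> j)\<^sup>2 * ((\<Sum>i=1..k n (t (Suc j)). (x i)\<^sup>2) + (- 1) * (\<Sum>i=1..k n (t j). (x i)\<^sup>2)))"
      using kt by (intro sum.cong refl) (simp add: sum_distrib_left[symmetric] sum_block[unfolded One_nat_def])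
    finally show ?thesis .
  qed
  have "tendsto_const_in_prob M (\<lambda>n \<omega>. \<Sum>j<m. (\<theta> j)\<^sup>2 * ((\<Sum>i=1..k n (t (Suc j)). (X n i \<omega>)\<^sup>2) + (- 1) * (\<Sum>i=1..k n (t j). (X n i \<omega>)\<^sup>2)))
      (\<Sum>j<m. (\<theta> j)\<^sup>2 * (a (t (Suc j)) + (- 1) * a (t j)))"
    by (intro tendsto_const_in_prob_sum tendsto_const_in_prob_cmult tendsto_const_in_prob_add sum_squares prob
        t(1) borel_measurable_times borel_measurable_const V_measurable borel_measurable_add) auto
  then have V: "tendsto_const_in_prob M (\<lambda>n \<omega>. \<Sum>i=1..k n T. (w n i * X n i \<omega>)\<^sup>2)
      (\<Sum>j<m. (\<theta> j)\<^sup>2 * (a (t (Suc j)) - a (t j)))"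
    unfolding quad by simp
  have "\<bar>w n i\<bar> \<le> (\<Sum>j<m. \<bar>\<theta> j\<bar>)" for n i
    unfolding w_def by (intro order_trans[OF sum_abs] sum_mono) (auto simp: block_def)
  moreover have "0 \<le> (\<Sum>j<m. (\<theta> j)\<^sup>2 * (a (t (Suc j)) - a (t j)))"
    using t strict_mono_onD[OF a_mono] by (intro sum_nonneg mult_nonneg_nonneg) (auto simp: less_imp_le)
  ultimately have "(\<lambda>n. \<integral>\<omega>. iexp (\<Sum>i=1..k n T. w n i * X n i \<omega>) \<partial>M n)
    \<longlonglongrightarrow> of_real (exp (- (\<Sum>j<m. (\<theta> j)\<^sup>2 * (a (t (Suc j)) - a (t j))) / 2))"
    by (rule weighted_char_tendsto[OF _ _ V])
  then show ?thesis unfolding lin S_def .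
qed

section \<open>Oscillation of the partial sums between grid points\<close>

lemma block_oscillation_bound:
  assumes st: "0 \<le> s" "s < t" "t \<le> T" and eps: "0 < eps" and e: "0 < e"
  shows "\<forall>\<^sub>F n in sequentially. measure (M n)
      {\<omega>\<in>space (M n). \<exists>i\<in>{k n s..k n t}. eps < \<bar>(\<Sum>l=1..i. X n l \<omega>) - S n s \<omega>\<bar>}
    \<le> 1024 * (a t - a s)\<^sup>2 / eps ^ 4 + e"
proof -
  define D where "D = a t - a s"
  have D: "0 < D" using strict_mono_onD[OF a_mono, of s t] st by (simp add: D_def)
  \<comment> \<open>The maximal inequality is applied at level \<open>v = 2 * D\<close>, twice the
    limit of the squares, so that exceeding it has vanishing probability. This \<open>lam\<close>
    minimises the resulting exponent \<open>4 * D * lam\<^sup>2 - lam * eps\<close>, with minimum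
    \<open>- x\<close>.\<close>
  define lam where "lam = eps / (8 * D)"
  have lam: "0 < lam" using eps D by (simp add: lam_def)
  define x where "x = eps\<^sup>2 / (16 * D)"
  have x: "0 < x" using eps D by (simp add: x_def)
  have expo: "2 * lam\<^sup>2 * (2 * D) - lam * eps = - x"
    using D by (simp add: lam_def x_def power2_eq_square field_simps)
  have "2 * exp (- x) \<le> 2 * (2 / x\<^sup>2)" using exp_minus_le_inverse_square[OF x] by simp
  \<comment> \<open>1024 is 4 times 16 squared: the factor 2 for the two signs, the 2 of the
    quadratic bound, and the 16 in \<open>x\<close>.\<close>
  also have "\<dots> = 1024 * D\<^sup>2 / eps ^ 4"
    using D eps by (simp add: x_def power2_eq_square power4_eq_xxxx field_simps)
  finally have ex: "2 * exp (- x) \<le> 1024 * D\<^sup>2 / eps ^ 4" .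
  let ?V = "\<lambda>n \<omega>. (\<Sum>i=1..k n t. (X n i \<omega>)\<^sup>2) + (- 1) * (\<Sum>i=1..k n s. (X n i \<omega>)\<^sup>2)"
  let ?p = "\<lambda>n. measure (M n) {\<omega>\<in>space (M n). 2 * D < ?V n \<omega>}"
  have V: "tendsto_const_in_prob M ?V (a t + (- 1) * a s)"
    using st by (intro tendsto_const_in_prob_add tendsto_const_in_prob_cmult sum_squares prob
        borel_measurable_times borel_measurable_const V_measurable) auto
  have p: "?p \<longlonglongrightarrow> 0"
  proof (rule tendsto_sandwich[OF _ _ tendsto_const])
    show "(\<lambda>n. measure (M n) {\<omega>\<in>space (M n). D < \<bar>?V n \<omega> - (a t + (- 1) * a s)\<bar>}) \<longlonglongrightarrow> 0"
      using V D unfolding tendsto_const_in_prob_def by blast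
    show "\<forall>\<^sub>F n in sequentially. ?p n \<le> measure (M n) {\<omega>\<in>space (M n). D < \<bar>?V n \<omega> - (a t + (- 1) * a s)\<bar>}"
    proof (intro always_eventually allI)
      fix n
      interpret prob_space "M n" by (rule prob)
      have [measurable]: "(\<lambda>\<omega>. \<Sum>i=1..k n t. (X n i \<omega>)\<^sup>2) \<in> borel_measurable (M n)" for t
        by (rule V_measurable)
      show "?p n \<le> measure (M n) {\<omega>\<in>space (M n). D < \<bar>?V n \<omega> - (a t + (- 1) * a s)\<bar>}"
      proof (rule finite_measure_mono)
        show "{\<omega>\<in>space (M n). 2 * D < ?V n \<omega>} \<subseteq> {\<omega>\<in>space (M n). D < \<bar>?V n \<omega> - (a t + (- 1) * a s)\<bar>}"
          by (auto simp: D_def)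
      qed measurable
    qed
  qed auto
  have kk: "k n s \<le> k n t" "k n t \<le> k n T" for n using st by (auto intro!: k_le)
  \<comment> \<open>The sign \<open>\<sigma>\<close> gives the upward and the downward deviation.
    Beyond \<open>k n t\<close> the weights vanish, so the maximum over the whole row is the one
    over the block.\<close>
  have one: "measure (M n) {\<omega>\<in>space (M n). \<exists>j\<le>k n T. eps < (\<Sum>i=1..j. (\<sigma> * block (k n s) (k n t) i) * X n i \<omega>)}
    \<le> exp (- x) + ?p n + 3 * lam * (\<integral>\<omega>. Q n \<omega> \<partial>M n)" if \<sigma>: "\<bar>\<sigma>\<bar> = 1" for \<sigma> n
  proof -
    have "\<bar>(\<sigma> * block (k n s) (k n t) i) * X n i \<omega>\<bar> \<le> Q n \<omega>" if "i \<in> {1..k n T}" for i \<omega>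
      using Q_ge[OF that, of \<omega>] \<sigma> Q_nonneg[of n \<omega>] by (auto simp: abs_mult block_def)
    moreover have "(\<Sum>i=1..k n T. ((\<sigma> * block (k n s) (k n t) i) * X n i \<omega>)\<^sup>2) = ?V n \<omega>" for \<omega>
    proof -
      have "\<sigma>\<^sup>2 = 1" using \<sigma> by (metis power2_abs power_one)
      then show ?thesis using sum_block[OF kk[of n], of "\<lambda>i. (X n i \<omega>)\<^sup>2"]
        by (simp add: power_mult_distrib block_power2)
    qed
    ultimately show ?thesis
      using mds_exponential_maximal_inequality[OF prob mds_scale[OF prob mds], of n "Q n" "k n T"
          "\<lambda>i. \<sigma> * block (k n s) (k n t) i" lam eps "2 * D"]
        Q_integrable Q_nonneg lam unfolding expo by simp
  qed
  have bound: "measure (M n) {\<omega>\<in>space (M n). \<exists>i\<in>{k n s..k n t}. eps < \<bar>(\<Sum>l=1..i. X n l \<omega>) - S n s \<omega>\<bar>}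
    \<le> 2 * exp (- x) + 2 * (?p n + 3 * lam * (\<integral>\<omega>. Q n \<omega> \<partial>M n))" for n
  proof -
    interpret prob_space "M n" by (rule prob)
    let ?A = "\<lambda>\<sigma>. {\<omega>\<in>space (M n). \<exists>j\<le>k n T. eps < (\<Sum>i=1..j. (\<sigma> * block (k n s) (k n t) i) * X n i \<omega>)}"
    have A: "?A \<sigma> \<in> sets (M n)" for \<sigma>
    proof -
      have [measurable]: "(\<lambda>\<omega>. \<Sum>i=1..j. (\<sigma> * block (k n s) (k n t) i) * X n i \<omega>) \<in> borel_measurable (M n)" for j
        using X_measurable by (intro borel_measurable_sum borel_measurable_times borel_measurable_const) auto
      show ?thesis by measurable
    qed
    have "{\<omega>\<in>space (M n). \<exists>i\<in>{k n s..k n t}. eps < \<bar>(\<Sum>l=1..i. X n l \<omega>) - S n s \<omega>\<bar>} \<subseteq> ?A 1 \<union> ?A (- 1)"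
    proof safe
      fix \<omega> i assume i: "i \<in> {k n s..k n t}" "eps < \<bar>(\<Sum>l=1..i. X n l \<omega>) - S n s \<omega>\<bar>"
        and n: "\<not> (\<exists>j\<le>k n T. eps < (\<Sum>i=1..j. - 1 * block (k n s) (k n t) i * X n i \<omega>))"
      have "(\<Sum>l=1..i. block (k n s) (k n t) l * X n l \<omega>) = (\<Sum>l=1..i. block (k n s) i l * X n l \<omega>)"
        using i by (intro sum.cong) (auto simp: block_def)
      also have "\<dots> = (\<Sum>l=1..i. X n l \<omega>) - S n s \<omega>"
        unfolding S_def using i by (intro sum_block) auto
      finally have eq: "(\<Sum>l=1..i. block (k n s) (k n t) l * X n l \<omega>) = (\<Sum>l=1..i. X n l \<omega>) - S n s \<omega>" .
      have iT: "i \<le> k n T" using i kk[of n] by auto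
      have "\<not> eps < - ((\<Sum>l=1..i. X n l \<omega>) - S n s \<omega>)"
        using n iT eq by (auto simp: sum_negf)
      then have "eps < (\<Sum>l=1..i. 1 * block (k n s) (k n t) l * X n l \<omega>)" using i eq by simp
      then show "\<exists>j\<le>k n T. eps < (\<Sum>i=1..j. 1 * block (k n s) (k n t) i * X n i \<omega>)" using iT by blast
    qed
    then have "measure (M n) {\<omega>\<in>space (M n). \<exists>i\<in>{k n s..k n t}. eps < \<bar>(\<Sum>l=1..i. X n l \<omega>) - S n s \<omega>\<bar>}
      \<le> measure (M n) (?A 1 \<union> ?A (- 1))" by (rule finite_measure_mono) (intro sets.Un A)
    also have "\<dots> \<le> measure (M n) (?A 1) + measure (M n) (?A (- 1))"
      by (rule measure_Un_le[OF A A])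
    finally show ?thesis using one[of 1 n] one[of "- 1" n] by simp
  qed
  have "(\<lambda>n. 2 * exp (- x) + 2 * (?p n + 3 * lam * (\<integral>\<omega>. Q n \<omega> \<partial>M n))) \<longlonglongrightarrow> 2 * exp (- x) + 2 * (0 + 3 * lam * 0)"
    using p Q_tendsto_0 by (intro tendsto_intros)
  then have "\<forall>\<^sub>F n in sequentially. 2 * exp (- x) + 2 * (?p n + 3 * lam * (\<integral>\<omega>. Q n \<omega> \<partial>M n)) < 2 * exp (- x) + e"
    by (rule order_tendstoD(2)) (use e in simp)
  then show ?thesis
  proof eventually_elim
    case (elim n)
    then show ?case using bound[of n] ex unfolding D_def[symmetric] by linarith
  qed
qed

text \<open>A union bound over the cells. Their number is fixed while \<open>n\<close> grows, so
  finitely many eventual bounds combine, each with its share of \<open>e\<close>.\<close>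

lemma grid_oscillation_bound:
  assumes t: "\<And>j. j \<le> m \<Longrightarrow> t j \<in> {0..T}" "\<And>j. j < m \<Longrightarrow> t j < t (Suc j)"
    and eps: "0 < eps" and e: "0 < e"
  shows "\<forall>\<^sub>F n in sequentially. measure (M n)
      {\<omega>\<in>space (M n). \<exists>j<m. \<exists>i\<in>{k n (t j)..k n (t (Suc j))}. eps < \<bar>(\<Sum>l=1..i. X n l \<omega>) - S n (t j) \<omega>\<bar>}
    \<le> 1024 * (\<Sum>j<m. (a (t (Suc j)) - a (t j))\<^sup>2) / eps ^ 4 + e"
proof -
  let ?A = "\<lambda>n j. {\<omega>\<in>space (M n). \<exists>i\<in>{k n (t j)..k n (t (Suc j))}. eps < \<bar>(\<Sum>l=1..i. X n l \<omega>) - S n (t j) \<omega>\<bar>}"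
  define r where "r = e / (real m + 1)"
  have r: "0 < r" using e by (simp add: r_def)
  have "real m * r \<le> e" using e by (simp add: r_def field_simps)
  have "\<forall>\<^sub>F n in sequentially. \<forall>j\<in>{..<m}. measure (M n) (?A n j) \<le> 1024 * (a (t (Suc j)) - a (t j))\<^sup>2 / eps ^ 4 + r"
  proof (rule eventually_ball_finite)
    show "\<forall>j\<in>{..<m}. \<forall>\<^sub>F n in sequentially. measure (M n) (?A n j) \<le> 1024 * (a (t (Suc j)) - a (t j))\<^sup>2 / eps ^ 4 + r"
    proof
      fix j assume "j \<in> {..<m}"
      then show "\<forall>\<^sub>F n in sequentially. measure (M n) (?A n j) \<le> 1024 * (a (t (Suc j)) - a (t j))\<^sup>2 / eps ^ 4 + r"
        using t(1)[of j] t(1)[of "Suc j"] t(2)[of j] eps r by (intro block_oscillation_bound) auto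
    qed
  qed simp
  then show ?thesis
  proof eventually_elim
    case (elim n)
    interpret prob_space "M n" by (rule prob)
    have A: "?A n j \<in> sets (M n)" for j
    proof -
      have [measurable]: "(\<lambda>\<omega>. \<Sum>l=1..i. X n l \<omega>) \<in> borel_measurable (M n)" for i
        using X_measurable by (intro borel_measurable_sum) auto
      have [measurable]: "S n t \<in> borel_measurable (M n)" for t by (rule S_measurable)
      show ?thesis by measurable
    qed
    have "{\<omega>\<in>space (M n). \<exists>j<m. \<exists>i\<in>{k n (t j)..k n (t (Suc j))}. eps < \<bar>(\<Sum>l=1..i. X n l \<omega>) - S n (t j) \<omega>\<bar>}
      = (\<Union>j<m. ?A n j)" by auto
    then have "measure (M n) {\<omega>\<in>space (M n). \<exists>j<m. \<exists>i\<in>{k n (t j)..k n (t (Suc j))}. eps < \<bar>(\<Sum>l=1..i. X n l \<omega>) - S n (t j) \<omega>\<bar>}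
      \<le> (\<Sum>j<m. measure (M n) (?A n j))"
      using A by (auto intro!: finite_measure_subadditive_finite)
    also have "\<dots> \<le> (\<Sum>j<m. 1024 * (a (t (Suc j)) - a (t j))\<^sup>2 / eps ^ 4 + r)"
      using elim by (intro sum_mono) auto
    also have "\<dots> = 1024 * (\<Sum>j<m. (a (t (Suc j)) - a (t j))\<^sup>2) / eps ^ 4 + real m * r"
      by (simp add: sum.distrib sum_distrib_left sum_divide_distrib)
    finally show ?case using \<open>real m * r \<le> e\<close> by simp
  qed
qed

lemma oscillation_event_sets:
  fixes p q :: "nat \<Rightarrow> nat"
  shows "{\<omega>\<in>space (M n). \<exists>j<m. \<exists>i\<in>{p j..q j}. eps < \<bar>(\<Sum>l=1..i. X n l \<omega>) - S n (t j) \<omega>\<bar>} \<in> sets (M n)"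
proof -
  have [measurable]: "(\<lambda>\<omega>. \<Sum>l=1..i. X n l \<omega>) \<in> borel_measurable (M n)" for i
    using X_measurable by (intro borel_measurable_sum) auto
  have [measurable]: "S n t \<in> borel_measurable (M n)" for t by (rule S_measurable)
  have "{\<omega>\<in>space (M n). eps < \<bar>(\<Sum>l=1..i. X n l \<omega>) - S n (t j) \<omega>\<bar>} \<in> sets (M n)" for i j
    by measurable
  then have "(\<Union>j<m. \<Union>i\<in>{p j..q j}. {\<omega>\<in>space (M n). eps < \<bar>(\<Sum>l=1..i. X n l \<omega>) - S n (t j) \<omega>\<bar>}) \<in> sets (M n)"
    by (intro sets.finite_UN) auto
  also have "(\<Union>j<m. \<Union>i\<in>{p j..q j}. {\<omega>\<in>space (M n). eps < \<bar>(\<Sum>l=1..i. X n l \<omega>) - S n (t j) \<omega>\<bar>})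
    = {\<omega>\<in>space (M n). \<exists>j<m. \<exists>i\<in>{p j..q j}. eps < \<bar>(\<Sum>l=1..i. X n l \<omega>) - S n (t j) \<omega>\<bar>}"
    by blast
  finally show ?thesis .
qed

text \<open>The increment over a cell is the deviation at \<open>i = k n (t (Suc j))\<close>, so the
  oscillation bound at level \<open>K\<close> applies. It decays like the inverse fourth power of
  \<open>K\<close>; \<open>K \<le> K ^ 4\<close> for \<open>K \<ge> 1\<close> lets a linear
  threshold \<open>K0\<close> suffice.\<close>

lemma increments_tight:
  assumes t: "\<And>j. j \<le> m \<Longrightarrow> t j \<in> {0..T}" "\<And>j. j < m \<Longrightarrow> t j < t (Suc j)" and e: "0 < e"
  shows "\<exists>K0. \<forall>K\<ge>K0. \<forall>\<^sub>F n in sequentially.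
    measure (M n) {\<omega>\<in>space (M n). \<exists>j<m. K < \<bar>S n (t (Suc j)) \<omega> - S n (t j) \<omega>\<bar>} \<le> e"
proof -
  define V where "V = (\<Sum>j<m. (a (t (Suc j)) - a (t j))\<^sup>2)"
  have V: "0 \<le> V" unfolding V_def by (intro sum_nonneg) auto
  define K0 where "K0 = max 1 (2048 * V / e)"
  have "\<forall>\<^sub>F n in sequentially.
    measure (M n) {\<omega>\<in>space (M n). \<exists>j<m. K < \<bar>S n (t (Suc j)) \<omega> - S n (t j) \<omega>\<bar>} \<le> e"
    if K: "K0 \<le> K" for K
  proof -
    have K1: "1 \<le> K" and "2048 * V / e \<le> K" using K by (auto simp: K0_def)
    then have "2048 * V \<le> e * K" using e by (simp add: field_simps)
    also have "K \<le> K ^ 4" using power_increasing[of 1 4 K] K1 by simp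
    then have "e * K \<le> e * K ^ 4" using e by simp
    finally have VK: "1024 * V / K ^ 4 \<le> e / 2" using K1 by (simp add: field_simps)
    have "\<forall>\<^sub>F n in sequentially. measure (M n)
      {\<omega>\<in>space (M n). \<exists>j<m. \<exists>i\<in>{k n (t j)..k n (t (Suc j))}. K < \<bar>(\<Sum>l=1..i. X n l \<omega>) - S n (t j) \<omega>\<bar>}
      \<le> 1024 * V / K ^ 4 + e / 2"
      unfolding V_def using t K1 e by (intro grid_oscillation_bound) auto
    then show ?thesis
    proof eventually_elim
      case (elim n)
      interpret prob_space "M n" by (rule prob)
      have "{\<omega>\<in>space (M n). \<exists>j<m. K < \<bar>S n (t (Suc j)) \<omega> - S n (t j) \<omega>\<bar>} \<subseteq>
        {\<omega>\<in>space (M n). \<exists>j<m. \<exists>i\<in>{k n (t j)..k n (t (Suc j))}. K < \<bar>(\<Sum>l=1..i. X n l \<omega>) - S n (t j) \<omega>\<bar>}"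
      proof safe
        fix \<omega> j assume j: "j < m" "K < \<bar>S n (t (Suc j)) \<omega> - S n (t j) \<omega>\<bar>"
        have "k n (t j) \<le> k n (t (Suc j))" using t(1)[of j] t(1)[of "Suc j"] t(2)[of j] j by (auto intro!: k_le)
        then show "\<exists>j<m. \<exists>i\<in>{k n (t j)..k n (t (Suc j))}. K < \<bar>(\<Sum>l=1..i. X n l \<omega>) - S n (t j) \<omega>\<bar>"
          using j unfolding S_def[of n "t (Suc j)"] by (intro exI[of _ j]) auto
      qed
      then have "measure (M n) {\<omega>\<in>space (M n). \<exists>j<m. K < \<bar>S n (t (Suc j)) \<omega> - S n (t j) \<omega>\<bar>} \<le> measure (M n)
        {\<omega>\<in>space (M n). \<exists>j<m. \<exists>i\<in>{k n (t j)..k n (t (Suc j))}. K < \<bar>(\<Sum>l=1..i. X n l \<omega>) - S n (t j) \<omega>\<bar>}"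
        by (rule finite_measure_mono) (rule oscillation_event_sets)
      then show ?case using elim VK by linarith
    qed
  qed
  then show ?thesis by blast
qed

section \<open>Random paths and convergence of their expectations\<close>

lemma a_nonneg: "t \<in> {0..T} \<Longrightarrow> 0 \<le> a t"
  using strict_mono_onD[OF a_mono, of 0 t] T a_zero by (cases "t = 0") auto

lemma time_changed_continuous:
  assumes B: "standard_brownian_motion N B" and w: "\<omega> \<in> space N"
  shows "continuous_on {0..T} (\<lambda>t. B (a t) \<omega>)" "B (a 0) \<omega> = 0"
proof -
  have "continuous_on {0..} (\<lambda>t. B t \<omega>)" using B w by (simp add: standard_brownian_motion_def)
  then show "continuous_on {0..T} (\<lambda>t. B (a t) \<omega>)"
    by (rule continuous_on_compose2[OF _ a_cont]) (auto intro: a_nonneg)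
  show "B (a 0) \<omega> = 0" using B w by (simp add: standard_brownian_motion_def a_zero)
qed

lemma measurable_grid_path_brownian:
  assumes B: "standard_brownian_motion N B" and m: "0 < m"
  shows "(\<lambda>\<omega>. grid_path T m (\<lambda>t. B (a t) \<omega>)) \<in> measurable N (borel_sigma (skorohod_topology T))"
  unfolding grid_path_def
proof (rule measurable_step_path[OF T clock_grid_clock[OF T m]])
  fix i
  show "(\<lambda>\<omega>. if 1 \<le> i \<and> i \<le> m then B (a (grid T m i)) \<omega> - B (a (grid T m (i - 1))) \<omega> else 0) \<in> borel_measurable N"
  proof (cases "1 \<le> i \<and> i \<le> m")
    case True
    then have "0 \<le> a (grid T m i)" "0 \<le> a (grid T m (i - 1))"
      using grid_mem[OF T m, of i] grid_mem[OF T m, of "i - 1"] by (auto intro!: a_nonneg simp del: atLeastAtMost_iff)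
    then have "B (a (grid T m i)) \<in> borel_measurable N" "B (a (grid T m (i - 1))) \<in> borel_measurable N"
      using B by (simp_all add: standard_brownian_motion_def)
    then have "(\<lambda>\<omega>. B (a (grid T m i)) \<omega> - B (a (grid T m (i - 1))) \<omega>) \<in> borel_measurable N"
      by (rule borel_measurable_diff)
    then show ?thesis using True by simp
  qed auto
qed

text \<open>The grid discretisations are measurable as step paths and converge pointwise in the
  Skorohod metric, because every path is continuous.\<close>

lemma measurable_time_changed_brownian:
  assumes B: "standard_brownian_motion N B"
  shows "(\<lambda>\<omega>. \<lambda>t\<in>{0..T}. B (a t) \<omega>) \<in> measurable N (borel_sigma (skorohod_topology T))"
proof -
  interpret D: Metric_space "skorohod_space T" "skorohod_dist T"
    using Metric_space_skorohod[OF T] .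
  show ?thesis unfolding skorohod_topology_def
  proof (rule D.measurable_borel_sigma_limit[where Y="\<lambda>m \<omega>. grid_path T (Suc m) (\<lambda>t. B (a t) \<omega>)"])
    show "(\<lambda>\<omega>. grid_path T (Suc m) (\<lambda>t. B (a t) \<omega>)) \<in> measurable N (borel_sigma D.mtopology)" for m
      using measurable_grid_path_brownian[OF B] unfolding skorohod_topology_def by simp
  qed (use grid_path_tendsto[OF T] continuous_in_skorohod_space time_changed_continuous[OF B] in auto)
qed

lemma measurable_partial_sums:
  assumes c: "clock T (k n)"
  shows "(\<lambda>\<omega>. \<lambda>t\<in>{0..T}. S n t \<omega>) \<in> measurable (M n) (borel_sigma (skorohod_topology T))"
proof -
  \<comment> \<open>\<open>X n 0\<close> need not be measurable; replacing it by 0 changes no sum,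
    as the sums start at 1.\<close>
  have "(\<lambda>\<omega>. step_path T (k n) (\<lambda>i. if i = 0 then 0 else X n i \<omega>)) \<in> measurable (M n) (borel_sigma (skorohod_topology T))"
  proof (rule measurable_step_path[OF T c])
    show "(\<lambda>\<omega>. if i = 0 then 0 else X n i \<omega>) \<in> borel_measurable (M n)" for i
      using X_measurable[of i n] by (cases "i = 0") auto
  qed
  also have "(\<lambda>\<omega>. step_path T (k n) (\<lambda>i. if i = 0 then 0 else X n i \<omega>)) = (\<lambda>\<omega>. \<lambda>t\<in>{0..T}. S n t \<omega>)"
    unfolding step_path_def S_def by (intro ext restrict_ext sum.cong) auto
  finally show ?thesis .
qed

lemma measurable_grid_path_partial_sums:
  assumes m: "0 < m"
  shows "(\<lambda>\<omega>. grid_path T m (\<lambda>t. S n t \<omega>)) \<in> measurable (M n) (borel_sigma (skorohod_topology T))"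
  unfolding grid_path_def
proof (rule measurable_step_path[OF T clock_grid_clock[OF T m]])
  have [measurable]: "S n t \<in> borel_measurable (M n)" for t by (rule S_measurable)
  show "(\<lambda>\<omega>. if 1 \<le> i \<and> i \<le> m then S n (grid T m i) \<omega> - S n (grid T m (i - 1)) \<omega> else 0)
    \<in> borel_measurable (M n)" for i by measurable
qed

text \<open>A test function of a grid path is a bounded continuous function of the \<open>m\<close>
  increments, so convergence of joint characteristic functions and tightness of the increments
  apply.\<close>

lemma grid_path_expectation_tendsto:
  assumes B: "standard_brownian_motion N B" and m: "0 < m"
    and h: "continuous_map (skorohod_topology T) euclideanreal h" "\<And>x. x \<in> skorohod_space T \<Longrightarrow> \<bar>h x\<bar> \<le> C"
  shows "(\<lambda>n. \<integral>\<omega>. h (grid_path T m (\<lambda>t. S n t \<omega>)) \<partial>M n)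
    \<longlonglongrightarrow> (\<integral>\<omega>. h (grid_path T m (\<lambda>t. B (a t) \<omega>)) \<partial>N)"
proof -
  let ?t = "grid T m"
  let ?c = "grid_clock T m"
  have c: "clock T ?c" using T m by (rule clock_grid_clock)
  have t: "\<And>j. j \<le> m \<Longrightarrow> ?t j \<in> {0..T}" "\<And>j. j < m \<Longrightarrow> ?t j < ?t (Suc j)"
    using grid_mem[OF T m] grid_less[OF T m] by (auto simp del: atLeastAtMost_iff)
  define Y where "Y n j \<omega> = S n (?t (Suc j)) \<omega> - S n (?t j) \<omega>" for n j \<omega>
  \<comment> \<open>Cut off at \<open>m\<close>: beyond it the grid leaves the interval, where
    nothing is known about \<open>a\<close> and hence about measurability. \<open>Y\<close> needs no
    cut, since \<open>S n t\<close> is measurable for every \<open>t\<close>.\<close>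
  define W where "W j \<omega> = (if j < m then B (a (?t (Suc j))) \<omega> - B (a (?t j)) \<omega> else 0)" for j \<omega>
  define g where "g y = h (step_path T ?c (\<lambda>i. if 1 \<le> i \<and> i \<le> m then y (i - 1) else 0))" for y
  \<comment> \<open>Undoes the index shift; the inner truncation at \<open>m\<close> never takes
    effect, because \<open>i - 1 < m\<close>.\<close>
  have idx: "(if 1 \<le> i \<and> i \<le> m then if i - 1 < m then u (Suc (i - 1)) - u (i - 1) else 0 else 0)
    = (if 1 \<le> i \<and> i \<le> m then u i - u (i - 1) else 0)" for u :: "nat \<Rightarrow> real" and i
    by (cases i) auto
  have gY: "g (\<lambda>j. if j < m then Y n j \<omega> else 0) = h (grid_path T m (\<lambda>t. S n t \<omega>))" for n \<omega>
    unfolding g_def grid_path_def Y_def by (simp only: idx[of _ "\<lambda>j. S n (?t j) \<omega>"])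
  have vec: "(\<lambda>j. if j < m then W j \<omega> else 0)
    = (\<lambda>j. if j < m then B (a (?t (Suc j))) \<omega> - B (a (?t j)) \<omega> else 0)" for \<omega>
    by (auto simp: W_def)
  have gW: "g (\<lambda>j. if j < m then W j \<omega> else 0) = h (grid_path T m (\<lambda>t. B (a t) \<omega>))" for \<omega>
    unfolding g_def grid_path_def vec by (simp only: idx[of _ "\<lambda>j. B (a (?t j)) \<omega>"])
  have "(\<lambda>n. \<integral>\<omega>. g (\<lambda>j. if j < m then Y n j \<omega> else 0) \<partial>M n)
    \<longlonglongrightarrow> (\<integral>\<omega>. g (\<lambda>j. if j < m then W j \<omega> else 0) \<partial>N)"
  proof (rule random_vector_tendsto)
    show "prob_space (M n)" for n by (rule prob)
    show "prob_space N" using B by (simp add: standard_brownian_motion_def)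
    show "Y n j \<in> borel_measurable (M n)" for n j
      unfolding Y_def[abs_def] using S_measurable by (intro borel_measurable_diff)
    show "W j \<in> borel_measurable N" for j
    proof (cases "j < m")
      case True
      then have "B (a (?t (Suc j))) \<in> borel_measurable N" "B (a (?t j)) \<in> borel_measurable N"
        using a_nonneg[OF t(1)] B by (auto simp: standard_brownian_motion_def)
      then show ?thesis unfolding W_def[abs_def] using True by (simp add: borel_measurable_diff)
    qed (simp add: W_def[abs_def])
    show "(\<lambda>n. \<integral>\<omega>. iexp (\<Sum>j<m. \<theta> j * Y n j \<omega>) \<partial>M n) \<longlonglongrightarrow> (\<integral>\<omega>. iexp (\<Sum>j<m. \<theta> j * W j \<omega>) \<partial>N)" for \<theta>
    proof -
      have "(\<Sum>j<m. \<theta> j * W j \<omega>) = (\<Sum>j<m. \<theta> j * (B (a (?t (Suc j))) \<omega> - B (a (?t j)) \<omega>))" for \<omega>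
        by (intro sum.cong) (auto simp: W_def)
      moreover have "(\<integral>\<omega>. iexp (\<Sum>j<m. \<theta> j * (B (a (?t (Suc j))) \<omega> - B (a (?t j)) \<omega>)) \<partial>N)
        = of_real (exp (- (\<Sum>j<m. (\<theta> j)\<^sup>2 * (a (?t (Suc j)) - a (?t j))) / 2))"
      proof (rule brownian_increments_char[OF B, of "\<lambda>j. a (?t j)"])
        show "a (?t i) < a (?t (Suc i))" if "i < m" for i
          using t(1)[of i] t(1)[of "Suc i"] t(2)[of i] that by (intro strict_mono_onD[OF a_mono]) auto
      qed (simp add: grid_0 a_zero)
      ultimately show ?thesis
        unfolding Y_def using increments_char_tendsto[where m=m and t="?t" and \<theta>=\<theta>, OF t] by simp
    qed
    show "\<exists>K0. \<forall>K\<ge>K0. \<forall>\<^sub>F n in sequentially. measure (M n) {\<omega>\<in>space (M n). \<exists>j<m. K < \<bar>Y n j \<omega>\<bar>} \<le> e"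
      if "0 < e" for e
      unfolding Y_def using t that by (rule increments_tight)
    show "continuous_on UNIV g"
      unfolding g_def[abs_def]
      by (rule continuous_on_compose2[OF continuous_on_step_path[OF T c h(1)] continuous_on_shift]) simp
    show "\<bar>g x\<bar> \<le> C" for x
      unfolding g_def using step_path_in_skorohod_space[OF c] by (rule h(2))
  qed
  then show ?thesis unfolding gY gW .
qed

text \<open>For \<open>s\<close> in a cell, monotonicity puts \<open>k n s\<close> between the row
  lengths at the two ends, so the deviation from the left end is one of those excluded by
  \<open>osc\<close>.\<close>

lemma grid_path_partial_sums_close:
  assumes c: "clock T (k n)" and m: "0 < m" and eps: "0 < eps"
    and osc: "\<not> (\<exists>j<m. \<exists>i\<in>{k n (grid T m j)..k n (grid T m (Suc j))}. eps < \<bar>(\<Sum>l=1..i. X n l \<omega>) - S n (grid T m j) \<omega>\<bar>)"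
  shows "skorohod_dist T (\<lambda>t\<in>{0..T}. S n t \<omega>) (grid_path T m (\<lambda>t. S n t \<omega>)) \<le> eps"
proof (rule skorohod_dist_le)
  have "(\<lambda>t\<in>{0..T}. S n t \<omega>) = step_path T (k n) (\<lambda>i. X n i \<omega>)"
    by (simp add: step_path_def S_def)
  then show "(\<lambda>t\<in>{0..T}. S n t \<omega>) \<in> skorohod_space T"
    using step_path_in_skorohod_space[OF c] by simp
  show "grid_path T m (\<lambda>t. S n t \<omega>) \<in> skorohod_space T" using T m by (rule grid_path_in_skorohod_space)
  fix s assume s: "s \<in> {0..T}"
  define j where "j = grid_clock T m s"
  have b: "j \<le> m" "grid T m j \<le> s" "s < grid T m (Suc j)"
    using grid_clock_bounds[OF T m s] by (auto simp: j_def)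
  have eq: "grid_path T m (\<lambda>t. S n t \<omega>) s = S n (grid T m j) \<omega>"
    unfolding j_def using k_zero by (intro grid_path_eq[OF T m s]) (simp add: S_def)
  show "\<bar>(\<lambda>t\<in>{0..T}. S n t \<omega>) s - grid_path T m (\<lambda>t. S n t \<omega>) s\<bar> \<le> eps"
  proof (cases "j < m")
    case True
    have "0 \<le> grid T m j" "grid T m (Suc j) \<le> T"
      using grid_mem[OF T m, of j] grid_mem[OF T m, of "Suc j"] True by auto
    then have "k n s \<in> {k n (grid T m j)..k n (grid T m (Suc j))}"
      using b s by (auto intro!: k_le)
    then have "\<not> eps < \<bar>(\<Sum>l=1..k n s. X n l \<omega>) - S n (grid T m j) \<omega>\<bar>" using osc True by blast
    then show ?thesis using s eq by (simp add: S_def)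
  next
    \<comment> \<open>The index \<open>m\<close> occurs at \<open>s = T\<close> only, where the path
      and its discretisation agree.\<close>
    case False
    then have "j = m" using b by simp
    then have "s = T" using b s grid_m[OF m, of T] by auto
    then show ?thesis using s eq eps grid_m[OF m, of T] \<open>j = m\<close> by simp
  qed
qed (use eps in simp)

text \<open>Both processes are compared through their discretisations: \<open>S\<close> with its
  grid path off the oscillation event, the two grid paths as \<open>n\<close> grows, and the
  Brownian path with its grid path as the mesh shrinks. The mesh is fixed first, then
  \<open>n\<close> is sent to infinity.\<close>

lemma lipschitz_expectation_tendsto:
  assumes c: "\<And>n. clock T (k n)" and B: "standard_brownian_motion N B"
    and L: "0 \<le> L" "\<And>x y. x \<in> skorohod_space T \<Longrightarrow> y \<in> skorohod_space T \<Longrightarrow> \<bar>h x - h y\<bar> \<le> L * skorohod_dist T x y"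
    and C: "\<And>x. x \<in> skorohod_space T \<Longrightarrow> \<bar>h x\<bar> \<le> C"
  shows "(\<lambda>n. \<integral>\<omega>. h (\<lambda>t\<in>{0..T}. S n t \<omega>) \<partial>M n) \<longlonglongrightarrow> (\<integral>\<omega>. h (\<lambda>t\<in>{0..T}. B (a t) \<omega>) \<partial>N)"
proof (rule tendstoI)
  interpret D: Metric_space "skorohod_space T" "skorohod_dist T"
    using Metric_space_skorohod[OF T] .
  have N: "prob_space N" using B by (simp add: standard_brownian_motion_def)
  then interpret N: prob_space N .
  have hc: "continuous_map (skorohod_topology T) euclideanreal h"
    unfolding skorohod_topology_def using L(2,1) by (rule D.lipschitz_continuous_map)
  have C0: "0 \<le> C" using C[OF step_path_in_skorohod_space[OF c[of 0], of "\<lambda>_. 0"]] by linarith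
  note hm = borel_measurable_continuous_map_compose[OF hc]
  have third: "(\<lambda>m. \<integral>\<omega>. h (grid_path T (Suc m) (\<lambda>t. B (a t) \<omega>)) \<partial>N) \<longlonglongrightarrow> (\<integral>\<omega>. h (\<lambda>t\<in>{0..T}. B (a t) \<omega>) \<partial>N)"
  proof (rule integral_dominated_convergence)
    show "AE \<omega> in N. (\<lambda>m. h (grid_path T (Suc m) (\<lambda>t. B (a t) \<omega>))) \<longlonglongrightarrow> h (\<lambda>t\<in>{0..T}. B (a t) \<omega>)"
    proof (rule AE_I2)
      fix \<omega> assume w: "\<omega> \<in> space N"
      note x = time_changed_continuous[OF B w]
      have lim: "(\<lambda>m. L * skorohod_dist T (grid_path T (Suc m) (\<lambda>t. B (a t) \<omega>)) (\<lambda>t\<in>{0..T}. B (a t) \<omega>)) \<longlonglongrightarrow> 0"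
        using tendsto_mult_right_zero[OF grid_path_tendsto[OF T x]] .
      have "\<bar>h (grid_path T (Suc m) (\<lambda>t. B (a t) \<omega>)) - h (\<lambda>t\<in>{0..T}. B (a t) \<omega>)\<bar>
        \<le> L * skorohod_dist T (grid_path T (Suc m) (\<lambda>t. B (a t) \<omega>)) (\<lambda>t\<in>{0..T}. B (a t) \<omega>)" for m
        using T continuous_in_skorohod_space[OF x(1)] by (intro L grid_path_in_skorohod_space) auto
      then show "(\<lambda>m. h (grid_path T (Suc m) (\<lambda>t. B (a t) \<omega>))) \<longlonglongrightarrow> h (\<lambda>t\<in>{0..T}. B (a t) \<omega>)"
        by (intro LIM_zero_cancel[OF Lim_null_comparison[OF _ lim]]) auto
    qed
    show "AE \<omega> in N. norm (h (grid_path T (Suc m) (\<lambda>t. B (a t) \<omega>))) \<le> C" for m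
      using C[OF grid_path_in_skorohod_space[OF T zero_less_Suc]] by simp
  qed (use hm measurable_grid_path_brownian[OF B] measurable_time_changed_brownian[OF B] in auto)
  fix e :: real assume e: "0 < e"
  \<comment> \<open>Error budget: \<open>e / 8\<close> each for the Lipschitz term, the limiting
    oscillation probability and its excess \<open>r\<close>, and \<open>e / 4\<close> each for the
    two remaining comparisons. The additions of 1 in \<open>c1\<close> and \<open>c2\<close> guard
    against \<open>L = 0\<close> and \<open>C = 0\<close>.\<close>
  define c1 where "c1 = L + 1"
  define eps where "eps = e / (8 * c1)"
  have c1: "0 < c1" "L \<le> c1" using L by (auto simp: c1_def)
  then have eps: "0 < eps" using e by (simp add: eps_def)
  have "L * eps \<le> c1 * eps" using c1 eps by (intro mult_right_mono) auto
  then have Leps: "L * eps \<le> e / 8" using c1 by (simp add: eps_def)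
  define c2 where "c2 = C + 1"
  define r where "r = e / (16 * c2)"
  have c2: "0 < c2" "C \<le> c2" using C0 by (auto simp: c2_def)
  then have r: "0 < r" using e by (simp add: r_def)
  have "2 * C * r \<le> 2 * c2 * r" using c2 r by (intro mult_right_mono) auto
  then have Cr: "2 * C * r \<le> e / 8" using c2 by (simp add: r_def)
  let ?V = "\<lambda>m. \<Sum>j<Suc m. (a (grid T (Suc m) (Suc j)) - a (grid T (Suc m) j))\<^sup>2"
  have "(\<lambda>m. 2 * C * (1024 * ?V m / eps ^ 4)) \<longlonglongrightarrow> 2 * C * (1024 * 0 / eps ^ 4)"
    using eps sum_square_increments_tendsto_0[OF T a_cont strict_mono_on_imp_mono_on[OF a_mono] a_zero]
    by (intro tendsto_intros) auto
  then have "\<forall>\<^sub>F m in sequentially. 2 * C * (1024 * ?V m / eps ^ 4) < e / 8"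
    by (rule order_tendstoD(2)) (use e in simp)
  moreover have "\<forall>\<^sub>F m in sequentially. dist (\<integral>\<omega>. h (grid_path T (Suc m) (\<lambda>t. B (a t) \<omega>)) \<partial>N) (\<integral>\<omega>. h (\<lambda>t\<in>{0..T}. B (a t) \<omega>) \<partial>N) < e / 4"
    using third by (rule tendstoD) (use e in simp)
  ultimately have "\<forall>\<^sub>F m in sequentially. 2 * C * (1024 * ?V m / eps ^ 4) < e / 8 \<and>
    dist (\<integral>\<omega>. h (grid_path T (Suc m) (\<lambda>t. B (a t) \<omega>)) \<partial>N) (\<integral>\<omega>. h (\<lambda>t\<in>{0..T}. B (a t) \<omega>) \<partial>N) < e / 4"
    by (rule eventually_conj)
  then obtain m where m: "2 * C * (1024 * ?V m / eps ^ 4) < e / 8"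
    "dist (\<integral>\<omega>. h (grid_path T (Suc m) (\<lambda>t. B (a t) \<omega>)) \<partial>N) (\<integral>\<omega>. h (\<lambda>t\<in>{0..T}. B (a t) \<omega>) \<partial>N) < e / 4"
    using eventually_happens'[OF sequentially_bot] by blast
  let ?t = "grid T (Suc m)"
  let ?osc = "\<lambda>n. {\<omega>\<in>space (M n). \<exists>j<Suc m. \<exists>i\<in>{k n (?t j)..k n (?t (Suc j))}. eps < \<bar>(\<Sum>l=1..i. X n l \<omega>) - S n (?t j) \<omega>\<bar>}"
  have "\<forall>\<^sub>F n in sequentially. measure (M n) (?osc n) \<le> 1024 * ?V m / eps ^ 4 + r"
    using eps r grid_mem[OF T zero_less_Suc, of _ m] grid_less[OF T zero_less_Suc]
    by (intro grid_oscillation_bound) (auto simp del: atLeastAtMost_iff)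
  moreover have "\<forall>\<^sub>F n in sequentially. dist (\<integral>\<omega>. h (grid_path T (Suc m) (\<lambda>t. S n t \<omega>)) \<partial>M n)
    (\<integral>\<omega>. h (grid_path T (Suc m) (\<lambda>t. B (a t) \<omega>)) \<partial>N) < e / 4"
    using grid_path_expectation_tendsto[OF B zero_less_Suc hc C] by (rule tendstoD) (use e in auto)
  ultimately show "\<forall>\<^sub>F n in sequentially. dist (\<integral>\<omega>. h (\<lambda>t\<in>{0..T}. S n t \<omega>) \<partial>M n) (\<integral>\<omega>. h (\<lambda>t\<in>{0..T}. B (a t) \<omega>) \<partial>N) < e"
  proof eventually_elim
    case (elim n)
    interpret prob_space "M n" by (rule prob)
    have Sin: "(\<lambda>t\<in>{0..T}. S n t \<omega>) \<in> skorohod_space T" for \<omega>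
      using step_path_in_skorohod_space[OF c[of n], of "\<lambda>i. X n i \<omega>"] by (simp add: step_path_def S_def)
    have Gin: "grid_path T (Suc m) (\<lambda>t. S n t \<omega>) \<in> skorohod_space T" for \<omega>
      using T by (intro grid_path_in_skorohod_space) auto
    have "\<bar>(\<integral>\<omega>. h (\<lambda>t\<in>{0..T}. S n t \<omega>) \<partial>M n) - (\<integral>\<omega>. h (grid_path T (Suc m) (\<lambda>t. S n t \<omega>)) \<partial>M n)\<bar>
      \<le> L * eps + 2 * C * measure (M n) (?osc n)"
    proof (rule prob_integral_diff_le)
      show "prob_space (M n)" by (rule prob)
      show "integrable (M n) (\<lambda>\<omega>. h (\<lambda>t\<in>{0..T}. S n t \<omega>))"
        using C[OF Sin] hm[OF measurable_partial_sums[OF c]] by (intro integrable_const_bound[of _ C]) auto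
      show "integrable (M n) (\<lambda>\<omega>. h (grid_path T (Suc m) (\<lambda>t. S n t \<omega>)))"
        using C[OF Gin] hm[OF measurable_grid_path_partial_sums] by (intro integrable_const_bound[of _ C]) auto
      show "?osc n \<in> sets (M n)" by (rule oscillation_event_sets)
      fix \<omega> assume w: "\<omega> \<in> space (M n)"
      show "\<bar>h (\<lambda>t\<in>{0..T}. S n t \<omega>) - h (grid_path T (Suc m) (\<lambda>t. S n t \<omega>))\<bar> \<le> L * eps + 2 * C * indicator (?osc n) \<omega>"
      proof (cases "\<omega> \<in> ?osc n")
        case True
        have "0 \<le> L * eps" using L eps by simp
        then show ?thesis using True C[OF Sin[of \<omega>]] C[OF Gin[of \<omega>]] by (simp del: mem_Collect_eq)
      next
        case False
        then have "skorohod_dist T (\<lambda>t\<in>{0..T}. S n t \<omega>) (grid_path T (Suc m) (\<lambda>t. S n t \<omega>)) \<le> eps"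
          using w c eps by (intro grid_path_partial_sums_close) auto
        then have "L * skorohod_dist T (\<lambda>t\<in>{0..T}. S n t \<omega>) (grid_path T (Suc m) (\<lambda>t. S n t \<omega>)) \<le> L * eps"
          using L(1) by (rule mult_left_mono)
        then show ?thesis using L(2)[OF Sin[of \<omega>] Gin[of \<omega>]] False by (simp del: mem_Collect_eq)
      qed
    qed
    moreover have "2 * C * measure (M n) (?osc n) \<le> 2 * C * (1024 * ?V m / eps ^ 4) + 2 * C * r"
      using mult_left_mono[OF elim(1), of "2 * C"] C0 by (simp add: distrib_left)
    ultimately show ?case using elim(2) m Leps Cr unfolding dist_real_def by linarith
  qed
qed

end

theorem theorem2p9:
  fixes T :: real
    and k :: "nat \<Rightarrow> real \<Rightarrow> nat"
    and a :: "real \<Rightarrow> real"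
    and M :: "nat \<Rightarrow> 'a measure"
    and X :: "nat \<Rightarrow> nat \<Rightarrow> 'a \<Rightarrow> real"
    and N :: "'b measure"
    and B :: "real \<Rightarrow> 'b \<Rightarrow> real"
  assumes "0 < T"
    and k_mono: "\<And>n. mono_on {0..T} (k n)"
    and k_right_cont: "\<And>n t. t \<in> {0..T} \<Longrightarrow> continuous (at t within {t..T}) (\<lambda>s. real (k n s))"
    and k_zero: "\<And>n. k n 0 = 0"
    and "time_change T a"
    and "\<And>n. prob_space (M n)"
    and "martingale_difference_array M X"
    and max_L2: "\<And>t. t \<in> {0..T} \<Longrightarrow>
      tendsto_0_in_L2 M (\<lambda>n \<omega>. Max (insert 0 ((\<lambda>i. \<bar>X n i \<omega>\<bar>) ` {1..k n t})))"
    and sum_squares: "\<And>t. t \<in> {0..T} \<Longrightarrow>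
      tendsto_const_in_prob M (\<lambda>n \<omega>. \<Sum>i=1..k n t. (X n i \<omega>)\<^sup>2) (a t)"
    and "standard_brownian_motion N B"
  shows "converges_in_law (skorohod_topology T)
    M (\<lambda>n \<omega>. \<lambda>t\<in>{0..T}. \<Sum>i=1..k n t. X n i \<omega>)
    N (\<lambda>\<omega>. \<lambda>t\<in>{0..T}. B (a t) \<omega>)"
proof -
  obtain F where F: "\<And>n. martingale_difference_seq (M n) (F n) (X n)"
    using \<open>martingale_difference_array M X\<close> unfolding martingale_difference_array_def by metis
  have tc: "strict_mono_on {0..T} a" "continuous_on {0..T} a" "a 0 = 0"
    using \<open>time_change T a\<close> by (auto simp: time_change_def)
  have "T \<in> {0..T}" using \<open>0 < T\<close> by simp
  interpret clt_array T k a M F X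
    by (rule clt_array.intro) (rule tc k_mono k_zero F assms(6) \<open>0 < T\<close> max_L2[OF \<open>T \<in> {0..T}\<close>] sum_squares, assumption?)+
  interpret D: Metric_space "skorohod_space T" "skorohod_dist T"
    using Metric_space_skorohod[OF \<open>0 < T\<close>] .
  \<comment> \<open>Right continuity of \<open>k n\<close> enters here and places the partial-sum
    paths in the Skorohod space.\<close>
  have c: "clock T (k n)" for n
    using k_mono k_right_cont by (rule right_continuous_clock)
  have "converges_in_law D.mtopology M (\<lambda>n \<omega>. \<lambda>t\<in>{0..T}. S n t \<omega>) N (\<lambda>\<omega>. \<lambda>t\<in>{0..T}. B (a t) \<omega>)"
  proof (rule D.converges_in_law_lipschitzI)
    show "prob_space (M n)" for n by fact
    show "prob_space N" using \<open>standard_brownian_motion N B\<close> by (simp add: standard_brownian_motion_def)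
    show "(\<lambda>\<omega>. \<lambda>t\<in>{0..T}. S n t \<omega>) \<in> measurable (M n) (borel_sigma D.mtopology)" for n
      using measurable_partial_sums[OF c] by (simp add: skorohod_topology_def)
    show "(\<lambda>\<omega>. \<lambda>t\<in>{0..T}. B (a t) \<omega>) \<in> measurable N (borel_sigma D.mtopology)"
      using measurable_time_changed_brownian[OF \<open>standard_brownian_motion N B\<close>]
      by (simp add: skorohod_topology_def)
  qed (rule lipschitz_expectation_tendsto[OF c \<open>standard_brownian_motion N B\<close>])
  then show ?thesis by (simp add: S_def skorohod_topology_def)
qed

end
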